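(* Let $\mathbf{k}$ be a unitary commutative ring, $\Omega$ a nonempty set and $M$ a $\mathbf{k}$-module. Let $\mathrm{Sha}_\Omega(M)=M\otimes\mathrm{Sh}(\mathbf{k}\Omega\otimes M)$ with the binary operations $\prec_\omega$, $\omega\in\Omega$, be as defined in the context. Then $(\mathrm{Sha}_\Omega(M),(\prec_\omega)_{\omega\in\Omega})$, together with the natural map $j_M:M\to\mathrm{Sha}_\Omega(M)$, $a\mapsto a=a\otimes 1$, is the free matching Zinbiel algebra on $M$. That is, it is a matching Zinbiel algebra, and for every matching Zinbiel algebra $(D,(\circ_{\omega,D})_{\omega\in\Omega})$ and every module homomorphism $f:M\to D$ there is a unique matching Zinbiel algebra homomorphism $\bar f:\mathrm{Sha}_\Omega(M)\to D$ such that $f=\bar f\,j_M$.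
   Context: All modules, tensor products and linear maps are over a unitary commutative ring $\mathbf{k}$. A (left) matching Zinbiel algebra (indexed by $\Omega$) is a $\mathbf{k}$-module $Z$ together with a family of ($\mathbf{k}$-bilinear) binary operations $(\circ_\omega)_{\omega\in\Omega}$ such that $(x\circ_\alpha y)\circ_\beta z=x\circ_\alpha(y\circ_\beta z)+x\circ_\beta(z\circ_\alpha y)$ for all $x,y,z\in Z$ and $\alpha,\beta\in\Omega$. A homomorphism of matching Zinbiel algebras is a linear map $g$ with $g(x\circ_\omega y)=g(x)\circ_\omega g(y)$ for all $x,y$ and all $\omega\in\Omega$. Shuffle product algebra: for a $\mathbf{k}$-module $V$, $\mathrm{Sh}(V)$ is the module $\bigoplus_{k\ge 0}V^{\otimes k}$ ($V^{\otimes 0}=\mathbf{k}$) with the bilinear shuffle product $\sqcup\!\sqcup$ with unit $1\in\mathbf{k}$, defined recursively, for $\mathfrak a=a_1\otimes\mathfrak a'\in V^{\otimes m}$, $\mathfrak b=b_1\otimes \mathfrak b'\in V^{\otimes n}$, $m,n\ge1$, $\mathfrak a'\in V^{\otimes(m-1)}$, $\mathfrak b'\in V^{\otimes(n-1)}$, by $\mathfrak a\sqcup\!\sqcup\mathfrak b=a_1\otimes(\mathfrak a'\sqcup\!\sqcup\mathfrak b)+b_1\otimes(\mathfrak a\sqcup\!\sqcup\mathfrak b')$, where $\mathfrak a'$ (resp. $\mathfrak b'$) is $1\in\mathbf{k}$ (up to a scalar absorbed in $a_1$, resp. $b_1$) if $m=1$ (resp. $n=1$). Construction: $\mathbf{k}\Omega$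 is the free $\mathbf{k}$-module on $\Omega$, and $\mathrm{Sha}_\Omega(M):=M\otimes\mathrm{Sh}(\mathbf{k}\Omega\otimes M)=\bigoplus_{k\ge0}M\otimes(\mathbf{k}\Omega\otimes M)^{\otimes k}$ as a module. For $\omega\in\Omega$, the bilinear operation $\prec_\omega$ on $\mathrm{Sha}_\Omega(M)$ is determined by $$(a_0\otimes\bar{\mathfrak a})\prec_\omega(b_0\otimes\bar{\mathfrak b})=a_0\otimes\Big(\bar{\mathfrak a}\sqcup\!\sqcup\big((\omega\otimes b_0)\otimes\bar{\mathfrak b}\big)\Big)$$ for $a_0,b_0\in M$, $\bar{\mathfrak a}\in(\mathbf{k}\Omega\otimes M)^{\otimes m}$, $\bar{\mathfrak b}\in(\mathbf{k}\Omega\otimes M)^{\otimes n}$, $m,n\ge0$, where $(\omega\otimes b_0)\otimes\bar{\mathfrak b}\in(\mathbf{k}\Omega\otimes M)^{\otimes(n+1)}$. *)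

theory Defs
  imports "HOL-Algebra.Module" "HOL-Algebra.AbelCoset"
begin

section \<open>Linear and bilinear maps\<close>

definition mod_hom ::
  "('r, 'x) ring_scheme \<Rightarrow> ('r, 'a, 'y) module_scheme \<Rightarrow> ('r, 'b, 'z) module_scheme \<Rightarrow> ('a \<Rightarrow> 'b) set"
  where "mod_hom R M N =
    {h \<in> carrier M \<rightarrow> carrier N.
      (\<forall>x\<in>carrier M. \<forall>y\<in>carrier M. h (x \<oplus>\<^bsub>M\<^esub> y) = h x \<oplus>\<^bsub>N\<^esub> h y) \<and>
      (\<forall>r\<in>carrier R. \<forall>x\<in>carrier M. h (r \<odot>\<^bsub>M\<^esub> x) = r \<odot>\<^bsub>N\<^esub> h x)}"

definition bilinear_map ::
  "('r, 'x) ring_scheme \<Rightarrow> ('r, 'a, 'y) module_scheme \<Rightarrow> ('r, 'b, 'z) module_scheme \<Rightarrow>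
   ('r, 'c, 'w) module_scheme \<Rightarrow> ('a \<Rightarrow> 'b \<Rightarrow> 'c) \<Rightarrow> bool"
  where "bilinear_map R M N P f \<longleftrightarrow>
    (\<forall>x\<in>carrier M. f x \<in> mod_hom R N P) \<and>
    (\<forall>y\<in>carrier N. (\<lambda>x. f x y) \<in> mod_hom R M P)"


section \<open>Free modules, quotients, direct sums\<close>

text \<open>The type of modules in the library extends that of rings. The ring components
  \<open>mult\<close> and \<open>one\<close> of a module are irrelevant and are left undefined below.\<close>

definition free_module :: "('r, 'x) ring_scheme \<Rightarrow> 'b set \<Rightarrow> ('r, 'b \<Rightarrow> 'r) module"
  where "free_module R B =
    \<lparr>carrier = {c. (\<forall>b\<in>B. c b \<in> carrier R) \<and> (\<forall>b. b \<notin> B \<longrightarrow> c b = \<zero>\<^bsub>R\<^esub>) \<and> finite {b. c b \<noteq> \<zero>\<^bsub>R\<^esub>}},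
     mult = undefined, one = undefined,
     zero = (\<lambda>b. \<zero>\<^bsub>R\<^esub>), add = (\<lambda>c d b. c b \<oplus>\<^bsub>R\<^esub> d b),
     smult = (\<lambda>r c b. r \<otimes>\<^bsub>R\<^esub> c b)\<rparr>"

definition free_basis :: "('r, 'x) ring_scheme \<Rightarrow> 'b \<Rightarrow> 'b \<Rightarrow> 'r"
  where "free_basis R b = (\<lambda>b'. if b' = b then \<one>\<^bsub>R\<^esub> else \<zero>\<^bsub>R\<^esub>)"

definition submodule_gen ::
  "('r, 'x) ring_scheme \<Rightarrow> ('r, 'a, 'y) module_scheme \<Rightarrow> 'a set \<Rightarrow> 'a set"
  where "submodule_gen R M S = \<Inter>{H. submodule H R M \<and> S \<subseteq> H}"

definition quotient_module :: "('r, 'a, 'y) module_scheme \<Rightarrow> 'a set \<Rightarrow> ('r, 'a set) module"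
  where "quotient_module M N =
    \<lparr>carrier = a_rcosets\<^bsub>M\<^esub> N,
     mult = undefined, one = undefined,
     zero = N, add = set_add M,
     smult = (\<lambda>r C. \<Union>c\<in>C. N +>\<^bsub>M\<^esub> (r \<odot>\<^bsub>M\<^esub> c))\<rparr>"

definition direct_sum :: "(nat \<Rightarrow> ('r, 'a, 'y) module_scheme) \<Rightarrow> ('r, nat \<Rightarrow> 'a) module"
  where "direct_sum A =
    \<lparr>carrier = {s. (\<forall>n. s n \<in> carrier (A n)) \<and> finite {n. s n \<noteq> \<zero>\<^bsub>A n\<^esub>}},
     mult = undefined, one = undefined,
     zero = (\<lambda>n. \<zero>\<^bsub>A n\<^esub>), add = (\<lambda>s t n. s n \<oplus>\<^bsub>A n\<^esub> t n),
     smult = (\<lambda>r s n. r \<odot>\<^bsub>A n\<^esub> s n)\<rparr>"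

definition direct_sum_inj :: "(nat \<Rightarrow> ('r, 'a, 'y) module_scheme) \<Rightarrow> nat \<Rightarrow> 'a \<Rightarrow> nat \<Rightarrow> 'a"
  where "direct_sum_inj A n x = (\<lambda>i. if i = n then x else \<zero>\<^bsub>A i\<^esub>)"


section \<open>Tensor products and tensor powers\<close>

definition tensor_relations ::
  "('r, 'x) ring_scheme \<Rightarrow> ('r, 'a, 'y) module_scheme \<Rightarrow> ('r, 'b, 'z) module_scheme \<Rightarrow>
   ('a \<times> 'b \<Rightarrow> 'r) set"
  where "tensor_relations R M N =
    (let F = free_module R (carrier M \<times> carrier N); e = free_basis R in
      {e (x \<oplus>\<^bsub>M\<^esub> x', y) \<ominus>\<^bsub>F\<^esub> (e (x, y) \<oplus>\<^bsub>F\<^esub> e (x', y)) | x x' y.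
         x \<in> carrier M \<and> x' \<in> carrier M \<and> y \<in> carrier N} \<union>
      {e (x, y \<oplus>\<^bsub>N\<^esub> y') \<ominus>\<^bsub>F\<^esub> (e (x, y) \<oplus>\<^bsub>F\<^esub> e (x, y')) | x y y'.
         x \<in> carrier M \<and> y \<in> carrier N \<and> y' \<in> carrier N} \<union>
      {e (r \<odot>\<^bsub>M\<^esub> x, y) \<ominus>\<^bsub>F\<^esub> r \<odot>\<^bsub>F\<^esub> e (x, y) | r x y.
         r \<in> carrier R \<and> x \<in> carrier M \<and> y \<in> carrier N} \<union>
      {e (x, r \<odot>\<^bsub>N\<^esub> y) \<ominus>\<^bsub>F\<^esub> r \<odot>\<^bsub>F\<^esub> e (x, y) | r x y.
         r \<in> carrier R \<and> x \<in> carrier M \<and> y \<in> carrier N})"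

definition tensor_null ::
  "('r, 'x) ring_scheme \<Rightarrow> ('r, 'a, 'y) module_scheme \<Rightarrow> ('r, 'b, 'z) module_scheme \<Rightarrow>
   ('a \<times> 'b \<Rightarrow> 'r) set"
  where "tensor_null R M N =
    submodule_gen R (free_module R (carrier M \<times> carrier N)) (tensor_relations R M N)"

definition tensor ::
  "('r, 'x) ring_scheme \<Rightarrow> ('r, 'a, 'y) module_scheme \<Rightarrow> ('r, 'b, 'z) module_scheme \<Rightarrow>
   ('r, ('a \<times> 'b \<Rightarrow> 'r) set) module"
  where "tensor R M N =
    quotient_module (free_module R (carrier M \<times> carrier N)) (tensor_null R M N)"

definition tensor_pure ::
  "('r, 'x) ring_scheme \<Rightarrow> ('r, 'a, 'y) module_scheme \<Rightarrow> ('r, 'b, 'z) module_scheme \<Rightarrow>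
   'a \<Rightarrow> 'b \<Rightarrow> ('a \<times> 'b \<Rightarrow> 'r) set"
  where "tensor_pure R M N x y =
    tensor_null R M N +>\<^bsub>free_module R (carrier M \<times> carrier N)\<^esub> free_basis R (x, y)"

text \<open>The \<open>n\<close>-th tensor power of \<open>V\<close> is the free module on the lists of \<open>n\<close> elements of \<open>V\<close>
  modulo the relations of multilinearity. There are no relations for \<open>n = 0\<close>, where it is free
  on the empty list, that is, \<open>R\<close> itself.\<close>

definition words_of_length :: "('r, 'a, 'y) module_scheme \<Rightarrow> nat \<Rightarrow> 'a list set"
  where "words_of_length V n = {xs. length xs = n \<and> set xs \<subseteq> carrier V}"

definition tensor_power_relations ::
  "('r, 'x) ring_scheme \<Rightarrow> ('r, 'a, 'y) module_scheme \<Rightarrow> nat \<Rightarrow> ('a list \<Rightarrow> 'r) set"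
  where "tensor_power_relations R V n =
    (let F = free_module R (words_of_length V n); e = free_basis R in
      {e (us @ (x \<oplus>\<^bsub>V\<^esub> y) # vs) \<ominus>\<^bsub>F\<^esub> (e (us @ x # vs) \<oplus>\<^bsub>F\<^esub> e (us @ y # vs)) | us x y vs.
         us @ x # vs \<in> words_of_length V n \<and> y \<in> carrier V} \<union>
      {e (us @ (r \<odot>\<^bsub>V\<^esub> x) # vs) \<ominus>\<^bsub>F\<^esub> r \<odot>\<^bsub>F\<^esub> e (us @ x # vs) | us r x vs.
         us @ x # vs \<in> words_of_length V n \<and> r \<in> carrier R})"

definition tensor_power_null ::
  "('r, 'x) ring_scheme \<Rightarrow> ('r, 'a, 'y) module_scheme \<Rightarrow> nat \<Rightarrow> ('a list \<Rightarrow> 'r) set"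
  where "tensor_power_null R V n =
    submodule_gen R (free_module R (words_of_length V n)) (tensor_power_relations R V n)"

definition tensor_power ::
  "('r, 'x) ring_scheme \<Rightarrow> ('r, 'a, 'y) module_scheme \<Rightarrow> nat \<Rightarrow> ('r, ('a list \<Rightarrow> 'r) set) module"
  where "tensor_power R V n =
    quotient_module (free_module R (words_of_length V n)) (tensor_power_null R V n)"

text \<open>The element \<open>a \<otimes> t\<close> of the \<open>(n + 1)\<close>-st tensor power, for \<open>a \<in> V\<close> and \<open>t\<close> in the \<open>n\<close>-th:
  prepend \<open>a\<close> to every word of every representative \<open>c\<close> of \<open>t\<close>. All these representatives give
  the same coset.\<close>

definition tensor_power_cons ::
  "('r, 'x) ring_scheme \<Rightarrow> ('r, 'a, 'y) module_scheme \<Rightarrow> nat \<Rightarrow> 'a \<Rightarrow>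
   ('a list \<Rightarrow> 'r) set \<Rightarrow> ('a list \<Rightarrow> 'r) set"
  where "tensor_power_cons R V n a t =
    (\<Union>c\<in>t. tensor_power_null R V (Suc n) +>\<^bsub>free_module R (words_of_length V (Suc n))\<^esub>
      (\<lambda>xs. case xs of [] \<Rightarrow> \<zero>\<^bsub>R\<^esub> | x # xs' \<Rightarrow> if x = a then c xs' else \<zero>\<^bsub>R\<^esub>))"


section \<open>The shuffle product algebra\<close>

definition Sh ::
  "('r, 'x) ring_scheme \<Rightarrow> ('r, 'a, 'y) module_scheme \<Rightarrow> ('r, nat \<Rightarrow> ('a list \<Rightarrow> 'r) set) module"
  where "Sh R V = direct_sum (tensor_power R V)"

definition Sh_inj ::
  "('r, 'x) ring_scheme \<Rightarrow> ('r, 'a, 'y) module_scheme \<Rightarrow> nat \<Rightarrow> ('a list \<Rightarrow> 'r) set \<Rightarrow>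
   nat \<Rightarrow> ('a list \<Rightarrow> 'r) set"
  where "Sh_inj R V = direct_sum_inj (tensor_power R V)"

definition Sh_one ::
  "('r, 'x) ring_scheme \<Rightarrow> ('r, 'a, 'y) module_scheme \<Rightarrow> nat \<Rightarrow> ('a list \<Rightarrow> 'r) set"
  where "Sh_one R V = Sh_inj R V 0
    (tensor_power_null R V 0 +>\<^bsub>free_module R (words_of_length V 0)\<^esub> free_basis R [])"

text \<open>The map \<open>s \<mapsto> a \<otimes> s\<close>, raising every degree by one.\<close>

definition Sh_cons ::
  "('r, 'x) ring_scheme \<Rightarrow> ('r, 'a, 'y) module_scheme \<Rightarrow> 'a \<Rightarrow>
   (nat \<Rightarrow> ('a list \<Rightarrow> 'r) set) \<Rightarrow> nat \<Rightarrow> ('a list \<Rightarrow> 'r) set"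
  where "Sh_cons R V a s =
    (\<lambda>n. case n of 0 \<Rightarrow> \<zero>\<^bsub>tensor_power R V 0\<^esub> | Suc k \<Rightarrow> tensor_power_cons R V k a (s k))"

text \<open>The recursion determines the bilinear operation on the carrier of \<open>Sh R V\<close>. Since \<open>s\<close> and
  \<open>t\<close> range over degree \<open>0\<close> as well, scalars in front of \<open>a\<close> and \<open>b\<close> are covered.\<close>

definition is_shuffle_product ::
  "('r, 'x) ring_scheme \<Rightarrow> ('r, 'a, 'y) module_scheme \<Rightarrow>
   ((nat \<Rightarrow> ('a list \<Rightarrow> 'r) set) \<Rightarrow> (nat \<Rightarrow> ('a list \<Rightarrow> 'r) set) \<Rightarrow> nat \<Rightarrow> ('a list \<Rightarrow> 'r) set) \<Rightarrow> bool"
  where "is_shuffle_product R V p \<longleftrightarrow>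
    bilinear_map R (Sh R V) (Sh R V) (Sh R V) p \<and>
    (\<forall>s\<in>carrier (Sh R V). p (Sh_one R V) s = s \<and> p s (Sh_one R V) = s) \<and>
    (\<forall>a\<in>carrier V. \<forall>b\<in>carrier V. \<forall>m n.
      \<forall>s\<in>carrier (tensor_power R V m). \<forall>t\<in>carrier (tensor_power R V n).
       let \<aa> = Sh_inj R V (Suc m) (tensor_power_cons R V m a s);
           \<bb> = Sh_inj R V (Suc n) (tensor_power_cons R V n b t)
       in p \<aa> \<bb> = Sh_cons R V a (p (Sh_inj R V m s) \<bb>) \<oplus>\<^bsub>Sh R V\<^esub> Sh_cons R V b (p \<aa> (Sh_inj R V n t)))"

definition shuffle_product ::
  "('r, 'x) ring_scheme \<Rightarrow> ('r, 'a, 'y) module_scheme \<Rightarrow>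
   (nat \<Rightarrow> ('a list \<Rightarrow> 'r) set) \<Rightarrow> (nat \<Rightarrow> ('a list \<Rightarrow> 'r) set) \<Rightarrow> nat \<Rightarrow> ('a list \<Rightarrow> 'r) set"
  where "shuffle_product R V = (SOME p. is_shuffle_product R V p)"


section \<open>Matching Zinbiel algebras\<close>

locale matching_zinbiel_algebra = module R Z
  for R :: "('r, 'x) ring_scheme" (structure) and \<Omega> :: "'o set"
    and Z :: "('r, 'a, 'y) module_scheme" (structure) and circ :: "'o \<Rightarrow> 'a \<Rightarrow> 'a \<Rightarrow> 'a" +
  assumes bilinear: "\<omega> \<in> \<Omega> \<Longrightarrow> bilinear_map R Z Z Z (circ \<omega>)"
    and matching_zinbiel:
      "\<lbrakk>\<alpha> \<in> \<Omega>; \<beta> \<in> \<Omega>; x \<in> carrier Z; y \<in> carrier Z; z \<in> carrier Z\<rbrakk> \<Longrightarrow>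
        circ \<beta> (circ \<alpha> x y) z = circ \<alpha> x (circ \<beta> y z) \<oplus>\<^bsub>Z\<^esub> circ \<beta> x (circ \<alpha> z y)"

definition matching_zinbiel_hom ::
  "('r, 'x) ring_scheme \<Rightarrow> 'o set \<Rightarrow>
   ('r, 'a, 'y) module_scheme \<Rightarrow> ('o \<Rightarrow> 'a \<Rightarrow> 'a \<Rightarrow> 'a) \<Rightarrow>
   ('r, 'b, 'z) module_scheme \<Rightarrow> ('o \<Rightarrow> 'b \<Rightarrow> 'b \<Rightarrow> 'b) \<Rightarrow> ('a \<Rightarrow> 'b) set"
  where "matching_zinbiel_hom R \<Omega> Z circ Z' circ' =
    {g \<in> mod_hom R Z Z'. \<forall>\<omega>\<in>\<Omega>. \<forall>x\<in>carrier Z. \<forall>y\<in>carrier Z.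
      g (circ \<omega> x y) = circ' \<omega> (g x) (g y)}"


section \<open>The module \<open>Sha\<close> and its operations\<close>

type_synonym ('r, 'o, 'm) letter = "(('o \<Rightarrow> 'r) \<times> 'm \<Rightarrow> 'r) set"

type_synonym ('r, 'o, 'm) sha = "('m \<times> (nat \<Rightarrow> (('r, 'o, 'm) letter list \<Rightarrow> 'r) set) \<Rightarrow> 'r) set"

definition letters ::
  "('r, 'x) ring_scheme \<Rightarrow> 'o set \<Rightarrow> ('r, 'm, 'y) module_scheme \<Rightarrow> ('r, ('r, 'o, 'm) letter) module"
  where "letters R \<Omega> M = tensor R (free_module R \<Omega>) M"

definition letter ::
  "('r, 'x) ring_scheme \<Rightarrow> 'o set \<Rightarrow> ('r, 'm, 'y) module_scheme \<Rightarrow> 'o \<Rightarrow> 'm \<Rightarrow> ('r, 'o, 'm) letter"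
  where "letter R \<Omega> M \<omega> b = tensor_pure R (free_module R \<Omega>) M (free_basis R \<omega>) b"

definition Sha ::
  "('r, 'x) ring_scheme \<Rightarrow> 'o set \<Rightarrow> ('r, 'm, 'y) module_scheme \<Rightarrow> ('r, ('r, 'o, 'm) sha) module"
  where "Sha R \<Omega> M = tensor R M (Sh R (letters R \<Omega> M))"

definition Sha_pure ::
  "('r, 'x) ring_scheme \<Rightarrow> 'o set \<Rightarrow> ('r, 'm, 'y) module_scheme \<Rightarrow>
   'm \<Rightarrow> (nat \<Rightarrow> (('r, 'o, 'm) letter list \<Rightarrow> 'r) set) \<Rightarrow> ('r, 'o, 'm) sha"
  where "Sha_pure R \<Omega> M = tensor_pure R M (Sh R (letters R \<Omega> M))"

definition Sha_emb ::
  "('r, 'x) ring_scheme \<Rightarrow> 'o set \<Rightarrow> ('r, 'm, 'y) module_scheme \<Rightarrow> 'm \<Rightarrow> ('r, 'o, 'm) sha"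
  where "Sha_emb R \<Omega> M a = Sha_pure R \<Omega> M a (Sh_one R (letters R \<Omega> M))"

text \<open>The formula determines the bilinear operation on the carrier of \<open>Sha R \<Omega> M\<close>.\<close>

definition is_Sha_prec ::
  "('r, 'x) ring_scheme \<Rightarrow> 'o set \<Rightarrow> ('r, 'm, 'y) module_scheme \<Rightarrow> 'o \<Rightarrow>
   (('r, 'o, 'm) sha \<Rightarrow> ('r, 'o, 'm) sha \<Rightarrow> ('r, 'o, 'm) sha) \<Rightarrow> bool"
  where "is_Sha_prec R \<Omega> M \<omega> p \<longleftrightarrow>
    (let V = letters R \<Omega> M in
      bilinear_map R (Sha R \<Omega> M) (Sha R \<Omega> M) (Sha R \<Omega> M) p \<and>
      (\<forall>a\<in>carrier M. \<forall>b\<in>carrier M. \<forall>m n.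
        \<forall>s\<in>carrier (tensor_power R V m). \<forall>t\<in>carrier (tensor_power R V n).
         p (Sha_pure R \<Omega> M a (Sh_inj R V m s)) (Sha_pure R \<Omega> M b (Sh_inj R V n t)) =
         Sha_pure R \<Omega> M a
           (shuffle_product R V (Sh_inj R V m s)
             (Sh_inj R V (Suc n) (tensor_power_cons R V n (letter R \<Omega> M \<omega> b) t)))))"

definition Sha_prec ::
  "('r, 'x) ring_scheme \<Rightarrow> 'o set \<Rightarrow> ('r, 'm, 'y) module_scheme \<Rightarrow> 'o \<Rightarrow>
   ('r, 'o, 'm) sha \<Rightarrow> ('r, 'o, 'm) sha \<Rightarrow> ('r, 'o, 'm) sha"
  where "Sha_prec R \<Omega> M \<omega> = (SOME p. is_Sha_prec R \<Omega> M \<omega> p)"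

end

theory Submission
  imports Defs
begin

text \<open>
  Every operation on \<^const>\<open>Sha\<close> is determined by words. By the formula for the operations,
  \<open>a \<otimes> (\<omega> \<otimes> b) \<otimes> w\<close> is the product of \<open>a\<close> and \<open>b \<otimes> w\<close> with respect to \<open>\<omega>\<close>. A pure tensor
  \<open>a\<^sub>0 \<otimes> (\<omega>\<^sub>1 \<otimes> a\<^sub>1) \<otimes> \<dots> \<otimes> (\<omega>\<^sub>n \<otimes> a\<^sub>n)\<close> is therefore the product of \<open>a\<^sub>0, \<dots>, a\<^sub>n\<close>, bracketed to the right,
  and a homomorphism that extends \<open>f\<close> has to send it to the corresponding product of the \<open>f a\<^sub>i\<close>. This is
  uniqueness (\<open>Sha_hom_unique\<close>), and it is also the definition of the extension (\<open>nested_product\<close>).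

  The matching Zinbiel identity in \<^const>\<open>Sha\<close> is the recursion of the shuffle product for two words that
  begin with \<open>\<alpha> \<otimes> b\<close> and \<open>\<beta> \<otimes> c\<close>, combined with associativity and commutativity of that product
  (\<open>Sha_zinbiel_pure\<close>, \<open>shuffle_assoc\<close>, \<open>shuffle_commute\<close>). Conversely the identity in the target
  algebra says that right-bracketed products multiply by the recursion of the shuffle product; an induction
  on the lengths of the two words then makes the extension a homomorphism (\<open>np_shuffle\<close>).

  What remains is that all these maps, given by recursion on words, exist on the modules in question. Tensor
  products, tensor powers and direct sums get a universal property for linear maps and a spanning set each.
  Everything else rests on two principles about spanning sets: linear maps that agree on a spanning set are
  equal (\<open>spans_hom_eq\<close>), and a function of two generators extends to a bilinear map as soon as it extends
  linearly in each argument separately (\<open>bilinear_extension\<close>).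
\<close>

section \<open>Linear maps, submodules and spanning sets\<close>

lemma mod_homI:
  assumes "\<And>x. x \<in> carrier M \<Longrightarrow> h x \<in> carrier N"
    and "\<And>x y. \<lbrakk>x \<in> carrier M; y \<in> carrier M\<rbrakk> \<Longrightarrow> h (x \<oplus>\<^bsub>M\<^esub> y) = h x \<oplus>\<^bsub>N\<^esub> h y"
    and "\<And>r x. \<lbrakk>r \<in> carrier R; x \<in> carrier M\<rbrakk> \<Longrightarrow> h (r \<odot>\<^bsub>M\<^esub> x) = r \<odot>\<^bsub>N\<^esub> h x"
  shows "h \<in> mod_hom R M N"
  using assms by (simp add: mod_hom_def)

lemma mod_hom_closed: "\<lbrakk>h \<in> mod_hom R M N; x \<in> carrier M\<rbrakk> \<Longrightarrow> h x \<in> carrier N"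
  by (auto simp: mod_hom_def)

lemma mod_hom_add:
  "\<lbrakk>h \<in> mod_hom R M N; x \<in> carrier M; y \<in> carrier M\<rbrakk> \<Longrightarrow> h (x \<oplus>\<^bsub>M\<^esub> y) = h x \<oplus>\<^bsub>N\<^esub> h y"
  by (auto simp: mod_hom_def)

lemma mod_hom_smult:
  "\<lbrakk>h \<in> mod_hom R M N; r \<in> carrier R; x \<in> carrier M\<rbrakk> \<Longrightarrow> h (r \<odot>\<^bsub>M\<^esub> x) = r \<odot>\<^bsub>N\<^esub> h x"
  by (auto simp: mod_hom_def)

lemma mod_hom_zero:
  assumes "module R M" "module R N" "h \<in> mod_hom R M N"
  shows "h \<zero>\<^bsub>M\<^esub> = \<zero>\<^bsub>N\<^esub>"
proof -
  interpret M: module R M by fact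
  interpret N: module R N by fact
  have "h (\<zero>\<^bsub>R\<^esub> \<odot>\<^bsub>M\<^esub> \<zero>\<^bsub>M\<^esub>) = \<zero>\<^bsub>R\<^esub> \<odot>\<^bsub>N\<^esub> h \<zero>\<^bsub>M\<^esub>"
    using assms(3) by (rule mod_hom_smult) auto
  then show ?thesis
    using mod_hom_closed[OF assms(3)] by simp
qed

lemma mod_hom_minus:
  assumes "module R M" "module R N" "h \<in> mod_hom R M N" "x \<in> carrier M" "y \<in> carrier M"
  shows "h (x \<ominus>\<^bsub>M\<^esub> y) = h x \<ominus>\<^bsub>N\<^esub> h y"
proof -
  interpret M: module R M by fact
  interpret N: module R N by fact
  have *: "h (\<ominus>\<^bsub>M\<^esub> y) = \<ominus>\<^bsub>N\<^esub> h y"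
    by (metis M.R.one_closed M.R.add.inv_closed M.smult_l_minus M.smult_one N.smult_l_minus
        N.smult_one assms(3,5) mod_hom_closed mod_hom_smult)
  show ?thesis
    by (simp add: M.minus_eq N.minus_eq * mod_hom_add[OF assms(3)] assms)
qed

lemma hom_minus_eq_zero_iff:
  assumes "module R M" "module R N" "h \<in> mod_hom R M N" "x \<in> carrier M" "y \<in> carrier M"
  shows "h (x \<ominus>\<^bsub>M\<^esub> y) = \<zero>\<^bsub>N\<^esub> \<longleftrightarrow> h x = h y"
proof -
  interpret N: module R N by fact
  have "a \<ominus>\<^bsub>N\<^esub> b = \<zero>\<^bsub>N\<^esub> \<longleftrightarrow> a = b" if "a \<in> carrier N" "b \<in> carrier N" for a b
    using that by (metis N.M.add.inv_closed N.M.minus_equality N.M.minus_minus N.M.minus_eq N.M.r_neg)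
  then show ?thesis
    using mod_hom_minus[OF assms] mod_hom_closed[OF assms(3,4)] mod_hom_closed[OF assms(3,5)]
    by simp
qed

lemma mod_hom_id: "(\<lambda>x. x) \<in> mod_hom R M M"
  by (auto intro: mod_homI)

lemma mod_hom_comp:
  assumes "g \<in> mod_hom R N P" "h \<in> mod_hom R M N"
  shows "(\<lambda>x. g (h x)) \<in> mod_hom R M P"
  using assms by (auto simp: mod_hom_def Pi_def)

lemma mod_hom_sum:
  assumes "module R N" "g \<in> mod_hom R M N" "h \<in> mod_hom R M N"
  shows "(\<lambda>x. g x \<oplus>\<^bsub>N\<^esub> h x) \<in> mod_hom R M N"
proof -
  interpret N: module R N by fact
  note c = mod_hom_closed[OF assms(2)] mod_hom_closed[OF assms(3)]
  show ?thesis
    by (rule mod_homI)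
      (simp_all add: c mod_hom_add[OF assms(2)] mod_hom_add[OF assms(3)]
        mod_hom_smult[OF assms(2)] mod_hom_smult[OF assms(3)] N.smult_r_distr N.a_ac)
qed

lemma mod_hom_scale:
  assumes "module R N" "h \<in> mod_hom R M N" "r \<in> carrier R"
  shows "(\<lambda>x. r \<odot>\<^bsub>N\<^esub> h x) \<in> mod_hom R M N"
proof -
  interpret N: module R N by fact
  note c = mod_hom_closed[OF assms(2)]
  have "r \<odot>\<^bsub>N\<^esub> (s \<odot>\<^bsub>N\<^esub> x) = s \<odot>\<^bsub>N\<^esub> (r \<odot>\<^bsub>N\<^esub> x)" if "s \<in> carrier R" "x \<in> carrier N" for s x
    using that assms(3) by (metis N.m_comm N.smult_assoc1)
  then show ?thesis
    using assms(3)
    by (intro mod_homI)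
      (simp_all add: c mod_hom_add[OF assms(2)] mod_hom_smult[OF assms(2)] N.smult_r_distr)
qed

lemma mod_hom_const_zero:
  assumes "module R N"
  shows "(\<lambda>x. \<zero>\<^bsub>N\<^esub>) \<in> mod_hom R M N"
proof -
  interpret N: module R N by fact
  show ?thesis by (rule mod_homI) auto
qed

lemma bilinear_mapI:
  assumes "\<And>x. x \<in> carrier M \<Longrightarrow> f x \<in> mod_hom R N P"
    and "\<And>y. y \<in> carrier N \<Longrightarrow> (\<lambda>x. f x y) \<in> mod_hom R M P"
  shows "bilinear_map R M N P f"
  using assms by (simp add: bilinear_map_def)

lemma bilinear_map_right: "\<lbrakk>bilinear_map R M N P f; x \<in> carrier M\<rbrakk> \<Longrightarrow> f x \<in> mod_hom R N P"
  by (simp add: bilinear_map_def)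

lemma bilinear_map_left:
  "\<lbrakk>bilinear_map R M N P f; y \<in> carrier N\<rbrakk> \<Longrightarrow> (\<lambda>x. f x y) \<in> mod_hom R M P"
  by (simp add: bilinear_map_def)

lemma bilinear_map_closed:
  "\<lbrakk>bilinear_map R M N P f; x \<in> carrier M; y \<in> carrier N\<rbrakk> \<Longrightarrow> f x y \<in> carrier P"
  by (metis bilinear_map_right mod_hom_closed)

lemma bilinear_map_comp_left:
  assumes "bilinear_map R M N P f" "h \<in> mod_hom R L M" "y \<in> carrier N"
  shows "(\<lambda>x. f (h x) y) \<in> mod_hom R L P"
  using mod_hom_comp[OF bilinear_map_left[OF assms(1,3)] assms(2)] .

lemma bilinear_map_comp_right:
  assumes "bilinear_map R M N P f" "h \<in> mod_hom R L N" "x \<in> carrier M"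
  shows "(\<lambda>y. f x (h y)) \<in> mod_hom R L P"
  using mod_hom_comp[OF bilinear_map_right[OF assms(1,3)] assms(2)] .

lemma submodule_of_closed:
  assumes "module R M" "H \<subseteq> carrier M" "\<zero>\<^bsub>M\<^esub> \<in> H"
    and "\<And>x y. \<lbrakk>x \<in> H; y \<in> H\<rbrakk> \<Longrightarrow> x \<oplus>\<^bsub>M\<^esub> y \<in> H"
    and "\<And>r x. \<lbrakk>r \<in> carrier R; x \<in> H\<rbrakk> \<Longrightarrow> r \<odot>\<^bsub>M\<^esub> x \<in> H"
  shows "submodule H R M"
proof -
  interpret M: module R M by fact
  show ?thesis
  proof (rule M.submoduleI[OF assms(2,3) _ assms(4,5)])
    fix a assume "a \<in> H"
    then show "\<ominus>\<^bsub>M\<^esub> a \<in> H"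
      \<comment> \<open>Closure under negatives is closure under the scalar \<open>- 1\<close>.\<close>
      using assms(5)[of "\<ominus>\<^bsub>R\<^esub> \<one>\<^bsub>R\<^esub>" a] assms(2) by (auto simp: M.smult_l_minus)
  qed auto
qed

lemma submodule_zero: "submodule H R M \<Longrightarrow> \<zero>\<^bsub>M\<^esub> \<in> H"
  using subgroup.one_closed[OF submodule.axioms(1)] by force

lemma submodule_add: "\<lbrakk>submodule H R M; x \<in> H; y \<in> H\<rbrakk> \<Longrightarrow> x \<oplus>\<^bsub>M\<^esub> y \<in> H"
  using subgroup.m_closed[OF submodule.axioms(1)] by force

lemma submodule_subset: "submodule H R M \<Longrightarrow> H \<subseteq> carrier M"
  using subgroup.subset[OF submodule.axioms(1)] by force

lemma submodule_equalizer:
  assumes "module R M" "module R N" "g \<in> mod_hom R M N" "h \<in> mod_hom R M N"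
  shows "submodule {x \<in> carrier M. g x = h x} R M"
proof -
  interpret M: module R M by fact
  show ?thesis
    by (rule submodule_of_closed[OF assms(1)])
      (auto simp: mod_hom_zero[OF assms(1,2)] mod_hom_add[OF assms(3)] mod_hom_add[OF assms(4)]
        mod_hom_smult[OF assms(3)] mod_hom_smult[OF assms(4)] assms)
qed

lemma submodule_vimage:
  assumes "module R M" "module R N" "h \<in> mod_hom R M N" "submodule H R N"
  shows "submodule {x \<in> carrier M. h x \<in> H} R M"
proof -
  interpret M: module R M by fact
  show ?thesis
    by (rule submodule_of_closed[OF assms(1)])
      (auto simp: mod_hom_zero[OF assms(1,2)] mod_hom_add[OF assms(3)] mod_hom_smult[OF assms(3)]
        assms submodule_zero[OF assms(4)] submodule_add[OF assms(4)]
        submodule.smult_closed[OF assms(4)])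
qed

text \<open>This says that \<open>S\<close> generates \<open>M\<close>, in the form of an induction principle: an identity between linear
  maps, whose solutions form a submodule, has to be checked on \<open>S\<close> only.\<close>

definition spans :: "('r, 'x) ring_scheme \<Rightarrow> ('r, 'a, 'y) module_scheme \<Rightarrow> 'a set \<Rightarrow> bool"
  where "spans R M S \<longleftrightarrow> S \<subseteq> carrier M \<and> (\<forall>H. submodule H R M \<longrightarrow> S \<subseteq> H \<longrightarrow> carrier M \<subseteq> H)"

lemma spansI:
  assumes "S \<subseteq> carrier M"
    and "\<And>H x. \<lbrakk>submodule H R M; S \<subseteq> H; x \<in> carrier M\<rbrakk> \<Longrightarrow> x \<in> H"
  shows "spans R M S"
  using assms unfolding spans_def by auto

lemma spans_subset: "spans R M S \<Longrightarrow> S \<subseteq> carrier M"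
  by (simp add: spans_def)

lemma spansD: "\<lbrakk>spans R M S; submodule H R M; S \<subseteq> H; x \<in> carrier M\<rbrakk> \<Longrightarrow> x \<in> H"
  unfolding spans_def by auto

lemma spans_carrier: "spans R M (carrier M)"
  by (auto intro: spansI)

lemma spans_hom_eq:
  assumes "spans R M S" "module R M" "module R N" "g \<in> mod_hom R M N" "h \<in> mod_hom R M N"
    and "\<And>x. x \<in> S \<Longrightarrow> g x = h x" and "x \<in> carrier M"
  shows "g x = h x"
  using spansD[OF assms(1) submodule_equalizer[OF assms(2-5)] _ assms(7)]
    assms(6) spans_subset[OF assms(1)] by auto

lemma spans_bilinear_eq:
  assumes "spans R M S" "spans R N T" "module R M" "module R N" "module R P"
    and "bilinear_map R M N P f" "bilinear_map R M N P g"
    and "\<And>x y. \<lbrakk>x \<in> S; y \<in> T\<rbrakk> \<Longrightarrow> f x y = g x y" and "x \<in> carrier M" "y \<in> carrier N"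
  shows "f x y = g x y"
proof -
  have *: "f s y = g s y" if s: "s \<in> S" for s
  proof (rule spans_hom_eq[OF assms(2,4,5), where g = "f s" and h = "g s"])
    show "f s \<in> mod_hom R N P" "g s \<in> mod_hom R N P"
      using assms(6,7) s spans_subset[OF assms(1)] by (auto intro: bilinear_map_right)
  qed (use s assms in auto)
  show ?thesis
    by (rule spans_hom_eq[OF assms(1,3,5), where g = "\<lambda>x. f x y" and h = "\<lambda>x. g x y"])
      (use * assms in \<open>auto intro: bilinear_map_left\<close>)
qed

lemma mod_hom_cong:
  assumes "module R M" "h \<in> mod_hom R M N" "\<And>x. x \<in> carrier M \<Longrightarrow> g x = h x"
  shows "g \<in> mod_hom R M N"
proof -
  interpret M: module R M by fact
  show ?thesis
    by (rule mod_homI)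
      (simp_all add: assms(3) mod_hom_closed[OF assms(2)] mod_hom_add[OF assms(2)] mod_hom_smult[OF assms(2)])
qed

text \<open>For fixed \<open>y\<close> and \<open>z\<close> both sides of \<open>f x (y + z) = f x y + f x z\<close> are linear in \<open>x\<close>, so that this
  identity spreads from a spanning set to all \<open>x\<close>; likewise for scalars. This turns linearity in a
  hidden argument, such as a letter inside a word, into a check on generators.\<close>

lemma bilinear_map_if_linear_on_spanning_set:
  assumes "spans R M S" and M: "module R M" and N: "module R N" and P: "module R P"
    and l: "\<And>y. y \<in> carrier N \<Longrightarrow> (\<lambda>x. f x y) \<in> mod_hom R M P"
    and r: "\<And>x. x \<in> S \<Longrightarrow> f x \<in> mod_hom R N P"
  shows "bilinear_map R M N P f"
proof (intro bilinear_mapI l mod_homI)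
  interpret N: module R N by fact
  note eq = spans_hom_eq[OF assms(1) M P]
  fix x y assume x: "x \<in> carrier M" and y: "y \<in> carrier N"
  show "f x y \<in> carrier P"
    by (rule mod_hom_closed[OF l[OF y] x])
  show "f x (y \<oplus>\<^bsub>N\<^esub> z) = f x y \<oplus>\<^bsub>P\<^esub> f x z" if z: "z \<in> carrier N" for z
    by (rule eq[OF l mod_hom_sum[OF P l l] _ x]) (use y z in \<open>auto intro: mod_hom_add[OF r]\<close>)
  show "f x (c \<odot>\<^bsub>N\<^esub> y) = c \<odot>\<^bsub>P\<^esub> f x y" if c: "c \<in> carrier R" for c
    by (rule eq[OF l mod_hom_scale[OF P l] _ x]) (use y c in \<open>auto intro: mod_hom_smult[OF r]\<close>)
qed

text \<open>Bilinear maps are built from values on generators without a module of homomorphisms and without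
  a presentation of \<open>P\<close> or \<open>Q\<close>. For \<open>b\<close> in \<open>B\<close> let \<open>k b\<close> be the given linear map on \<open>Q\<close>. The elements
  \<open>y\<close> for which some linear map on \<open>P\<close> sends every \<open>\<iota> b\<close> to \<open>k b y\<close> form a submodule, because such maps
  can be added and scaled. It contains the generators \<open>\<kappa> c\<close>, hence it is all of \<open>Q\<close>. On \<open>P\<close> the map found
  for \<open>y\<close> is unique because \<open>\<iota> ` B\<close> spans \<open>P\<close>, and therefore depends linearly on \<open>y\<close>.\<close>

lemma bilinear_extension:
  assumes P: "spans R P (\<iota> ` B)" "module R P" and Q: "spans R Q (\<kappa> ` C)" "module R Q"
    and N: "module R N"
    and l: "\<And>c. c \<in> C \<Longrightarrow> \<exists>h \<in> mod_hom R P N. \<forall>b\<in>B. h (\<iota> b) = \<phi> b c"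
    and r: "\<And>b. b \<in> B \<Longrightarrow> \<exists>h \<in> mod_hom R Q N. \<forall>c\<in>C. h (\<kappa> c) = \<phi> b c"
  shows "\<exists>F. bilinear_map R P Q N F \<and> (\<forall>b\<in>B. \<forall>c\<in>C. F (\<iota> b) (\<kappa> c) = \<phi> b c)"
proof -
  interpret P: module R P by fact
  interpret Q: module R Q by fact
  interpret N: module R N by fact
  have \<iota>: "\<iota> b \<in> carrier P" if "b \<in> B" for b using spans_subset[OF P(1)] that by auto
  have \<kappa>: "\<kappa> c \<in> carrier Q" if "c \<in> C" for c using spans_subset[OF Q(1)] that by auto
  obtain k where k: "\<And>b. b \<in> B \<Longrightarrow> k b \<in> mod_hom R Q N"
    and k_\<kappa>: "\<And>b c. \<lbrakk>b \<in> B; c \<in> C\<rbrakk> \<Longrightarrow> k b (\<kappa> c) = \<phi> b c"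
    using r by metis
  define H where "H = {y \<in> carrier Q. \<exists>g \<in> mod_hom R P N. \<forall>b\<in>B. g (\<iota> b) = k b y}"
  have "submodule H R Q"
  proof (rule submodule_of_closed[OF Q(2)])
    have "\<forall>b\<in>B. \<zero>\<^bsub>N\<^esub> = k b \<zero>\<^bsub>Q\<^esub>"
      using mod_hom_zero[OF Q(2) N k] by simp
    then show "\<zero>\<^bsub>Q\<^esub> \<in> H"
      unfolding H_def using Q.zero_closed mod_hom_const_zero[OF N, where M = P]
      by (intro CollectI conjI bexI[of _ "\<lambda>x. \<zero>\<^bsub>N\<^esub>"]) auto
  next
    fix x y assume "x \<in> H" "y \<in> H"
    then obtain g h where xy: "x \<in> carrier Q" "y \<in> carrier Q"
      and gh: "g \<in> mod_hom R P N" "h \<in> mod_hom R P N"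
      and "\<forall>b\<in>B. g (\<iota> b) = k b x" "\<forall>b\<in>B. h (\<iota> b) = k b y"
      unfolding H_def by auto
    then have "\<forall>b\<in>B. g (\<iota> b) \<oplus>\<^bsub>N\<^esub> h (\<iota> b) = k b (x \<oplus>\<^bsub>Q\<^esub> y)"
      by (simp add: mod_hom_add[OF k])
    then show "x \<oplus>\<^bsub>Q\<^esub> y \<in> H"
      unfolding H_def using xy mod_hom_sum[OF N gh]
      by (intro CollectI conjI bexI[of _ "\<lambda>x. g x \<oplus>\<^bsub>N\<^esub> h x"]) auto
  next
    fix t y assume t: "t \<in> carrier R" and "y \<in> H"
    then obtain g where y: "y \<in> carrier Q" and g: "g \<in> mod_hom R P N"
      and "\<forall>b\<in>B. g (\<iota> b) = k b y"
      unfolding H_def by auto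
    then have "\<forall>b\<in>B. t \<odot>\<^bsub>N\<^esub> g (\<iota> b) = k b (t \<odot>\<^bsub>Q\<^esub> y)"
      by (simp add: mod_hom_smult[OF k] t)
    then show "t \<odot>\<^bsub>Q\<^esub> y \<in> H"
      unfolding H_def using y t mod_hom_scale[OF N g t]
      by (intro CollectI conjI bexI[of _ "\<lambda>x. t \<odot>\<^bsub>N\<^esub> g x"]) auto
  qed (auto simp: H_def)
  moreover have "\<kappa> ` C \<subseteq> H"
    unfolding H_def using l k_\<kappa> \<kappa> by fastforce
  ultimately have "\<exists>g \<in> mod_hom R P N. \<forall>b\<in>B. g (\<iota> b) = k b y" if "y \<in> carrier Q" for y
    using spansD[OF Q(1), of H y] that unfolding H_def by auto
  then obtain g where g: "\<And>y. y \<in> carrier Q \<Longrightarrow> g y \<in> mod_hom R P N"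
    and g_\<iota>: "\<And>y b. \<lbrakk>y \<in> carrier Q; b \<in> B\<rbrakk> \<Longrightarrow> g y (\<iota> b) = k b y"
    by metis
  have "bilinear_map R P Q N (\<lambda>x y. g y x)"
    by (rule bilinear_map_if_linear_on_spanning_set[OF P Q(2) N])
      (use g g_\<iota> in \<open>auto intro: mod_hom_cong[OF Q(2) k]\<close>)
  moreover have "g (\<kappa> c) (\<iota> b) = \<phi> b c" if "b \<in> B" "c \<in> C" for b c
    using that g_\<iota> k_\<kappa> \<kappa> by simp
  ultimately show ?thesis by blast
qed

section \<open>Free modules\<close>

lemma free_module_simps [simp]:
  "\<zero>\<^bsub>free_module R B\<^esub> = (\<lambda>b. \<zero>\<^bsub>R\<^esub>)"
  "c \<oplus>\<^bsub>free_module R B\<^esub> d = (\<lambda>b. c b \<oplus>\<^bsub>R\<^esub> d b)"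
  "r \<odot>\<^bsub>free_module R B\<^esub> c = (\<lambda>b. r \<otimes>\<^bsub>R\<^esub> c b)"
  by (simp_all add: free_module_def)

lemma free_module_carrier:
  "c \<in> carrier (free_module R B) \<longleftrightarrow>
    (\<forall>b\<in>B. c b \<in> carrier R) \<and> (\<forall>b. b \<notin> B \<longrightarrow> c b = \<zero>\<^bsub>R\<^esub>) \<and> finite {b. c b \<noteq> \<zero>\<^bsub>R\<^esub>}"
  by (simp add: free_module_def)

lemma free_module_coeff:
  assumes "cring R" "c \<in> carrier (free_module R B)"
  shows "c b \<in> carrier R"
proof -
  interpret cring R by fact
  show ?thesis using assms(2) by (cases "b \<in> B") (auto simp: free_module_carrier)
qed

lemma module_free_module:
  assumes "cring R"
  shows "module R (free_module R B)"
proof -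
  interpret cring R by fact
  let ?F = "free_module R B"
  note c = free_module_coeff[OF assms]
  have add: "(\<lambda>b. c b \<oplus>\<^bsub>R\<^esub> d b) \<in> carrier ?F" if "c \<in> carrier ?F" "d \<in> carrier ?F" for c d
    using that by (auto simp: free_module_carrier
        intro: finite_subset[of _ "{b. c b \<noteq> \<zero>\<^bsub>R\<^esub>} \<union> {b. d b \<noteq> \<zero>\<^bsub>R\<^esub>}"])
  have smult: "(\<lambda>b. r \<otimes>\<^bsub>R\<^esub> c b) \<in> carrier ?F" if "r \<in> carrier R" "c \<in> carrier ?F" for r c
    using that by (auto simp: free_module_carrier intro: finite_subset[of _ "{b. c b \<noteq> \<zero>\<^bsub>R\<^esub>}"])
  have inv: "\<exists>d\<in>carrier ?F. (\<lambda>b. d b \<oplus>\<^bsub>R\<^esub> c b) = (\<lambda>b. \<zero>\<^bsub>R\<^esub>)" if "c \<in> carrier ?F" for c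
    using smult[of "\<ominus>\<^bsub>R\<^esub> \<one>\<^bsub>R\<^esub>" c] that c[OF that]
    by (intro bexI[of _ "\<lambda>b. (\<ominus>\<^bsub>R\<^esub> \<one>\<^bsub>R\<^esub>) \<otimes>\<^bsub>R\<^esub> c b"]) (auto simp: l_minus l_neg)
  show ?thesis
  proof (rule moduleI[OF assms])
    show "abelian_group ?F"
      by (rule abelian_groupI)
        (use add inv in \<open>auto simp: a_ac c\<close>, auto simp: free_module_carrier)
  qed (auto simp: smult c l_distr r_distr m_assoc)
qed

lemma free_basis_closed:
  assumes "cring R" "b \<in> B"
  shows "free_basis R b \<in> carrier (free_module R B)"
proof -
  interpret cring R by fact
  have "finite {b'. free_basis R b b' \<noteq> \<zero>\<^bsub>R\<^esub>}"
    by (rule finite_subset[of _ "{b}"]) (auto simp: free_basis_def)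
  then show ?thesis using assms(2) by (auto simp: free_module_carrier free_basis_def)
qed

text \<open>Induction on a finite set that contains the support: one coefficient is split off at a time.\<close>

lemma free_module_spans:
  assumes "cring R"
  shows "spans R (free_module R B) (free_basis R ` B)"
proof (rule spansI)
  interpret cring R by fact
  let ?F = "free_module R B"
  fix H c assume H: "submodule H R ?F" "free_basis R ` B \<subseteq> H" and c: "c \<in> carrier ?F"
  have "c \<in> H" if "finite K" "{b. c b \<noteq> \<zero>\<^bsub>R\<^esub>} \<subseteq> K" "c \<in> carrier ?F" for K c
    using that
  proof (induction K arbitrary: c)
    case empty
    then have "c = (\<lambda>b. \<zero>\<^bsub>R\<^esub>)" by auto
    then show ?case using submodule_zero[OF H(1)] by simp
  next
    case (insert k K)
    note cc = free_module_coeff[OF assms insert.prems(2)]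
    show ?case
    proof (cases "k \<in> B")
      case True
      define d where "d = c(k := \<zero>\<^bsub>R\<^esub>)"
      have "{b. d b \<noteq> \<zero>\<^bsub>R\<^esub>} \<subseteq> {b. c b \<noteq> \<zero>\<^bsub>R\<^esub>}" by (auto simp: d_def)
      then have "d \<in> carrier ?F"
        using insert.prems(2) by (auto simp: free_module_carrier d_def elim: finite_subset[rotated])
      moreover have "{b. d b \<noteq> \<zero>\<^bsub>R\<^esub>} \<subseteq> K"
        using insert.prems(1) by (auto simp: d_def)
      ultimately have "d \<in> H" by (intro insert.IH)
      moreover have "c k \<odot>\<^bsub>?F\<^esub> free_basis R k \<in> H"
        using H True cc by (intro submodule.smult_closed[OF H(1)]) auto
      ultimately have "d \<oplus>\<^bsub>?F\<^esub> (c k \<odot>\<^bsub>?F\<^esub> free_basis R k) \<in> H"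
        by (rule submodule_add[OF H(1)])
      moreover have "d \<oplus>\<^bsub>?F\<^esub> (c k \<odot>\<^bsub>?F\<^esub> free_basis R k) = c"
        using cc by (auto simp: d_def free_basis_def)
      ultimately show ?thesis by simp
    next
      case False
      then have "{b. c b \<noteq> \<zero>\<^bsub>R\<^esub>} \<subseteq> K" using insert.prems by (auto simp: free_module_carrier)
      then show ?thesis using insert by blast
    qed
  qed
  then show "c \<in> H" using c by (auto simp: free_module_carrier)
qed (use free_basis_closed[OF assms] in auto)

text \<open>The sum over the support is compared on the union of two supports, where it is visibly additive.\<close>

lemma free_module_universal:
  assumes "module R N" "\<And>b. b \<in> B \<Longrightarrow> \<phi> b \<in> carrier N"
  shows "\<exists>h \<in> mod_hom R (free_module R B) N. \<forall>b\<in>B. h (free_basis R b) = \<phi> b"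
proof -
  interpret N: module R N by fact
  let ?F = "free_module R B"
  define h where "h c = (\<Oplus>\<^bsub>N\<^esub>b\<in>{b. c b \<noteq> \<zero>\<^bsub>R\<^esub>}. c b \<odot>\<^bsub>N\<^esub> \<phi> b)" for c
  note cc = free_module_coeff[OF N.is_cring]
  have tm: "c b \<odot>\<^bsub>N\<^esub> \<phi> b \<in> carrier N" if "c \<in> carrier ?F" "b \<in> B" for c b
    using assms(2)[OF that(2)] cc[OF that(1)] by blast
  have sB: "{b. c b \<noteq> \<zero>\<^bsub>R\<^esub>} \<subseteq> B" "finite {b. c b \<noteq> \<zero>\<^bsub>R\<^esub>}" if "c \<in> carrier ?F" for c
    using that by (auto simp: free_module_carrier)
  have h_eq: "h c = (\<Oplus>\<^bsub>N\<^esub>b\<in>K. c b \<odot>\<^bsub>N\<^esub> \<phi> b)"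
    if "c \<in> carrier ?F" "finite K" "{b. c b \<noteq> \<zero>\<^bsub>R\<^esub>} \<subseteq> K" "K \<subseteq> B" for c K
    unfolding h_def
    by (rule N.M.add.finprod_mono_neutral_cong_left) (use that tm assms(2) in auto)
  have "h \<in> mod_hom R ?F N"
  proof (rule mod_homI)
    fix c assume "c \<in> carrier ?F"
    then show "h c \<in> carrier N"
      unfolding h_def using tm sB by (intro N.finsum_closed) blast
  next
    fix c d assume cd: "c \<in> carrier ?F" "d \<in> carrier ?F"
    interpret F: module R ?F by (rule module_free_module[OF N.is_cring])
    define K where "K = {b. c b \<noteq> \<zero>\<^bsub>R\<^esub>} \<union> {b. d b \<noteq> \<zero>\<^bsub>R\<^esub>}"
    have K: "finite K" "K \<subseteq> B" using sB cd by (auto simp: K_def)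
    have tK: "(\<lambda>b. c b \<odot>\<^bsub>N\<^esub> \<phi> b) \<in> K \<rightarrow> carrier N" "(\<lambda>b. d b \<odot>\<^bsub>N\<^esub> \<phi> b) \<in> K \<rightarrow> carrier N"
      using cd K(2) tm by blast+
    have "h (c \<oplus>\<^bsub>?F\<^esub> d) = (\<Oplus>\<^bsub>N\<^esub>b\<in>K. (c \<oplus>\<^bsub>?F\<^esub> d) b \<odot>\<^bsub>N\<^esub> \<phi> b)"
      by (rule h_eq) (use cd K F.a_closed[OF cd] in \<open>auto simp: K_def\<close>)
    also have "\<dots> = (\<Oplus>\<^bsub>N\<^esub>b\<in>K. c b \<odot>\<^bsub>N\<^esub> \<phi> b \<oplus>\<^bsub>N\<^esub> d b \<odot>\<^bsub>N\<^esub> \<phi> b)"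
      using K(2) by (intro N.finsum_cong')
        (auto intro!: N.smult_l_distr N.smult_closed N.a_closed cc[OF cd(1)] cc[OF cd(2)] assms(2))
    also have "\<dots> = (\<Oplus>\<^bsub>N\<^esub>b\<in>K. c b \<odot>\<^bsub>N\<^esub> \<phi> b) \<oplus>\<^bsub>N\<^esub> (\<Oplus>\<^bsub>N\<^esub>b\<in>K. d b \<odot>\<^bsub>N\<^esub> \<phi> b)"
      using tK by (rule N.finsum_addf)
    also have "\<dots> = h c \<oplus>\<^bsub>N\<^esub> h d"
      using h_eq[OF cd(1) K(1) _ K(2)] h_eq[OF cd(2) K(1) _ K(2)] by (simp add: K_def)
    finally show "h (c \<oplus>\<^bsub>?F\<^esub> d) = h c \<oplus>\<^bsub>N\<^esub> h d" .
  next
    fix r c assume rc: "r \<in> carrier R" "c \<in> carrier ?F"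
    interpret F: module R ?F by (rule module_free_module[OF N.is_cring])
    define K where "K = {b. c b \<noteq> \<zero>\<^bsub>R\<^esub>}"
    have K: "finite K" "K \<subseteq> B" using sB rc by (auto simp: K_def)
    have tK: "(\<lambda>b. c b \<odot>\<^bsub>N\<^esub> \<phi> b) \<in> K \<rightarrow> carrier N"
      using rc K(2) tm by blast+
    have "h (r \<odot>\<^bsub>?F\<^esub> c) = (\<Oplus>\<^bsub>N\<^esub>b\<in>K. (r \<odot>\<^bsub>?F\<^esub> c) b \<odot>\<^bsub>N\<^esub> \<phi> b)"
      by (rule h_eq) (use rc K F.smult_closed[OF rc] in \<open>auto simp: K_def\<close>)
    also have "\<dots> = (\<Oplus>\<^bsub>N\<^esub>b\<in>K. r \<odot>\<^bsub>N\<^esub> (c b \<odot>\<^bsub>N\<^esub> \<phi> b))"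
      using K(2) by (intro N.finsum_cong')
        (auto intro!: N.smult_assoc1 N.smult_closed cc[OF rc(2)] assms(2) rc(1))
    also have "\<dots> = r \<odot>\<^bsub>N\<^esub> h c"
      unfolding h_def using N.finsum_smult_ldistr[OF K(1) rc(1) tK] by (simp add: K_def)
    finally show "h (r \<odot>\<^bsub>?F\<^esub> c) = r \<odot>\<^bsub>N\<^esub> h c" .
  qed
  moreover have "h (free_basis R b) = \<phi> b" if b: "b \<in> B" for b
  proof -
    have "h (free_basis R b) = (\<Oplus>\<^bsub>N\<^esub>b'\<in>{b}. free_basis R b b' \<odot>\<^bsub>N\<^esub> \<phi> b')"
      by (rule h_eq) (use b free_basis_closed[OF N.is_cring b] in \<open>auto simp: free_basis_def\<close>)
    then show ?thesis using assms(2)[OF b] by (simp add: free_basis_def)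
  qed
  ultimately show ?thesis by blast
qed

section \<open>Quotients\<close>

lemma submodule_abelian_subgroup:
  assumes "module R M" "submodule N R M"
  shows "abelian_subgroup N M"
proof -
  interpret M: module R M by fact
  show ?thesis
    using submodule.axioms(1)[OF assms(2)]
    by (intro abelian_subgroupI3 additive_subgroup.intro M.abelian_group_axioms)
qed

context
  fixes R :: "('r, 'x) ring_scheme" and M :: "('r, 'a, 'y) module_scheme" and N
  assumes mod: "module R M" and sub: "submodule N R M"
begin

interpretation M: module R M by (rule mod)
interpretation N: abelian_subgroup N M by (rule submodule_abelian_subgroup[OF mod sub])

lemma quotient_carrier: "carrier (quotient_module M N) = (\<lambda>x. N +>\<^bsub>M\<^esub> x) ` carrier M"
  by (auto simp: quotient_module_def A_RCOSETS_def')

lemma quotient_zero: "\<zero>\<^bsub>quotient_module M N\<^esub> = N +>\<^bsub>M\<^esub> \<zero>\<^bsub>M\<^esub>"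
  using submodule_subset[OF sub] by (simp add: quotient_module_def)

lemma quotient_add:
  "\<lbrakk>x \<in> carrier M; y \<in> carrier M\<rbrakk> \<Longrightarrow>
    (N +>\<^bsub>M\<^esub> x) \<oplus>\<^bsub>quotient_module M N\<^esub> (N +>\<^bsub>M\<^esub> y) = N +>\<^bsub>M\<^esub> (x \<oplus>\<^bsub>M\<^esub> y)"
  by (simp add: quotient_module_def N.a_rcos_sum)

lemma coset_eqI:
  assumes "x \<in> carrier M" "y \<in> carrier M" "x \<ominus>\<^bsub>M\<^esub> y \<in> N"
  shows "N +>\<^bsub>M\<^esub> x = N +>\<^bsub>M\<^esub> y"
proof -
  have "x \<oplus>\<^bsub>M\<^esub> (\<ominus>\<^bsub>M\<^esub> y) \<in> N" using assms(3) by (simp only: a_minus_def)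
  then have "x \<in> N +>\<^bsub>M\<^esub> y"
    by (rule N.a_rcos_module_rev[OF assms(2,1)])
  then show ?thesis
    using N.a_repr_independence'[OF _ assms(2)] by simp
qed

text \<open>All representatives of a coset give the same coset after scaling, so that the union in
  \<^const>\<open>quotient_module\<close> has only one member.\<close>

lemma quotient_smult:
  assumes "r \<in> carrier R" "x \<in> carrier M"
  shows "r \<odot>\<^bsub>quotient_module M N\<^esub> (N +>\<^bsub>M\<^esub> x) = N +>\<^bsub>M\<^esub> (r \<odot>\<^bsub>M\<^esub> x)"
proof -
  have "N +>\<^bsub>M\<^esub> (r \<odot>\<^bsub>M\<^esub> c) = N +>\<^bsub>M\<^esub> (r \<odot>\<^bsub>M\<^esub> x)" if c: "c \<in> N +>\<^bsub>M\<^esub> x" for c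
  proof (rule coset_eqI)
    show "r \<odot>\<^bsub>M\<^esub> c \<in> carrier M" "r \<odot>\<^bsub>M\<^esub> x \<in> carrier M"
      using assms c N.a_elemrcos_carrier by auto
    obtain n where n: "n \<in> N" "c = n \<oplus>\<^bsub>M\<^esub> x" using c by (auto simp: a_r_coset_def r_coset_def)
    then have "r \<odot>\<^bsub>M\<^esub> c \<ominus>\<^bsub>M\<^esub> r \<odot>\<^bsub>M\<^esub> x = r \<odot>\<^bsub>M\<^esub> n"
      using assms submodule_subset[OF sub]
      by (simp add: M.minus_eq M.smult_r_distr M.a_assoc M.r_neg subset_iff)
    then show "r \<odot>\<^bsub>M\<^esub> c \<ominus>\<^bsub>M\<^esub> r \<odot>\<^bsub>M\<^esub> x \<in> N"
      using n assms submodule.smult_closed[OF sub] by simp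
  qed
  then have "(\<Union>c\<in>N +>\<^bsub>M\<^esub> x. N +>\<^bsub>M\<^esub> (r \<odot>\<^bsub>M\<^esub> c)) = (\<Union>c\<in>N +>\<^bsub>M\<^esub> x. N +>\<^bsub>M\<^esub> (r \<odot>\<^bsub>M\<^esub> x))"
    by (intro SUP_cong refl)
  also have "\<dots> = N +>\<^bsub>M\<^esub> (r \<odot>\<^bsub>M\<^esub> x)"
    using N.a_rcos_self[OF assms(2)] by blast
  finally show ?thesis by (simp add: quotient_module_def)
qed

lemma module_quotient: "module R (quotient_module M N)"
proof -
  let ?Q = "quotient_module M N"
  have "abelian_group ?Q"
  proof (rule abelian_groupI)
    fix C assume "C \<in> carrier ?Q"
    then obtain x where "x \<in> carrier M" "C = N +>\<^bsub>M\<^esub> x"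
      by (auto simp: quotient_carrier)
    then show "\<exists>D\<in>carrier ?Q. D \<oplus>\<^bsub>?Q\<^esub> C = \<zero>\<^bsub>?Q\<^esub>"
      by (intro bexI[of _ "N +>\<^bsub>M\<^esub> (\<ominus>\<^bsub>M\<^esub> x)"])
        (auto simp: quotient_carrier quotient_zero quotient_add M.l_neg)
  qed (auto simp: quotient_carrier quotient_zero quotient_add M.a_ac)
  then show ?thesis
    by (rule moduleI[OF M.is_cring])
      (auto simp: quotient_carrier quotient_add quotient_smult M.smult_l_distr M.smult_r_distr
        M.smult_assoc1)
qed

lemma coset_hom: "(\<lambda>x. N +>\<^bsub>M\<^esub> x) \<in> mod_hom R M (quotient_module M N)"
  by (rule mod_homI) (auto simp: quotient_carrier quotient_add quotient_smult)

lemma quotient_universal: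
  assumes P: "module R P" and h: "h \<in> mod_hom R M P" and 0: "\<And>x. x \<in> N \<Longrightarrow> h x = \<zero>\<^bsub>P\<^esub>"
  shows "\<exists>k \<in> mod_hom R (quotient_module M N) P. \<forall>x\<in>carrier M. k (N +>\<^bsub>M\<^esub> x) = h x"
proof -
  interpret P: module R P by fact
  have *: "h c = h x" if x: "x \<in> carrier M" and c: "c \<in> N +>\<^bsub>M\<^esub> x" for c x
  proof -
    obtain n where "n \<in> N" "c = n \<oplus>\<^bsub>M\<^esub> x" using c by (auto simp: a_r_coset_def r_coset_def)
    then show ?thesis
      using x submodule_subset[OF sub] mod_hom_add[OF h, of n x] mod_hom_closed[OF h x] 0
      by auto
  qed
  define k where "k C = h (SOME c. c \<in> C)" for C
  have k: "k (N +>\<^bsub>M\<^esub> x) = h x" if "x \<in> carrier M" for x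
    unfolding k_def using N.a_rcos_self[OF that] by (intro *[OF that]) (rule someI)
  have "k \<in> mod_hom R (quotient_module M N) P"
    by (rule mod_homI)
      (auto simp: quotient_carrier quotient_add quotient_smult k mod_hom_closed[OF h]
        mod_hom_add[OF h] mod_hom_smult[OF h])
  then show ?thesis using k by blast
qed

end

lemma submodule_gen:
  assumes "module R M" "S \<subseteq> carrier M"
  shows "submodule (submodule_gen R M S) R M" "S \<subseteq> submodule_gen R M S"
proof -
  interpret M: module R M by fact
  show "submodule (submodule_gen R M S) R M"
    by (rule submodule_of_closed[OF assms(1)])
      (use M.carrier_is_submodule assms(2) in
        \<open>auto simp: submodule_gen_def submodule_zero submodule_add submodule.smult_closed\<close>)
qed (auto simp: submodule_gen_def)

text \<open>The kernel of \<open>h\<close> is one of the submodules whose intersection is \<^const>\<open>submodule_gen\<close>.\<close>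

lemma quotient_gen_universal:
  assumes "module R M" "S \<subseteq> carrier M" "module R P" "h \<in> mod_hom R M P"
    and "\<And>x. x \<in> S \<Longrightarrow> h x = \<zero>\<^bsub>P\<^esub>"
  shows "\<exists>k \<in> mod_hom R (quotient_module M (submodule_gen R M S)) P.
    \<forall>x\<in>carrier M. k (submodule_gen R M S +>\<^bsub>M\<^esub> x) = h x"
proof (rule quotient_universal[OF assms(1) submodule_gen(1)[OF assms(1,2)] assms(3,4)])
  interpret P: module R P by fact
  have "submodule {x \<in> carrier M. h x = \<zero>\<^bsub>P\<^esub>} R M"
    by (rule submodule_equalizer[OF assms(1,3,4) mod_hom_const_zero[OF assms(3)]])
  then show "h x = \<zero>\<^bsub>P\<^esub>" if "x \<in> submodule_gen R M S" for x
    using that assms(2,5) by (auto simp: submodule_gen_def)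
qed

section \<open>Direct sums\<close>

lemma direct_sum_simps [simp]:
  "\<zero>\<^bsub>direct_sum A\<^esub> = (\<lambda>n. \<zero>\<^bsub>A n\<^esub>)"
  "s \<oplus>\<^bsub>direct_sum A\<^esub> t = (\<lambda>n. s n \<oplus>\<^bsub>A n\<^esub> t n)"
  "r \<odot>\<^bsub>direct_sum A\<^esub> s = (\<lambda>n. r \<odot>\<^bsub>A n\<^esub> s n)"
  by (simp_all add: direct_sum_def)

lemma direct_sum_carrier:
  "s \<in> carrier (direct_sum A) \<longleftrightarrow> (\<forall>n. s n \<in> carrier (A n)) \<and> finite {n. s n \<noteq> \<zero>\<^bsub>A n\<^esub>}"
  by (simp add: direct_sum_def)

context
  fixes R :: "('r, 'x) ring_scheme" and A :: "nat \<Rightarrow> ('r, 'a, 'y) module_scheme"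
  assumes mod: "\<And>n. module R (A n)"
begin

interpretation A: module R "A n" for n by (rule mod)

lemma module_direct_sum: "module R (direct_sum A)"
proof -
  let ?S = "direct_sum A"
  have add: "(\<lambda>n. s n \<oplus>\<^bsub>A n\<^esub> t n) \<in> carrier ?S" if "s \<in> carrier ?S" "t \<in> carrier ?S" for s t
    using that by (auto simp: direct_sum_carrier
        intro: finite_subset[of _ "{n. s n \<noteq> \<zero>\<^bsub>A n\<^esub>} \<union> {n. t n \<noteq> \<zero>\<^bsub>A n\<^esub>}"])
  have smult: "(\<lambda>n. r \<odot>\<^bsub>A n\<^esub> s n) \<in> carrier ?S" if "r \<in> carrier R" "s \<in> carrier ?S" for r s
    using that by (auto simp: direct_sum_carrier intro: finite_subset[of _ "{n. s n \<noteq> \<zero>\<^bsub>A n\<^esub>}"])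
  have inv: "\<exists>t\<in>carrier ?S. (\<lambda>n. t n \<oplus>\<^bsub>A n\<^esub> s n) = (\<lambda>n. \<zero>\<^bsub>A n\<^esub>)" if "s \<in> carrier ?S" for s
    using smult[of "\<ominus>\<^bsub>R\<^esub> \<one>\<^bsub>R\<^esub>" s] that
    by (intro bexI[of _ "\<lambda>n. (\<ominus>\<^bsub>R\<^esub> \<one>\<^bsub>R\<^esub>) \<odot>\<^bsub>A n\<^esub> s n"])
      (auto simp: A.smult_l_minus A.l_neg direct_sum_carrier)
  show ?thesis
  proof (rule moduleI)
    show "abelian_group ?S"
      by (rule abelian_groupI)
        (use add inv in \<open>auto simp: A.a_ac\<close>, auto simp: direct_sum_carrier A.a_ac)
  qed (use A.is_cring smult[unfolded direct_sum_carrier] in \<open>auto simp: A.smult_l_distr A.smult_r_distr A.smult_assoc1 direct_sum_carrier\<close>)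
qed

lemma direct_sum_inj_hom: "direct_sum_inj A n \<in> mod_hom R (A n) (direct_sum A)"
proof (rule mod_homI)
  fix x assume x: "x \<in> carrier (A n)"
  have "finite {i. direct_sum_inj A n x i \<noteq> \<zero>\<^bsub>A i\<^esub>}"
    by (rule finite_subset[of _ "{n}"]) (auto simp: direct_sum_inj_def)
  then show "direct_sum_inj A n x \<in> carrier (direct_sum A)"
    using x by (auto simp: direct_sum_carrier direct_sum_inj_def)
qed (auto simp: direct_sum_inj_def fun_eq_iff)

lemma direct_sum_spans:
  assumes S: "\<And>n. spans R (A n) (S n)"
  shows "spans R (direct_sum A) (\<Union>n. direct_sum_inj A n ` S n)"
proof (rule spansI)
  let ?D = "direct_sum A"
  show "(\<Union>n. direct_sum_inj A n ` S n) \<subseteq> carrier ?D"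
    using spans_subset[OF S] mod_hom_closed[OF direct_sum_inj_hom] by blast
  fix H s assume H: "submodule H R ?D" "(\<Union>n. direct_sum_inj A n ` S n) \<subseteq> H"
    and s: "s \<in> carrier ?D"
  have inj: "direct_sum_inj A n x \<in> H" if "x \<in> carrier (A n)" for n x
    using spansD[OF S submodule_vimage[OF mod module_direct_sum direct_sum_inj_hom H(1)] _ that]
      H(2) spans_subset[OF S] by blast
  have "s \<in> H" if "finite K" "{n. s n \<noteq> \<zero>\<^bsub>A n\<^esub>} \<subseteq> K" "s \<in> carrier ?D" for K s
    using that
  proof (induction K arbitrary: s)
    case empty
    then have "s = (\<lambda>n. \<zero>\<^bsub>A n\<^esub>)" by auto
    then show ?case using submodule_zero[OF H(1)] by simp
  next
    case (insert k K)
    have cs: "s n \<in> carrier (A n)" for n using insert.prems(2) by (simp add: direct_sum_carrier)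
    define t where "t = s(k := \<zero>\<^bsub>A k\<^esub>)"
    have "{n. t n \<noteq> \<zero>\<^bsub>A n\<^esub>} \<subseteq> {n. s n \<noteq> \<zero>\<^bsub>A n\<^esub>}" by (auto simp: t_def)
    then have "t \<in> carrier ?D"
      using insert.prems(2) by (auto simp: direct_sum_carrier t_def elim: finite_subset[rotated])
    moreover have "{n. t n \<noteq> \<zero>\<^bsub>A n\<^esub>} \<subseteq> K"
      using insert.prems(1) by (auto simp: t_def)
    ultimately have "t \<in> H" by (intro insert.IH)
    then have "t \<oplus>\<^bsub>?D\<^esub> direct_sum_inj A k (s k) \<in> H"
      using inj[OF cs] by (rule submodule_add[OF H(1)])
    moreover have "t \<oplus>\<^bsub>?D\<^esub> direct_sum_inj A k (s k) = s"
      using cs by (auto simp: t_def direct_sum_inj_def)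
    ultimately show ?case by simp
  qed
  then show "s \<in> H" using s by (auto simp: direct_sum_carrier)
qed

lemma direct_sum_universal:
  assumes N: "module R N" and f: "\<And>n. f n \<in> mod_hom R (A n) N"
  shows "\<exists>h \<in> mod_hom R (direct_sum A) N. \<forall>n. \<forall>x\<in>carrier (A n). h (direct_sum_inj A n x) = f n x"
proof -
  interpret N: module R N by fact
  let ?D = "direct_sum A"
  define h where "h s = (\<Oplus>\<^bsub>N\<^esub>n\<in>{n. s n \<noteq> \<zero>\<^bsub>A n\<^esub>}. f n (s n))" for s
  note f0 = mod_hom_zero[OF mod N f]
  have tm: "f n (s n) \<in> carrier N" if "s \<in> carrier ?D" for s n
    using that mod_hom_closed[OF f] by (auto simp: direct_sum_carrier)
  have h_eq: "h s = (\<Oplus>\<^bsub>N\<^esub>n\<in>K. f n (s n))"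
    if "s \<in> carrier ?D" "finite K" "{n. s n \<noteq> \<zero>\<^bsub>A n\<^esub>} \<subseteq> K" for s K
    unfolding h_def
    by (rule N.M.add.finprod_mono_neutral_cong_left) (use that tm f0 in auto)
  interpret D: module R ?D by (rule module_direct_sum)
  have "h \<in> mod_hom R ?D N"
  proof (rule mod_homI)
    fix s assume "s \<in> carrier ?D"
    then show "h s \<in> carrier N"
      unfolding h_def using tm by (intro N.finsum_closed) auto
  next
    fix s t assume st: "s \<in> carrier ?D" "t \<in> carrier ?D"
    define K where "K = {n. s n \<noteq> \<zero>\<^bsub>A n\<^esub>} \<union> {n. t n \<noteq> \<zero>\<^bsub>A n\<^esub>}"
    have K: "finite K" using st by (auto simp: K_def direct_sum_carrier)
    have c: "s n \<in> carrier (A n)" "t n \<in> carrier (A n)" for n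
      using st by (auto simp: direct_sum_carrier)
    have "h (s \<oplus>\<^bsub>?D\<^esub> t) = (\<Oplus>\<^bsub>N\<^esub>n\<in>K. f n ((s \<oplus>\<^bsub>?D\<^esub> t) n))"
      by (rule h_eq) (use st K D.a_closed[OF st] in \<open>auto simp: K_def\<close>)
    also have "\<dots> = (\<Oplus>\<^bsub>N\<^esub>n\<in>K. f n (s n) \<oplus>\<^bsub>N\<^esub> f n (t n))"
      by (rule N.finsum_cong') (auto simp: mod_hom_add[OF f] c tm st)
    also have "\<dots> = (\<Oplus>\<^bsub>N\<^esub>n\<in>K. f n (s n)) \<oplus>\<^bsub>N\<^esub> (\<Oplus>\<^bsub>N\<^esub>n\<in>K. f n (t n))"
      by (rule N.finsum_addf) (auto simp: tm st)
    also have "\<dots> = h s \<oplus>\<^bsub>N\<^esub> h t"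
      using h_eq[OF st(1) K] h_eq[OF st(2) K] by (simp add: K_def)
    finally show "h (s \<oplus>\<^bsub>?D\<^esub> t) = h s \<oplus>\<^bsub>N\<^esub> h t" .
  next
    fix r s assume rs: "r \<in> carrier R" "s \<in> carrier ?D"
    define K where "K = {n. s n \<noteq> \<zero>\<^bsub>A n\<^esub>}"
    have K: "finite K" using rs by (auto simp: K_def direct_sum_carrier)
    have c: "s n \<in> carrier (A n)" for n
      using rs by (auto simp: direct_sum_carrier)
    have "h (r \<odot>\<^bsub>?D\<^esub> s) = (\<Oplus>\<^bsub>N\<^esub>n\<in>K. f n ((r \<odot>\<^bsub>?D\<^esub> s) n))"
      by (rule h_eq) (use rs K D.smult_closed[OF rs] in \<open>auto simp: K_def\<close>)
    also have "\<dots> = (\<Oplus>\<^bsub>N\<^esub>n\<in>K. r \<odot>\<^bsub>N\<^esub> f n (s n))"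
      by (rule N.finsum_cong') (auto simp: mod_hom_smult[OF f] c tm rs)
    also have "\<dots> = r \<odot>\<^bsub>N\<^esub> h s"
      unfolding h_def using N.finsum_smult_ldistr[OF K rs(1), of "\<lambda>n. f n (s n)"] tm rs
      by (simp add: K_def)
    finally show "h (r \<odot>\<^bsub>?D\<^esub> s) = r \<odot>\<^bsub>N\<^esub> h s" .
  qed
  moreover have "h (direct_sum_inj A n x) = f n x" if x: "x \<in> carrier (A n)" for n x
  proof -
    have "h (direct_sum_inj A n x) = (\<Oplus>\<^bsub>N\<^esub>i\<in>{n}. f i (direct_sum_inj A n x i))"
      by (rule h_eq) (use mod_hom_closed[OF direct_sum_inj_hom x] in \<open>auto simp: direct_sum_inj_def\<close>)
    then show ?thesis using mod_hom_closed[OF f x] by (simp add: direct_sum_inj_def)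
  qed
  ultimately show ?thesis by blast
qed

end

section \<open>Tensor products\<close>

lemma ball_comprehension3:
  "(\<forall>c\<in>{f x y z | x y z. P x y z}. Q c) \<longleftrightarrow> (\<forall>x y z. P x y z \<longrightarrow> Q (f x y z))"
  by blast

context
  fixes R :: "('r, 'x) ring_scheme" and M :: "('r, 'a, 'y) module_scheme"
    and N :: "('r, 'b, 'z) module_scheme"
  assumes M: "module R M" and N: "module R N"
begin

interpretation M: module R M by (rule M)
interpretation N: module R N by (rule N)

lemma module_free_pairs: "module R (free_module R (carrier M \<times> carrier N))"
  by (rule module_free_module[OF M.is_cring])

interpretation F: module R "free_module R (carrier M \<times> carrier N)"
  by (rule module_free_pairs)

lemma tensor_basis_closed:
  "\<lbrakk>x \<in> carrier M; y \<in> carrier N\<rbrakk> \<Longrightarrow> free_basis R (x, y) \<in> carrier (free_module R (carrier M \<times> carrier N))"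
  by (simp add: free_basis_closed M.is_cring)

lemma tensor_relations_closed:
  "tensor_relations R M N \<subseteq> carrier (free_module R (carrier M \<times> carrier N))"
  unfolding tensor_relations_def Let_def
  by (auto simp del: free_module_simps intro!: F.minus_closed F.a_closed F.smult_closed tensor_basis_closed)

lemmas tensor_null = submodule_gen[OF module_free_pairs tensor_relations_closed, folded tensor_null_def]

lemma module_tensor: "module R (tensor R M N)"
  unfolding tensor_def by (rule module_quotient[OF module_free_pairs tensor_null(1)])

text \<open>The relations are, one by one, the differences of the two sides of the bilinearity identities.
  The lemma serves in both directions: for the projection to the quotient it makes
  \<^const>\<open>tensor_pure\<close> bilinear, and for a given bilinear map it yields the factorisation.\<close>

lemma bilinear_kills_tensor_relations:
  assumes P: "module R P" and h: "h \<in> mod_hom R (free_module R (carrier M \<times> carrier N)) P"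
    and \<beta>: "\<And>x y. \<lbrakk>x \<in> carrier M; y \<in> carrier N\<rbrakk> \<Longrightarrow> h (free_basis R (x, y)) = \<beta> x y"
  shows "bilinear_map R M N P \<beta> \<longleftrightarrow> (\<forall>c\<in>tensor_relations R M N. h c = \<zero>\<^bsub>P\<^esub>)"
proof -
  interpret P: module R P by fact
  note hs = hom_minus_eq_zero_iff[OF module_free_pairs P h] tensor_basis_closed
    mod_hom_add[OF h] mod_hom_smult[OF h] \<beta> F.a_closed F.smult_closed
  have \<beta>c: "\<beta> x y \<in> carrier P" if "x \<in> carrier M" "y \<in> carrier N" for x y
    using mod_hom_closed[OF h tensor_basis_closed[OF that]] \<beta>[OF that] by simp
  let ?F = "free_module R (carrier M \<times> carrier N)" and ?e = "free_basis R"
  have rel: "h (?e (x \<oplus>\<^bsub>M\<^esub> x', y) \<ominus>\<^bsub>?F\<^esub> (?e (x, y) \<oplus>\<^bsub>?F\<^esub> ?e (x', y))) = \<zero>\<^bsub>P\<^esub>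
      \<longleftrightarrow> \<beta> (x \<oplus>\<^bsub>M\<^esub> x') y = \<beta> x y \<oplus>\<^bsub>P\<^esub> \<beta> x' y"
    "h (?e (x, y \<oplus>\<^bsub>N\<^esub> y') \<ominus>\<^bsub>?F\<^esub> (?e (x, y) \<oplus>\<^bsub>?F\<^esub> ?e (x, y'))) = \<zero>\<^bsub>P\<^esub>
      \<longleftrightarrow> \<beta> x (y \<oplus>\<^bsub>N\<^esub> y') = \<beta> x y \<oplus>\<^bsub>P\<^esub> \<beta> x y'"
    "r \<in> carrier R \<Longrightarrow> h (?e (r \<odot>\<^bsub>M\<^esub> x, y) \<ominus>\<^bsub>?F\<^esub> r \<odot>\<^bsub>?F\<^esub> ?e (x, y)) = \<zero>\<^bsub>P\<^esub>
      \<longleftrightarrow> \<beta> (r \<odot>\<^bsub>M\<^esub> x) y = r \<odot>\<^bsub>P\<^esub> \<beta> x y"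
    "r \<in> carrier R \<Longrightarrow> h (?e (x, r \<odot>\<^bsub>N\<^esub> y) \<ominus>\<^bsub>?F\<^esub> r \<odot>\<^bsub>?F\<^esub> ?e (x, y)) = \<zero>\<^bsub>P\<^esub>
      \<longleftrightarrow> \<beta> x (r \<odot>\<^bsub>N\<^esub> y) = r \<odot>\<^bsub>P\<^esub> \<beta> x y"
    if "x \<in> carrier M" "x' \<in> carrier M" "y \<in> carrier N" "y' \<in> carrier N" for x x' y y' r
    using that by (simp_all del: free_module_simps add: hs)
  have "(\<forall>c\<in>tensor_relations R M N. h c = \<zero>\<^bsub>P\<^esub>) \<longleftrightarrow>
    (\<forall>x\<in>carrier M. \<forall>x'\<in>carrier M. \<forall>y\<in>carrier N. \<beta> (x \<oplus>\<^bsub>M\<^esub> x') y = \<beta> x y \<oplus>\<^bsub>P\<^esub> \<beta> x' y) \<and>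
    (\<forall>x\<in>carrier M. \<forall>y\<in>carrier N. \<forall>y'\<in>carrier N. \<beta> x (y \<oplus>\<^bsub>N\<^esub> y') = \<beta> x y \<oplus>\<^bsub>P\<^esub> \<beta> x y') \<and>
    (\<forall>r\<in>carrier R. \<forall>x\<in>carrier M. \<forall>y\<in>carrier N. \<beta> (r \<odot>\<^bsub>M\<^esub> x) y = r \<odot>\<^bsub>P\<^esub> \<beta> x y) \<and>
    (\<forall>r\<in>carrier R. \<forall>x\<in>carrier M. \<forall>y\<in>carrier N. \<beta> x (r \<odot>\<^bsub>N\<^esub> y) = r \<odot>\<^bsub>P\<^esub> \<beta> x y)"
    unfolding tensor_relations_def Let_def ball_Un conj_assoc ball_comprehension3
    by (intro arg_cong2[of _ _ _ _ "(\<and>)"]; auto simp del: free_module_simps simp: rel)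
  also have "\<dots> \<longleftrightarrow> bilinear_map R M N P \<beta>"
    using \<beta>c by (auto simp: bilinear_map_def mod_hom_def)
  finally show ?thesis by blast
qed

lemma tensor_pure_bilinear: "bilinear_map R M N (tensor R M N) (tensor_pure R M N)"
proof -
  note q = coset_hom[OF module_free_pairs tensor_null(1), folded tensor_def]
  interpret T: module R "tensor R M N" by (rule module_tensor)
  show ?thesis
  proof (subst bilinear_kills_tensor_relations[OF module_tensor q])
    show "\<forall>c\<in>tensor_relations R M N.
      tensor_null R M N +>\<^bsub>free_module R (carrier M \<times> carrier N)\<^esub> c = \<zero>\<^bsub>tensor R M N\<^esub>"
    proof
      fix c assume c: "c \<in> tensor_relations R M N"
      interpret n: abelian_subgroup "tensor_null R M N" "free_module R (carrier M \<times> carrier N)"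
        by (rule submodule_abelian_subgroup[OF module_free_pairs tensor_null(1)])
      have "c \<in> tensor_null R M N" using c tensor_null(2) by auto
      then show "tensor_null R M N +>\<^bsub>free_module R (carrier M \<times> carrier N)\<^esub> c = \<zero>\<^bsub>tensor R M N\<^esub>"
        using n.a_rcos_const by (simp add: tensor_def quotient_module_def)
    qed
  qed (simp add: tensor_pure_def)
qed

lemma tensor_universal:
  assumes P: "module R P" and \<beta>: "bilinear_map R M N P \<beta>"
  shows "\<exists>h \<in> mod_hom R (tensor R M N) P.
    \<forall>x\<in>carrier M. \<forall>y\<in>carrier N. h (tensor_pure R M N x y) = \<beta> x y"
proof -
  obtain g where g: "g \<in> mod_hom R (free_module R (carrier M \<times> carrier N)) P"
    and g_eq: "\<forall>p\<in>carrier M \<times> carrier N. g (free_basis R p) = (case p of (x, y) \<Rightarrow> \<beta> x y)"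
    using free_module_universal[OF P, of "carrier M \<times> carrier N" "\<lambda>(x, y). \<beta> x y"]
      bilinear_map_closed[OF \<beta>] by auto
  have "\<forall>c\<in>tensor_relations R M N. g c = \<zero>\<^bsub>P\<^esub>"
    using \<beta> g_eq by (subst bilinear_kills_tensor_relations[OF P g, symmetric]) auto
  then obtain h where h: "h \<in> mod_hom R (tensor R M N) P"
    and h_eq: "\<And>c. c \<in> carrier (free_module R (carrier M \<times> carrier N)) \<Longrightarrow>
      h (tensor_null R M N +>\<^bsub>free_module R (carrier M \<times> carrier N)\<^esub> c) = g c"
    using quotient_gen_universal[OF module_free_pairs tensor_relations_closed P g]
    by (auto simp: tensor_null_def tensor_def)
  show ?thesis
    using h g_eq by (auto simp: tensor_pure_def h_eq tensor_basis_closed intro!: bexI[of _ h])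
qed

lemma tensor_spans:
  assumes S: "spans R M S" and T: "spans R N T"
  shows "spans R (tensor R M N) {tensor_pure R M N x y | x y. x \<in> S \<and> y \<in> T}"
proof (rule spansI)
  let ?F = "free_module R (carrier M \<times> carrier N)"
  show "{tensor_pure R M N x y | x y. x \<in> S \<and> y \<in> T} \<subseteq> carrier (tensor R M N)"
    using bilinear_map_closed[OF tensor_pure_bilinear] spans_subset[OF S] spans_subset[OF T] by blast
  fix H t assume H: "submodule H R (tensor R M N)"
    "{tensor_pure R M N x y | x y. x \<in> S \<and> y \<in> T} \<subseteq> H" and t: "t \<in> carrier (tensor R M N)"
  have 1: "tensor_pure R M N x y \<in> H" if "x \<in> S" "y \<in> carrier N" for x y
    using spansD[OF T submodule_vimage[OF N module_tensor bilinear_map_right[OF tensor_pure_bilinear] H(1)] _ that(2)]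
      that(1) H(2) spans_subset[OF S] spans_subset[OF T] by blast
  have 2: "tensor_pure R M N x y \<in> H" if "x \<in> carrier M" "y \<in> carrier N" for x y
    using spansD[OF S submodule_vimage[OF M module_tensor bilinear_map_left[OF tensor_pure_bilinear] H(1)] _ that(1)]
      1 that(2) spans_subset[OF S] by blast
  note q = coset_hom[OF module_free_pairs tensor_null(1), folded tensor_def]
  obtain c where "c \<in> carrier ?F" "t = tensor_null R M N +>\<^bsub>?F\<^esub> c"
    using t quotient_carrier[OF module_free_pairs tensor_null(1)] by (auto simp: tensor_def)
  moreover have "free_basis R ` (carrier M \<times> carrier N) \<subseteq> {c \<in> carrier ?F. tensor_null R M N +>\<^bsub>?F\<^esub> c \<in> H}"
    using 2 by (auto simp: tensor_pure_def tensor_basis_closed)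
  ultimately show "t \<in> H"
    using spansD[OF free_module_spans[OF M.is_cring] submodule_vimage[OF module_free_pairs module_tensor q H(1)]]
    by blast
qed

end


section \<open>Tensor powers\<close>

lemma words_of_length_simps [simp]:
  "[] \<in> words_of_length V n \<longleftrightarrow> n = 0"
  "w \<in> words_of_length V 0 \<longleftrightarrow> w = []"
  "x # w \<in> words_of_length V (Suc n) \<longleftrightarrow> x \<in> carrier V \<and> w \<in> words_of_length V n"
  by (auto simp: words_of_length_def)

text \<open>Multilinearity on words of length \<open>n\<close>. Splitting a word at one of its letters, instead of indexing
  the arguments, fits the relations of \<^const>\<open>tensor_power_relations\<close> and recursion on words.\<close>

definition multilinear ::
  "('r, 'x) ring_scheme \<Rightarrow> ('r, 'a, 'y) module_scheme \<Rightarrow> nat \<Rightarrow> ('r, 'b, 'z) module_scheme \<Rightarrow>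
   ('a list \<Rightarrow> 'b) \<Rightarrow> bool"
  where "multilinear R V n P \<phi> \<longleftrightarrow>
    (\<forall>w\<in>words_of_length V n. \<phi> w \<in> carrier P) \<and>
    (\<forall>us x vs. us @ x # vs \<in> words_of_length V n \<longrightarrow>
      (\<forall>y\<in>carrier V. \<phi> (us @ (x \<oplus>\<^bsub>V\<^esub> y) # vs) = \<phi> (us @ x # vs) \<oplus>\<^bsub>P\<^esub> \<phi> (us @ y # vs)) \<and>
      (\<forall>r\<in>carrier R. \<phi> (us @ (r \<odot>\<^bsub>V\<^esub> x) # vs) = r \<odot>\<^bsub>P\<^esub> \<phi> (us @ x # vs)))"

lemma multilinearI:
  assumes "\<And>w. w \<in> words_of_length V n \<Longrightarrow> \<phi> w \<in> carrier P"
    and "\<And>us x y vs. \<lbrakk>us @ x # vs \<in> words_of_length V n; y \<in> carrier V\<rbrakk> \<Longrightarrow>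
      \<phi> (us @ (x \<oplus>\<^bsub>V\<^esub> y) # vs) = \<phi> (us @ x # vs) \<oplus>\<^bsub>P\<^esub> \<phi> (us @ y # vs)"
    and "\<And>us x r vs. \<lbrakk>us @ x # vs \<in> words_of_length V n; r \<in> carrier R\<rbrakk> \<Longrightarrow>
      \<phi> (us @ (r \<odot>\<^bsub>V\<^esub> x) # vs) = r \<odot>\<^bsub>P\<^esub> \<phi> (us @ x # vs)"
  shows "multilinear R V n P \<phi>"
  using assms by (simp add: multilinear_def)

lemma multilinear_closed: "\<lbrakk>multilinear R V n P \<phi>; w \<in> words_of_length V n\<rbrakk> \<Longrightarrow> \<phi> w \<in> carrier P"
  by (simp add: multilinear_def)

lemma multilinear_add:
  "\<lbrakk>multilinear R V n P \<phi>; us @ x # vs \<in> words_of_length V n; y \<in> carrier V\<rbrakk> \<Longrightarrow>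
    \<phi> (us @ (x \<oplus>\<^bsub>V\<^esub> y) # vs) = \<phi> (us @ x # vs) \<oplus>\<^bsub>P\<^esub> \<phi> (us @ y # vs)"
  by (simp add: multilinear_def)

lemma multilinear_smult:
  "\<lbrakk>multilinear R V n P \<phi>; us @ x # vs \<in> words_of_length V n; r \<in> carrier R\<rbrakk> \<Longrightarrow>
    \<phi> (us @ (r \<odot>\<^bsub>V\<^esub> x) # vs) = r \<odot>\<^bsub>P\<^esub> \<phi> (us @ x # vs)"
  by (simp add: multilinear_def)

definition tensor_word ::
  "('r, 'x) ring_scheme \<Rightarrow> ('r, 'a, 'y) module_scheme \<Rightarrow> nat \<Rightarrow> 'a list \<Rightarrow> ('a list \<Rightarrow> 'r) set"
  where "tensor_word R V n w =
    tensor_power_null R V n +>\<^bsub>free_module R (words_of_length V n)\<^esub> free_basis R w"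

lemma ball_comprehension4:
  "(\<forall>c\<in>{f x y z u | x y z u. P x y z u}. Q c) \<longleftrightarrow> (\<forall>x y z u. P x y z u \<longrightarrow> Q (f x y z u))"
  by blast

context
  fixes R :: "('r, 'x) ring_scheme" and V :: "('r, 'a, 'y) module_scheme"
  assumes V: "module R V"
begin

interpretation V: module R V by (rule V)

lemma module_free_words: "module R (free_module R (words_of_length V n))"
  by (rule module_free_module[OF V.is_cring])

interpretation F: module R "free_module R (words_of_length V n)" for n
  by (rule module_free_words)

lemma words_replace:
  assumes "us @ x # vs \<in> words_of_length V n"
  shows "y \<in> carrier V \<Longrightarrow> us @ y # vs \<in> words_of_length V n"
    and "x \<in> carrier V"
  using assms by (auto simp: words_of_length_def)

lemma tensor_power_relations_closed:
  "tensor_power_relations R V n \<subseteq> carrier (free_module R (words_of_length V n))"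
  unfolding tensor_power_relations_def Let_def
  by (auto simp del: free_module_simps
      intro!: F.minus_closed F.a_closed F.smult_closed free_basis_closed[OF V.is_cring]
      intro: words_replace V.a_closed V.smult_closed)

lemmas tensor_power_null =
  submodule_gen[OF module_free_words tensor_power_relations_closed, folded tensor_power_null_def]

lemma module_tensor_power: "module R (tensor_power R V n)"
  unfolding tensor_power_def by (rule module_quotient[OF module_free_words tensor_power_null(1)])

lemma multilinear_iff_kills_relations:
  assumes P: "module R P" and h: "h \<in> mod_hom R (free_module R (words_of_length V n)) P"
    and \<phi>: "\<And>w. w \<in> words_of_length V n \<Longrightarrow> h (free_basis R w) = \<phi> w"
  shows "multilinear R V n P \<phi> \<longleftrightarrow> (\<forall>c\<in>tensor_power_relations R V n. h c = \<zero>\<^bsub>P\<^esub>)"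
proof -
  interpret P: module R P by fact
  note b = free_basis_closed[OF V.is_cring]
  note hs = hom_minus_eq_zero_iff[OF module_free_words P h] b
    mod_hom_add[OF h] mod_hom_smult[OF h] \<phi> F.a_closed F.smult_closed
  have \<phi>c: "\<phi> w \<in> carrier P" if "w \<in> words_of_length V n" for w
    using mod_hom_closed[OF h b[OF that]] \<phi>[OF that] by simp
  let ?F = "free_module R (words_of_length V n)" and ?e = "free_basis R"
  have rel: "y \<in> carrier V \<Longrightarrow>
      h (?e (us @ (x \<oplus>\<^bsub>V\<^esub> y) # vs) \<ominus>\<^bsub>?F\<^esub> (?e (us @ x # vs) \<oplus>\<^bsub>?F\<^esub> ?e (us @ y # vs))) = \<zero>\<^bsub>P\<^esub>
      \<longleftrightarrow> \<phi> (us @ (x \<oplus>\<^bsub>V\<^esub> y) # vs) = \<phi> (us @ x # vs) \<oplus>\<^bsub>P\<^esub> \<phi> (us @ y # vs)"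
    "r \<in> carrier R \<Longrightarrow> h (?e (us @ (r \<odot>\<^bsub>V\<^esub> x) # vs) \<ominus>\<^bsub>?F\<^esub> r \<odot>\<^bsub>?F\<^esub> ?e (us @ x # vs)) = \<zero>\<^bsub>P\<^esub>
      \<longleftrightarrow> \<phi> (us @ (r \<odot>\<^bsub>V\<^esub> x) # vs) = r \<odot>\<^bsub>P\<^esub> \<phi> (us @ x # vs)"
    if "us @ x # vs \<in> words_of_length V n" for us x vs y r
    using that words_replace[OF that] by (simp_all del: free_module_simps add: hs)
  have "(\<forall>c\<in>tensor_power_relations R V n. h c = \<zero>\<^bsub>P\<^esub>) \<longleftrightarrow>
    (\<forall>us x y vs. us @ x # vs \<in> words_of_length V n \<and> y \<in> carrier V \<longrightarrow>
      \<phi> (us @ (x \<oplus>\<^bsub>V\<^esub> y) # vs) = \<phi> (us @ x # vs) \<oplus>\<^bsub>P\<^esub> \<phi> (us @ y # vs)) \<and>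
    (\<forall>us r x vs. us @ x # vs \<in> words_of_length V n \<and> r \<in> carrier R \<longrightarrow>
      \<phi> (us @ (r \<odot>\<^bsub>V\<^esub> x) # vs) = r \<odot>\<^bsub>P\<^esub> \<phi> (us @ x # vs))"
    unfolding tensor_power_relations_def Let_def ball_Un ball_comprehension4
    by (intro arg_cong2[of _ _ _ _ "(\<and>)"] all_cong1 imp_cong refl; simp del: free_module_simps add: rel)
  also have "\<dots> \<longleftrightarrow> multilinear R V n P \<phi>"
    unfolding multilinear_def using \<phi>c by blast
  finally show ?thesis by blast
qed

lemma tensor_word_multilinear: "multilinear R V n (tensor_power R V n) (tensor_word R V n)"
proof -
  note q = coset_hom[OF module_free_words tensor_power_null(1), folded tensor_power_def]
  show ?thesis
  proof (subst multilinear_iff_kills_relations[OF module_tensor_power q])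
    show "\<forall>c\<in>tensor_power_relations R V n.
      tensor_power_null R V n +>\<^bsub>free_module R (words_of_length V n)\<^esub> c = \<zero>\<^bsub>tensor_power R V n\<^esub>"
    proof
      fix c assume c: "c \<in> tensor_power_relations R V n"
      interpret n: abelian_subgroup "tensor_power_null R V n" "free_module R (words_of_length V n)"
        by (rule submodule_abelian_subgroup[OF module_free_words tensor_power_null(1)])
      have "c \<in> tensor_power_null R V n" using c tensor_power_null(2) by auto
      then show "tensor_power_null R V n +>\<^bsub>free_module R (words_of_length V n)\<^esub> c = \<zero>\<^bsub>tensor_power R V n\<^esub>"
        using n.a_rcos_const by (simp add: tensor_power_def quotient_module_def)
    qed
  qed (simp add: tensor_word_def)
qed

lemma tensor_word_closed: "w \<in> words_of_length V n \<Longrightarrow> tensor_word R V n w \<in> carrier (tensor_power R V n)"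
  using tensor_word_multilinear by (auto simp: multilinear_def)

lemma tensor_power_universal:
  assumes P: "module R P" and \<phi>: "multilinear R V n P \<phi>"
  shows "\<exists>h \<in> mod_hom R (tensor_power R V n) P. \<forall>w\<in>words_of_length V n. h (tensor_word R V n w) = \<phi> w"
proof -
  obtain g where g: "g \<in> mod_hom R (free_module R (words_of_length V n)) P"
    and g_eq: "\<forall>w\<in>words_of_length V n. g (free_basis R w) = \<phi> w"
    using free_module_universal[OF P, of "words_of_length V n" \<phi>] \<phi> by (auto simp: multilinear_def)
  have "\<forall>c\<in>tensor_power_relations R V n. g c = \<zero>\<^bsub>P\<^esub>"
    using \<phi> g_eq by (subst multilinear_iff_kills_relations[OF P g, symmetric]) auto
  then obtain h where h: "h \<in> mod_hom R (tensor_power R V n) P"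
    and h_eq: "\<And>c. c \<in> carrier (free_module R (words_of_length V n)) \<Longrightarrow>
      h (tensor_power_null R V n +>\<^bsub>free_module R (words_of_length V n)\<^esub> c) = g c"
    using quotient_gen_universal[OF module_free_words tensor_power_relations_closed P g]
    by (auto simp: tensor_power_null_def tensor_power_def)
  show ?thesis
    using h g_eq
    by (auto simp: tensor_word_def h_eq free_basis_closed[OF V.is_cring] intro!: bexI[of _ h])
qed

lemma tensor_power_spans: "spans R (tensor_power R V n) (tensor_word R V n ` words_of_length V n)"
proof (rule spansI)
  let ?F = "free_module R (words_of_length V n)"
  show "tensor_word R V n ` words_of_length V n \<subseteq> carrier (tensor_power R V n)"
    using tensor_word_closed by blast
  fix H t assume H: "submodule H R (tensor_power R V n)"
    "tensor_word R V n ` words_of_length V n \<subseteq> H" and t: "t \<in> carrier (tensor_power R V n)"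
  note q = coset_hom[OF module_free_words tensor_power_null(1), folded tensor_power_def]
  obtain c where "c \<in> carrier ?F" "t = tensor_power_null R V n +>\<^bsub>?F\<^esub> c"
    using t quotient_carrier[OF module_free_words tensor_power_null(1)] by (auto simp: tensor_power_def)
  moreover have "free_basis R ` words_of_length V n \<subseteq> {c \<in> carrier ?F. tensor_power_null R V n +>\<^bsub>?F\<^esub> c \<in> H}"
    using H(2) by (auto simp: tensor_word_def free_basis_closed[OF V.is_cring])
  ultimately show "t \<in> H"
    using spansD[OF free_module_spans[OF V.is_cring] submodule_vimage[OF module_free_words module_tensor_power q H(1)]]
    by blast
qed

text \<open>A linear map that prepends \<open>a\<close> to words is \<^const>\<open>tensor_power_cons\<close>: composed with the projection
  it agrees on basis words with prepending followed by projection, hence on every representative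
  of \<open>t\<close>. All members of the union defining \<^const>\<open>tensor_power_cons\<close> are therefore equal.\<close>

lemma tensor_power_cons_unique:
  assumes a: "a \<in> carrier V" and h: "h \<in> mod_hom R (tensor_power R V n) (tensor_power R V (Suc n))"
    and h_word: "\<And>w. w \<in> words_of_length V n \<Longrightarrow> h (tensor_word R V n w) = tensor_word R V (Suc n) (a # w)"
    and t: "t \<in> carrier (tensor_power R V n)"
  shows "tensor_power_cons R V n a t = h t"
proof -
  let ?F = "\<lambda>n. free_module R (words_of_length V n)"
  let ?N = "tensor_power_null R V"
  interpret N: abelian_subgroup "?N n" "?F n"
    by (rule submodule_abelian_subgroup[OF module_free_words tensor_power_null(1)])
  define shift where "shift c = (\<lambda>xs. case xs of [] \<Rightarrow> \<zero>\<^bsub>R\<^esub> | x # xs' \<Rightarrow> if x = a then c xs' else \<zero>\<^bsub>R\<^esub>)"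
    for c :: "'a list \<Rightarrow> 'r"
  have shift: "shift \<in> mod_hom R (?F n) (?F (Suc n))"
  proof (rule mod_homI)
    fix c assume c: "c \<in> carrier (?F n)"
    have "{w. shift c w \<noteq> \<zero>\<^bsub>R\<^esub>} \<subseteq> (#) a ` {w. c w \<noteq> \<zero>\<^bsub>R\<^esub>}"
    proof
      fix w assume "w \<in> {w. shift c w \<noteq> \<zero>\<^bsub>R\<^esub>}"
      then show "w \<in> (#) a ` {w. c w \<noteq> \<zero>\<^bsub>R\<^esub>}"
        by (cases w) (auto simp: shift_def split: if_splits)
    qed
    then have "finite {w. shift c w \<noteq> \<zero>\<^bsub>R\<^esub>}"
      using c finite_surj by (auto simp: free_module_carrier)
    then show "shift c \<in> carrier (?F (Suc n))"
      using c a free_module_coeff[OF V.is_cring c]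
      by (auto simp: free_module_carrier shift_def split: list.splits)
  qed (auto simp: shift_def fun_eq_iff split: list.splits)
  have shift_basis: "shift (free_basis R w) = free_basis R (a # w)" for w
    by (auto simp: shift_def free_basis_def fun_eq_iff split: list.splits)
  note q = coset_hom[OF module_free_words tensor_power_null(1), folded tensor_power_def]
  have *: "?N (Suc n) +>\<^bsub>?F (Suc n)\<^esub> shift c = h (?N n +>\<^bsub>?F n\<^esub> c)" if "c \<in> carrier (?F n)" for c
    by (rule spans_hom_eq[OF free_module_spans[OF V.is_cring] module_free_words module_tensor_power
          mod_hom_comp[OF q shift] mod_hom_comp[OF h q] _ that])
      (use h_word in \<open>auto simp: shift_basis tensor_word_def\<close>)
  obtain c where c: "c \<in> carrier (?F n)" "t = ?N n +>\<^bsub>?F n\<^esub> c"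
    using t quotient_carrier[OF module_free_words tensor_power_null(1)] by (auto simp: tensor_power_def)
  have "?N (Suc n) +>\<^bsub>?F (Suc n)\<^esub> shift d = h t" if d: "d \<in> t" for d
  proof -
    have "d \<in> carrier (?F n)" using N.a_elemrcos_carrier[OF c(1)] d c(2) by simp
    moreover have "?N n +>\<^bsub>?F n\<^esub> d = t" using N.a_repr_independence'[OF _ c(1)] d c(2) by simp
    ultimately show ?thesis using *[of d] by simp
  qed
  moreover have "c \<in> t" using N.a_rcos_self[OF c(1)] c(2) by simp
  ultimately show ?thesis
    unfolding tensor_power_cons_def shift_def[symmetric] by blast
qed

lemma tensor_power_cons_hom:
  assumes "a \<in> carrier V"
  shows "tensor_power_cons R V n a \<in> mod_hom R (tensor_power R V n) (tensor_power R V (Suc n))"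
    and "w \<in> words_of_length V n \<Longrightarrow>
      tensor_power_cons R V n a (tensor_word R V n w) = tensor_word R V (Suc n) (a # w)"
proof -
  have "multilinear R V n (tensor_power R V (Suc n)) (\<lambda>w. tensor_word R V (Suc n) (a # w))"
  proof (rule multilinearI)
    note ml = tensor_word_multilinear[of "Suc n"]
    show "tensor_word R V (Suc n) (a # w) \<in> carrier (tensor_power R V (Suc n))"
      if "w \<in> words_of_length V n" for w
      using that assms by (simp add: multilinear_closed[OF ml])
    show "tensor_word R V (Suc n) (a # us @ (x \<oplus>\<^bsub>V\<^esub> y) # vs) =
        tensor_word R V (Suc n) (a # us @ x # vs) \<oplus>\<^bsub>tensor_power R V (Suc n)\<^esub> tensor_word R V (Suc n) (a # us @ y # vs)"
      if "us @ x # vs \<in> words_of_length V n" "y \<in> carrier V" for us x y vs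
      using multilinear_add[OF ml, of "a # us" x vs y] that assms by simp
    show "tensor_word R V (Suc n) (a # us @ (r \<odot>\<^bsub>V\<^esub> x) # vs) =
        r \<odot>\<^bsub>tensor_power R V (Suc n)\<^esub> tensor_word R V (Suc n) (a # us @ x # vs)"
      if "us @ x # vs \<in> words_of_length V n" "r \<in> carrier R" for us x r vs
      using multilinear_smult[OF ml, of "a # us" x vs r] that assms by simp
  qed
  from tensor_power_universal[OF module_tensor_power this]
  obtain h where h: "h \<in> mod_hom R (tensor_power R V n) (tensor_power R V (Suc n))"
    and hw: "\<And>w. w \<in> words_of_length V n \<Longrightarrow> h (tensor_word R V n w) = tensor_word R V (Suc n) (a # w)"
    by auto
  have eq: "tensor_power_cons R V n a t = h t" if "t \<in> carrier (tensor_power R V n)" for t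
    by (rule tensor_power_cons_unique[OF assms h hw that])
  interpret T: module R "tensor_power R V n" by (rule module_tensor_power)
  show "tensor_power_cons R V n a \<in> mod_hom R (tensor_power R V n) (tensor_power R V (Suc n))"
    by (rule mod_homI) (simp_all add: eq mod_hom_closed[OF h] mod_hom_add[OF h] mod_hom_smult[OF h])
  show "tensor_power_cons R V n a (tensor_word R V n w) = tensor_word R V (Suc n) (a # w)"
    if "w \<in> words_of_length V n"
    using that by (simp add: eq hw tensor_word_closed)
qed

end

section \<open>The shuffle product\<close>

text \<open>The pure tensor of the letters of \<open>w\<close>, placed in its degree.\<close>

definition Sh_word ::
  "('r, 'x) ring_scheme \<Rightarrow> ('r, 'a, 'y) module_scheme \<Rightarrow> 'a list \<Rightarrow> nat \<Rightarrow> ('a list \<Rightarrow> 'r) set"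
  where "Sh_word R V w = Sh_inj R V (length w) (tensor_word R V (length w) w)"

fun shuffle_words ::
  "('r, 'x) ring_scheme \<Rightarrow> ('r, 'a, 'y) module_scheme \<Rightarrow> 'a list \<Rightarrow> 'a list \<Rightarrow> nat \<Rightarrow> ('a list \<Rightarrow> 'r) set"
  where
    "shuffle_words R V [] v = Sh_word R V v"
  | "shuffle_words R V (a # u) [] = Sh_word R V (a # u)"
  | "shuffle_words R V (a # u) (b # v) =
      Sh_cons R V a (shuffle_words R V u (b # v)) \<oplus>\<^bsub>Sh R V\<^esub> Sh_cons R V b (shuffle_words R V (a # u) v)"

lemma words_of_length_eq: "w \<in> words_of_length V n \<longleftrightarrow> w \<in> lists (carrier V) \<and> length w = n"
  by (auto simp: words_of_length_def in_lists_conv_set)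

text \<open>Membership in \<^const>\<open>lists\<close> is kept as it is, since words are taken apart by recursion and not
  by quantification over their letters.\<close>

declare in_lists_conv_set [simp del] in_listsD [rule del] in_listsI [rule del]

lemma Sh_one_eq: "Sh_one R V = Sh_word R V []"
  by (simp add: Sh_one_def Sh_word_def tensor_word_def)

context
  fixes R :: "('r, 'x) ring_scheme" and V :: "('r, 'a, 'y) module_scheme"
  assumes V: "module R V"
begin

interpretation V: module R V by (rule V)

lemma module_Sh: "module R (Sh R V)"
  unfolding Sh_def by (rule module_direct_sum[OF module_tensor_power[OF V]])

interpretation Sh: module R "Sh R V" by (rule module_Sh)

lemma Sh_inj_hom: "Sh_inj R V n \<in> mod_hom R (tensor_power R V n) (Sh R V)"
  unfolding Sh_def Sh_inj_def by (rule direct_sum_inj_hom[OF module_tensor_power[OF V]])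

lemma Sh_word_closed: "w \<in> lists (carrier V) \<Longrightarrow> Sh_word R V w \<in> carrier (Sh R V)"
  unfolding Sh_word_def
  by (auto intro!: mod_hom_closed[OF Sh_inj_hom] tensor_word_closed[OF V] simp: words_of_length_eq)

lemma Sh_word_multilinear: "multilinear R V n (Sh R V) (Sh_word R V)"
proof (rule multilinearI)
  note ml = tensor_word_multilinear[OF V]
  show "Sh_word R V w \<in> carrier (Sh R V)" if "w \<in> words_of_length V n" for w
    using that by (auto simp: words_of_length_eq intro: Sh_word_closed)
  fix us x vs assume w: "us @ x # vs \<in> words_of_length V n"
  then have n: "Suc (length us + length vs) = n" by (simp add: words_of_length_def)
  show "Sh_word R V (us @ (x \<oplus>\<^bsub>V\<^esub> y) # vs) = Sh_word R V (us @ x # vs) \<oplus>\<^bsub>Sh R V\<^esub> Sh_word R V (us @ y # vs)"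
    if y: "y \<in> carrier V" for y
    using multilinear_add[OF ml w y] mod_hom_add[OF Sh_inj_hom]
      tensor_word_closed[OF V w] tensor_word_closed[OF V words_replace(1)[OF V w y]]
    by (simp add: Sh_word_def n)
  show "Sh_word R V (us @ (r \<odot>\<^bsub>V\<^esub> x) # vs) = r \<odot>\<^bsub>Sh R V\<^esub> Sh_word R V (us @ x # vs)"
    if r: "r \<in> carrier R" for r
    using multilinear_smult[OF ml w r] mod_hom_smult[OF Sh_inj_hom r tensor_word_closed[OF V w]]
    by (simp add: Sh_word_def n)
qed

lemma Sh_spans: "spans R (Sh R V) (Sh_word R V ` lists (carrier V))"
proof -
  have "(\<Union>n. direct_sum_inj (tensor_power R V) n ` tensor_word R V n ` words_of_length V n) =
      Sh_word R V ` lists (carrier V)"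
    by (force simp: Sh_word_def Sh_inj_def words_of_length_eq)
  then show ?thesis
    using direct_sum_spans[where A = "tensor_power R V", OF module_tensor_power[OF V] tensor_power_spans[OF V]]
    by (simp add: Sh_def)
qed

text \<open>The letters of a word are replaced one after the other, from left to right, by generators: \<open>us\<close> is
  the part already replaced, and for fixed \<open>us\<close> and \<open>vs\<close> the word is linear in the letter between them.\<close>

lemma Sh_spans_words:
  assumes S: "spans R V S"
  shows "spans R (Sh R V) (Sh_word R V ` lists S)"
proof (rule spansI)
  have SV: "lists S \<subseteq> lists (carrier V)"
    using spans_subset[OF S] by (rule lists_mono)
  then show "Sh_word R V ` lists S \<subseteq> carrier (Sh R V)"
    using Sh_word_closed by blast
  fix H s assume H: "submodule H R (Sh R V)" "Sh_word R V ` lists S \<subseteq> H" and s: "s \<in> carrier (Sh R V)"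
  have "Sh_word R V (us @ vs) \<in> H" if "us \<in> lists S" "vs \<in> lists (carrier V)" for us vs
    using that
  proof (induction vs arbitrary: us)
    case Nil
    then show ?case using H(2) by auto
  next
    case (Cons x vs)
    have w: "us @ y # vs \<in> words_of_length V (length us + Suc (length vs))" if "y \<in> carrier V" for y
      using that Cons.prems SV by (auto simp: words_of_length_eq)
    have "(\<lambda>y. Sh_word R V (us @ y # vs)) \<in> mod_hom R V (Sh R V)"
      by (rule mod_homI)
        (use w in \<open>auto intro: multilinear_closed[OF Sh_word_multilinear]
          multilinear_add[OF Sh_word_multilinear] multilinear_smult[OF Sh_word_multilinear]\<close>)
    note sub = submodule_vimage[OF V module_Sh this H(1)]
    have "Sh_word R V (us @ y # vs) \<in> H" if "y \<in> S" for y
      using Cons.IH[of "us @ [y]"] Cons.prems that by simp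
    then show ?case
      using spansD[OF S sub, of x] Cons.prems spans_subset[OF S] by auto
  qed
  from this[of "[]"] have "Sh_word R V ` lists (carrier V) \<subseteq> H" by auto
  then show "s \<in> H" using spansD[OF Sh_spans H(1) _ s] by simp
qed

lemma Sh_universal:
  assumes P: "module R P" and \<phi>: "\<And>n. multilinear R V n P \<phi>"
  shows "\<exists>h \<in> mod_hom R (Sh R V) P. \<forall>w\<in>lists (carrier V). h (Sh_word R V w) = \<phi> w"
proof -
  have "\<forall>n. \<exists>h \<in> mod_hom R (tensor_power R V n) P. \<forall>w\<in>words_of_length V n. h (tensor_word R V n w) = \<phi> w"
    using tensor_power_universal[OF V P \<phi>] by auto
  then obtain h where h: "\<And>n. h n \<in> mod_hom R (tensor_power R V n) P"
    and hw: "\<And>n w. w \<in> words_of_length V n \<Longrightarrow> h n (tensor_word R V n w) = \<phi> w"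
    by metis
  from direct_sum_universal[where A = "tensor_power R V", OF module_tensor_power[OF V] P h]
  obtain k where "k \<in> mod_hom R (Sh R V) P"
    "\<And>n x. x \<in> carrier (tensor_power R V n) \<Longrightarrow> k (Sh_inj R V n x) = h n x"
    by (auto simp: Sh_def Sh_inj_def)
  then show ?thesis
    by (intro bexI[of _ k]) (auto simp: Sh_word_def hw tensor_word_closed[OF V] words_of_length_eq)
qed

lemma Sh_carrier:
  "s \<in> carrier (Sh R V) \<longleftrightarrow>
    (\<forall>n. s n \<in> carrier (tensor_power R V n)) \<and> finite {n. s n \<noteq> \<zero>\<^bsub>tensor_power R V n\<^esub>}"
  by (simp add: Sh_def direct_sum_carrier)

lemma Sh_cons_hom:
  assumes a: "a \<in> carrier V"
  shows "Sh_cons R V a \<in> mod_hom R (Sh R V) (Sh R V)"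
proof (rule mod_homI)
  note c = tensor_power_cons_hom(1)[OF V a]
  interpret T: module R "tensor_power R V n" for n by (rule module_tensor_power[OF V])
  fix s assume s: "s \<in> carrier (Sh R V)"
  have "{n. Sh_cons R V a s n \<noteq> \<zero>\<^bsub>tensor_power R V n\<^esub>} \<subseteq> Suc ` {n. s n \<noteq> \<zero>\<^bsub>tensor_power R V n\<^esub>}"
  proof
    fix n assume "n \<in> {n. Sh_cons R V a s n \<noteq> \<zero>\<^bsub>tensor_power R V n\<^esub>}"
    then show "n \<in> Suc ` {n. s n \<noteq> \<zero>\<^bsub>tensor_power R V n\<^esub>}"
      using mod_hom_zero[OF T.module_axioms T.module_axioms c] by (cases n) (auto simp: Sh_cons_def)
  qed
  then have "finite {n. Sh_cons R V a s n \<noteq> \<zero>\<^bsub>tensor_power R V n\<^esub>}"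
    using s finite_surj by (auto simp: Sh_carrier)
  then show "Sh_cons R V a s \<in> carrier (Sh R V)"
    using s mod_hom_closed[OF c] by (auto simp: Sh_carrier Sh_cons_def split: nat.split)
next
  note c = tensor_power_cons_hom(1)[OF V a]
  interpret T: module R "tensor_power R V n" for n by (rule module_tensor_power[OF V])
  show "Sh_cons R V a (s \<oplus>\<^bsub>Sh R V\<^esub> t) = Sh_cons R V a s \<oplus>\<^bsub>Sh R V\<^esub> Sh_cons R V a t"
    if "s \<in> carrier (Sh R V)" "t \<in> carrier (Sh R V)" for s t
    using that by (auto simp: Sh_carrier Sh_cons_def Sh_def fun_eq_iff mod_hom_add[OF c] direct_sum_carrier
        split: nat.split)
  show "Sh_cons R V a (r \<odot>\<^bsub>Sh R V\<^esub> s) = r \<odot>\<^bsub>Sh R V\<^esub> Sh_cons R V a s"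
    if "r \<in> carrier R" "s \<in> carrier (Sh R V)" for r s
    using that by (auto simp: Sh_carrier Sh_cons_def Sh_def fun_eq_iff mod_hom_smult[OF c] direct_sum_carrier
        split: nat.split)
qed

lemma Sh_cons_inj:
  assumes "a \<in> carrier V" "s \<in> carrier (tensor_power R V n)"
  shows "Sh_cons R V a (Sh_inj R V n s) = Sh_inj R V (Suc n) (tensor_power_cons R V n a s)"
  using mod_hom_zero[OF module_tensor_power[OF V] module_tensor_power[OF V] tensor_power_cons_hom(1)[OF V assms(1)]]
  by (auto simp: Sh_cons_def Sh_inj_def direct_sum_inj_def fun_eq_iff split: nat.split)

lemma Sh_cons_word:
  assumes "a \<in> carrier V" "w \<in> lists (carrier V)"
  shows "Sh_cons R V a (Sh_word R V w) = Sh_word R V (a # w)"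
  using assms
  by (simp add: Sh_word_def Sh_cons_inj tensor_word_closed[OF V] words_of_length_eq tensor_power_cons_hom(2)[OF V])

lemma Sh_cons_bilinear: "bilinear_map R V (Sh R V) (Sh R V) (Sh_cons R V)"
proof -
  have "bilinear_map R (Sh R V) V (Sh R V) (\<lambda>s a. Sh_cons R V a s)"
  proof (rule bilinear_map_if_linear_on_spanning_set[OF Sh_spans module_Sh V module_Sh Sh_cons_hom])
    fix s assume "s \<in> Sh_word R V ` lists (carrier V)"
    then obtain w where w: "w \<in> lists (carrier V)" "s = Sh_word R V w" by auto
    then have n: "[] @ a # w \<in> words_of_length V (Suc (length w))" if "a \<in> carrier V" for a
      using that by (simp add: words_of_length_eq)
    note ml = multilinear_closed[OF Sh_word_multilinear n] multilinear_add[OF Sh_word_multilinear n]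
      multilinear_smult[OF Sh_word_multilinear n]
    have "(\<lambda>a. Sh_word R V (a # w)) \<in> mod_hom R V (Sh R V)"
      by (rule mod_homI) (use ml in \<open>simp_all\<close>)
    then show "(\<lambda>a. Sh_cons R V a s) \<in> mod_hom R V (Sh R V)"
      by (rule mod_hom_cong[OF V]) (simp add: w Sh_cons_word)
  qed
  then show ?thesis by (simp add: bilinear_map_def)
qed

lemmas Sh_cons_closed = bilinear_map_closed[OF Sh_cons_bilinear]
lemmas Sh_cons_add_right = mod_hom_add[OF Sh_cons_hom]
lemmas Sh_cons_smult_right = mod_hom_smult[OF Sh_cons_hom]
lemmas Sh_cons_add_left = mod_hom_add[OF bilinear_map_left[OF Sh_cons_bilinear]]
lemmas Sh_cons_smult_left = mod_hom_smult[OF bilinear_map_left[OF Sh_cons_bilinear]]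

lemma shuffle_words_closed:
  "\<lbrakk>u \<in> lists (carrier V); v \<in> lists (carrier V)\<rbrakk> \<Longrightarrow> shuffle_words R V u v \<in> carrier (Sh R V)"
proof (induction u arbitrary: v)
  case (Cons a u)
  from Cons.prems(2) show ?case
    by (induction v) (use Cons.prems(1) Cons.IH in \<open>auto simp: Sh_word_closed Sh_cons_closed\<close>)
qed (simp add: Sh_word_closed)

lemma shuffle_words_Nil_right [simp]: "shuffle_words R V u [] = Sh_word R V u"
  by (cases u) auto

lemma shuffle_words_commute:
  "\<lbrakk>u \<in> lists (carrier V); v \<in> lists (carrier V)\<rbrakk> \<Longrightarrow> shuffle_words R V u v = shuffle_words R V v u"
proof (induction "length u + length v" arbitrary: u v rule: less_induct)
  case less
  show ?case
  proof (cases u; cases v)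
    fix a u' b v' assume uv: "u = a # u'" "v = b # v'"
    then have "shuffle_words R V u' v = shuffle_words R V v u'" "shuffle_words R V u v' = shuffle_words R V v' u"
      using less.prems by (auto intro!: less.hyps)
    then show ?thesis
      using less.prems uv
      by (simp add: Sh.a_comm Sh_cons_closed shuffle_words_closed del: listsE)
  qed auto
qed

text \<open>The letter \<open>x + y\<close> is either moved to the front by the recursion, where \<^const>\<open>Sh_cons\<close> is linear
  in it, or it stays inside one of the two smaller shuffles. Linearity in the letters of the second
  word comes from commutativity.\<close>

lemma shuffle_words_add:
  assumes x: "x \<in> carrier V" "y \<in> carrier V" "vs \<in> lists (carrier V)"
  shows "\<lbrakk>us \<in> lists (carrier V); v \<in> lists (carrier V)\<rbrakk> \<Longrightarrow>
    shuffle_words R V (us @ (x \<oplus>\<^bsub>V\<^esub> y) # vs) v =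
      shuffle_words R V (us @ x # vs) v \<oplus>\<^bsub>Sh R V\<^esub> shuffle_words R V (us @ y # vs) v"
proof (induction "length us + length v" arbitrary: us v rule: less_induct)
  case less
  show ?case
  proof (cases v)
    case Nil
    have "us @ x # vs \<in> words_of_length V (length (us @ x # vs))"
      using less.prems x by (auto simp: words_of_length_eq)
    from multilinear_add[OF Sh_word_multilinear this x(2)] show ?thesis
      using Nil by simp
  next
    case (Cons b v')
    then have b: "b \<in> carrier V" "v' \<in> lists (carrier V)" using less.prems by auto
    have IH2: "shuffle_words R V (us @ (x \<oplus>\<^bsub>V\<^esub> y) # vs) v' =
      shuffle_words R V (us @ x # vs) v' \<oplus>\<^bsub>Sh R V\<^esub> shuffle_words R V (us @ y # vs) v'"
      using less.prems Cons by (intro less.hyps) auto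
    show ?thesis
    proof (cases us)
      case Nil
      show ?thesis
        using less.prems Cons x b IH2 unfolding Nil
        by (simp add: Sh_cons_add_left Sh_cons_add_right shuffle_words_closed Sh_cons_closed Sh.a_ac)
    next
      case (Cons a us')
      then have "shuffle_words R V (us' @ (x \<oplus>\<^bsub>V\<^esub> y) # vs) v =
        shuffle_words R V (us' @ x # vs) v \<oplus>\<^bsub>Sh R V\<^esub> shuffle_words R V (us' @ y # vs) v"
        using less.prems by (intro less.hyps) auto
      then show ?thesis
        using less.prems Cons \<open>v = b # v'\<close> x b IH2
        by (simp add: Sh_cons_add_right shuffle_words_closed Sh_cons_closed Sh.a_ac)
    qed
  qed
qed

lemma shuffle_words_smult:
  assumes x: "x \<in> carrier V" "r \<in> carrier R" "vs \<in> lists (carrier V)"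
  shows "\<lbrakk>us \<in> lists (carrier V); v \<in> lists (carrier V)\<rbrakk> \<Longrightarrow>
    shuffle_words R V (us @ (r \<odot>\<^bsub>V\<^esub> x) # vs) v = r \<odot>\<^bsub>Sh R V\<^esub> shuffle_words R V (us @ x # vs) v"
proof (induction "length us + length v" arbitrary: us v rule: less_induct)
  case less
  show ?case
  proof (cases v)
    case Nil
    have "us @ x # vs \<in> words_of_length V (length (us @ x # vs))"
      using less.prems x by (auto simp: words_of_length_eq)
    from multilinear_smult[OF Sh_word_multilinear this x(2)] show ?thesis
      using Nil by simp
  next
    case (Cons b v')
    then have b: "b \<in> carrier V" "v' \<in> lists (carrier V)" using less.prems by auto
    have IH2: "shuffle_words R V (us @ (r \<odot>\<^bsub>V\<^esub> x) # vs) v' = r \<odot>\<^bsub>Sh R V\<^esub> shuffle_words R V (us @ x # vs) v'"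
      using less.prems Cons by (intro less.hyps) auto
    show ?thesis
    proof (cases us)
      case Nil
      show ?thesis
        using less.prems Cons x b IH2 unfolding Nil
        by (simp add: Sh_cons_smult_left Sh_cons_smult_right shuffle_words_closed Sh_cons_closed Sh.smult_r_distr)
    next
      case (Cons a us')
      then have "shuffle_words R V (us' @ (r \<odot>\<^bsub>V\<^esub> x) # vs) v = r \<odot>\<^bsub>Sh R V\<^esub> shuffle_words R V (us' @ x # vs) v"
        using less.prems by (intro less.hyps) auto
      then show ?thesis
        using less.prems Cons \<open>v = b # v'\<close> x b IH2
        by (simp add: Sh_cons_smult_right shuffle_words_closed Sh_cons_closed Sh.smult_r_distr)
    qed
  qed
qed

lemma shuffle_words_multilinear:
  assumes v: "v \<in> lists (carrier V)"
  shows "multilinear R V n (Sh R V) (\<lambda>u. shuffle_words R V u v)"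
  using v by (intro multilinearI)
    (auto simp: words_of_length_eq shuffle_words_closed shuffle_words_add shuffle_words_smult)

text \<open>Both sides are bilinear in \<open>s\<close> and \<open>t\<close>, and words span.\<close>

lemma shuffle_recursion_extends:
  assumes p: "bilinear_map R (Sh R V) (Sh R V) (Sh R V) p"
    and ab: "a \<in> carrier V" "b \<in> carrier V" and st: "s \<in> carrier (Sh R V)" "t \<in> carrier (Sh R V)"
    and w: "\<And>u v. \<lbrakk>u \<in> lists (carrier V); v \<in> lists (carrier V)\<rbrakk> \<Longrightarrow>
      p (Sh_word R V (a # u)) (Sh_word R V (b # v)) =
      Sh_cons R V a (p (Sh_word R V u) (Sh_word R V (b # v))) \<oplus>\<^bsub>Sh R V\<^esub>
      Sh_cons R V b (p (Sh_word R V (a # u)) (Sh_word R V v))"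
  shows "p (Sh_cons R V a s) (Sh_cons R V b t) =
    Sh_cons R V a (p s (Sh_cons R V b t)) \<oplus>\<^bsub>Sh R V\<^esub> Sh_cons R V b (p (Sh_cons R V a s) t)"
proof (rule spans_bilinear_eq[OF Sh_spans Sh_spans module_Sh module_Sh module_Sh _ _ _ st])
  note ca = Sh_cons_hom[OF ab(1)] and cb = Sh_cons_hom[OF ab(2)]
  note cca = mod_hom_closed[OF ca] and ccb = mod_hom_closed[OF cb]
  show "bilinear_map R (Sh R V) (Sh R V) (Sh R V) (\<lambda>s t. p (Sh_cons R V a s) (Sh_cons R V b t))"
    by (intro bilinear_mapI bilinear_map_comp_left[OF p ca] bilinear_map_comp_right[OF p cb] cca ccb)
  show "bilinear_map R (Sh R V) (Sh R V) (Sh R V) (\<lambda>s t. Sh_cons R V a (p s (Sh_cons R V b t)) \<oplus>\<^bsub>Sh R V\<^esub>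
      Sh_cons R V b (p (Sh_cons R V a s) t))"
    by (rule bilinear_mapI; rule mod_hom_sum[OF module_Sh])
      (rule mod_hom_comp[OF ca bilinear_map_comp_right[OF p cb]]
        mod_hom_comp[OF cb bilinear_map_right[OF p cca]]
        mod_hom_comp[OF ca bilinear_map_left[OF p ccb]]
        mod_hom_comp[OF cb bilinear_map_comp_left[OF p ca]]; assumption)+
  fix x y assume "x \<in> Sh_word R V ` lists (carrier V)" "y \<in> Sh_word R V ` lists (carrier V)"
  then obtain u v where "u \<in> lists (carrier V)" "x = Sh_word R V u"
    "v \<in> lists (carrier V)" "y = Sh_word R V v"
    by blast
  then show "p (Sh_cons R V a x) (Sh_cons R V b y) =
    Sh_cons R V a (p x (Sh_cons R V b y)) \<oplus>\<^bsub>Sh R V\<^esub> Sh_cons R V b (p (Sh_cons R V a x) y)"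
    by (simp add: Sh_cons_word ab w)
qed

text \<open>The conditions on the shuffle product are satisfiable, so that the choice in
  \<^const>\<open>shuffle_product\<close> obeys them: the recursion on words is multilinear and extends bilinearly.\<close>

lemma is_shuffle_product_shuffle_product: "is_shuffle_product R V (shuffle_product R V)"
proof -
  have left: "\<exists>h \<in> mod_hom R (Sh R V) (Sh R V). \<forall>u\<in>lists (carrier V). h (Sh_word R V u) = shuffle_words R V u v"
    if "v \<in> lists (carrier V)" for v
    by (rule Sh_universal[OF module_Sh shuffle_words_multilinear[OF that]])
  have right: "\<exists>h \<in> mod_hom R (Sh R V) (Sh R V). \<forall>v\<in>lists (carrier V). h (Sh_word R V v) = shuffle_words R V u v"
    if "u \<in> lists (carrier V)" for u
    using left[OF that] shuffle_words_commute[OF that] by auto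
  have "\<exists>p. bilinear_map R (Sh R V) (Sh R V) (Sh R V) p \<and> (\<forall>u\<in>lists (carrier V). \<forall>v\<in>lists (carrier V).
      p (Sh_word R V u) (Sh_word R V v) = shuffle_words R V u v)"
    by (rule bilinear_extension[OF Sh_spans module_Sh Sh_spans module_Sh module_Sh left right])
  then obtain p where p: "bilinear_map R (Sh R V) (Sh R V) (Sh R V) p"
    and pw: "\<And>u v. \<lbrakk>u \<in> lists (carrier V); v \<in> lists (carrier V)\<rbrakk> \<Longrightarrow>
      p (Sh_word R V u) (Sh_word R V v) = shuffle_words R V u v"
    by blast
  have one: "Sh_one R V \<in> carrier (Sh R V)"
    by (simp add: Sh_one_eq Sh_word_closed)
  have "is_shuffle_product R V p"
    unfolding is_shuffle_product_def Let_def
  proof (intro conjI ballI allI)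
    show "p (Sh_one R V) s = s" if s: "s \<in> carrier (Sh R V)" for s
      by (rule spans_hom_eq[OF Sh_spans module_Sh module_Sh bilinear_map_right[OF p one] mod_hom_id _ s])
        (auto simp: Sh_one_eq pw)
    show "p s (Sh_one R V) = s" if s: "s \<in> carrier (Sh R V)" for s
      by (rule spans_hom_eq[OF Sh_spans module_Sh module_Sh bilinear_map_left[OF p one] mod_hom_id _ s])
        (auto simp: Sh_one_eq pw)
  next
    fix a b m n s t
    assume *: "a \<in> carrier V" "b \<in> carrier V"
      "s \<in> carrier (tensor_power R V m)" "t \<in> carrier (tensor_power R V n)"
    show "p (Sh_inj R V (Suc m) (tensor_power_cons R V m a s)) (Sh_inj R V (Suc n) (tensor_power_cons R V n b t)) =
      Sh_cons R V a (p (Sh_inj R V m s) (Sh_inj R V (Suc n) (tensor_power_cons R V n b t))) \<oplus>\<^bsub>Sh R V\<^esub>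
      Sh_cons R V b (p (Sh_inj R V (Suc m) (tensor_power_cons R V m a s)) (Sh_inj R V n t))"
      unfolding Sh_cons_inj[OF *(1,3), symmetric] Sh_cons_inj[OF *(2,4), symmetric]
      by (rule shuffle_recursion_extends[OF p]) (use * in \<open>auto simp: pw mod_hom_closed[OF Sh_inj_hom]\<close>)
  qed (rule p)
  then show ?thesis
    unfolding shuffle_product_def by (rule someI[where P = "is_shuffle_product R V"])
qed

private abbreviation (input) shuffle (infixl \<open>\<diamondop>\<close> 70) where "shuffle \<equiv> shuffle_product R V"

lemma shuffle_bilinear: "bilinear_map R (Sh R V) (Sh R V) (Sh R V) (shuffle_product R V)"
  using is_shuffle_product_shuffle_product by (simp add: is_shuffle_product_def)

lemma shuffle_one:
  assumes "s \<in> carrier (Sh R V)"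
  shows "Sh_word R V [] \<diamondop> s = s" "s \<diamondop> Sh_word R V [] = s"
  using is_shuffle_product_shuffle_product assms
  by (auto simp: is_shuffle_product_def Sh_one_eq)

lemma shuffle_cons:
  assumes ab: "a \<in> carrier V" "b \<in> carrier V" and st: "s \<in> carrier (Sh R V)" "t \<in> carrier (Sh R V)"
  shows "Sh_cons R V a s \<diamondop> Sh_cons R V b t =
    Sh_cons R V a (s \<diamondop> Sh_cons R V b t) \<oplus>\<^bsub>Sh R V\<^esub> Sh_cons R V b (Sh_cons R V a s \<diamondop> t)"
proof (rule shuffle_recursion_extends[OF shuffle_bilinear ab st])
  fix u v assume uv: "u \<in> lists (carrier V)" "v \<in> lists (carrier V)"
  then have c: "tensor_word R V (length u) u \<in> carrier (tensor_power R V (length u))"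
    "tensor_word R V (length v) v \<in> carrier (tensor_power R V (length v))"
    by (auto simp: tensor_word_closed[OF V] words_of_length_eq)
  have e: "Sh_inj R V (Suc (length w)) (tensor_power_cons R V (length w) x (tensor_word R V (length w) w)) =
      Sh_word R V (x # w)" if "x \<in> carrier V" "w \<in> lists (carrier V)" for x w
    using that by (simp add: Sh_word_def tensor_power_cons_hom(2)[OF V] words_of_length_eq)
  show "Sh_word R V (a # u) \<diamondop> Sh_word R V (b # v) =
    Sh_cons R V a (Sh_word R V u \<diamondop> Sh_word R V (b # v)) \<oplus>\<^bsub>Sh R V\<^esub>
    Sh_cons R V b (Sh_word R V (a # u) \<diamondop> Sh_word R V v)"
    using is_shuffle_product_shuffle_product c ab unfolding is_shuffle_product_def Let_def
    by (simp add: e[OF ab(1) uv(1), symmetric] e[OF ab(2) uv(2), symmetric])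
      (simp add: Sh_word_def)
qed

lemmas shuffle_closed = bilinear_map_closed[OF shuffle_bilinear]
lemmas shuffle_add_left = mod_hom_add[OF bilinear_map_left[OF shuffle_bilinear]]
lemmas shuffle_add_right = mod_hom_add[OF bilinear_map_right[OF shuffle_bilinear]]

lemma shuffle_commute:
  assumes "s \<in> carrier (Sh R V)" "t \<in> carrier (Sh R V)"
  shows "s \<diamondop> t = t \<diamondop> s"
proof (rule spans_bilinear_eq[OF Sh_spans Sh_spans module_Sh module_Sh module_Sh shuffle_bilinear _ _ assms])
  show "bilinear_map R (Sh R V) (Sh R V) (Sh R V) (\<lambda>s t. t \<diamondop> s)"
    by (intro bilinear_mapI bilinear_map_left[OF shuffle_bilinear] bilinear_map_right[OF shuffle_bilinear])
  have "Sh_word R V u \<diamondop> Sh_word R V v = Sh_word R V v \<diamondop> Sh_word R V u"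
    if "u \<in> lists (carrier V)" "v \<in> lists (carrier V)" for u v
    using that
  proof (induction "length u + length v" arbitrary: u v rule: less_induct)
    case less
    show ?case
    proof (cases u; cases v)
      fix a u' b v' assume uv: "u = a # u'" "v = b # v'"
      then have "Sh_word R V u' \<diamondop> Sh_word R V v = Sh_word R V v \<diamondop> Sh_word R V u'"
        "Sh_word R V u \<diamondop> Sh_word R V v' = Sh_word R V v' \<diamondop> Sh_word R V u"
        using less.prems by (auto intro!: less.hyps)
      then show ?thesis
        using less.prems uv
        by (simp add: Sh_cons_word[symmetric] shuffle_cons Sh_word_closed Sh.a_comm Sh_cons_closed shuffle_closed)
    qed (use less.prems in \<open>auto simp: shuffle_one Sh_word_closed\<close>)
  qed
  then show "x \<diamondop> y = y \<diamondop> x"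
    if "x \<in> Sh_word R V ` lists (carrier V)" "y \<in> Sh_word R V ` lists (carrier V)" for x y
    using that by auto
qed

text \<open>For nonempty words with first letters \<open>a\<close>, \<open>b\<close>, \<open>c\<close> both bracketings expand to three terms, one for
  each letter that can come first, and in each of them a shorter triple is shuffled.\<close>

lemma shuffle_assoc_words:
  "\<lbrakk>u \<in> lists (carrier V); v \<in> lists (carrier V); w \<in> lists (carrier V)\<rbrakk> \<Longrightarrow>
    (Sh_word R V u \<diamondop> Sh_word R V v) \<diamondop> Sh_word R V w = Sh_word R V u \<diamondop> (Sh_word R V v \<diamondop> Sh_word R V w)"
proof (induction "length u + length v + length w" arbitrary: u v w rule: less_induct)
  case less
  let ?W = "Sh_word R V"
  show ?case
  proof (cases "u = [] \<or> v = [] \<or> w = []")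
    case True
    then show ?thesis
      using less.prems by (auto simp: shuffle_one Sh_word_closed shuffle_closed)
  next
    case False
    then obtain a u' b v' c w' where uvw: "u = a # u'" "v = b # v'" "w = c # w'"
      by (metis list.exhaust)
    have l: "a \<in> carrier V" "b \<in> carrier V" "c \<in> carrier V" "u' \<in> lists (carrier V)"
      "v' \<in> lists (carrier V)" "w' \<in> lists (carrier V)"
      using less.prems uvw by auto
    have IH: "(?W u' \<diamondop> ?W v) \<diamondop> ?W w = ?W u' \<diamondop> (?W v \<diamondop> ?W w)"
      "(?W u \<diamondop> ?W v') \<diamondop> ?W w = ?W u \<diamondop> (?W v' \<diamondop> ?W w)"
      "(?W u \<diamondop> ?W v) \<diamondop> ?W w' = ?W u \<diamondop> (?W v \<diamondop> ?W w')"
      using less.prems uvw by (auto intro!: less.hyps)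
    note cl = Sh_word_closed[OF less.prems(1)] Sh_word_closed[OF less.prems(2)] Sh_word_closed[OF less.prems(3)]
      Sh_word_closed[OF l(4)] Sh_word_closed[OF l(5)] Sh_word_closed[OF l(6)]
      l(1-3) shuffle_closed Sh_cons_closed
    have W: "?W u = Sh_cons R V a (?W u')" "?W v = Sh_cons R V b (?W v')" "?W w = Sh_cons R V c (?W w')"
      using l by (simp_all add: uvw Sh_cons_word)
    have uv: "?W u \<diamondop> ?W v = Sh_cons R V a (?W u' \<diamondop> ?W v) \<oplus>\<^bsub>Sh R V\<^esub> Sh_cons R V b (?W u \<diamondop> ?W v')"
      and vw: "?W v \<diamondop> ?W w = Sh_cons R V b (?W v' \<diamondop> ?W w) \<oplus>\<^bsub>Sh R V\<^esub> Sh_cons R V c (?W v \<diamondop> ?W w')"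
      using shuffle_cons[of a b "?W u'" "?W v'"] shuffle_cons[of b c "?W v'" "?W w'"] W cl by simp_all
    have cw: "Sh_cons R V x s \<diamondop> ?W w = Sh_cons R V x (s \<diamondop> ?W w) \<oplus>\<^bsub>Sh R V\<^esub> Sh_cons R V c (Sh_cons R V x s \<diamondop> ?W w')"
      if "x \<in> carrier V" "s \<in> carrier (Sh R V)" for x s
      using shuffle_cons[of x c s "?W w'"] that W(3) cl by simp
    have cu: "?W u \<diamondop> Sh_cons R V x s = Sh_cons R V a (?W u' \<diamondop> Sh_cons R V x s) \<oplus>\<^bsub>Sh R V\<^esub> Sh_cons R V x (?W u \<diamondop> s)"
      if "x \<in> carrier V" "s \<in> carrier (Sh R V)" for x s
      using shuffle_cons[of a x "?W u'" s] that W(1) cl by simp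
    have ac: "(x \<oplus>\<^bsub>Sh R V\<^esub> y) \<oplus>\<^bsub>Sh R V\<^esub> (z \<oplus>\<^bsub>Sh R V\<^esub> q) = x \<oplus>\<^bsub>Sh R V\<^esub> (z \<oplus>\<^bsub>Sh R V\<^esub> (y \<oplus>\<^bsub>Sh R V\<^esub> q))"
      "(x \<oplus>\<^bsub>Sh R V\<^esub> y) \<oplus>\<^bsub>Sh R V\<^esub> (z \<oplus>\<^bsub>Sh R V\<^esub> q) = (x \<oplus>\<^bsub>Sh R V\<^esub> z) \<oplus>\<^bsub>Sh R V\<^esub> (y \<oplus>\<^bsub>Sh R V\<^esub> q)"
      if "x \<in> carrier (Sh R V)" "y \<in> carrier (Sh R V)" "z \<in> carrier (Sh R V)" "q \<in> carrier (Sh R V)" for x y z q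
      using that by (simp_all add: Sh.a_ac)
    \<comment> \<open>Four terms arise; the two that begin with \<open>c\<close> recombine to one.\<close>
    have "(?W u \<diamondop> ?W v) \<diamondop> ?W w =
      (Sh_cons R V a ((?W u' \<diamondop> ?W v) \<diamondop> ?W w) \<oplus>\<^bsub>Sh R V\<^esub> Sh_cons R V c (Sh_cons R V a (?W u' \<diamondop> ?W v) \<diamondop> ?W w')) \<oplus>\<^bsub>Sh R V\<^esub>
      (Sh_cons R V b ((?W u \<diamondop> ?W v') \<diamondop> ?W w) \<oplus>\<^bsub>Sh R V\<^esub> Sh_cons R V c (Sh_cons R V b (?W u \<diamondop> ?W v') \<diamondop> ?W w'))"
      by (simp only: uv shuffle_add_left cw cl)
    also have "\<dots> = Sh_cons R V a ((?W u' \<diamondop> ?W v) \<diamondop> ?W w) \<oplus>\<^bsub>Sh R V\<^esub> (Sh_cons R V b ((?W u \<diamondop> ?W v') \<diamondop> ?W w) \<oplus>\<^bsub>Sh R V\<^esub>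
      Sh_cons R V c ((?W u \<diamondop> ?W v) \<diamondop> ?W w'))"
      by (simp only: uv shuffle_add_left Sh_cons_add_right cl ac(1))
    also have "\<dots> = Sh_cons R V a (?W u' \<diamondop> (?W v \<diamondop> ?W w)) \<oplus>\<^bsub>Sh R V\<^esub> (Sh_cons R V b (?W u \<diamondop> (?W v' \<diamondop> ?W w)) \<oplus>\<^bsub>Sh R V\<^esub>
      Sh_cons R V c (?W u \<diamondop> (?W v \<diamondop> ?W w')))"
      by (simp only: IH)
    also have "\<dots> = (Sh_cons R V a (?W u' \<diamondop> Sh_cons R V b (?W v' \<diamondop> ?W w)) \<oplus>\<^bsub>Sh R V\<^esub> Sh_cons R V b (?W u \<diamondop> (?W v' \<diamondop> ?W w))) \<oplus>\<^bsub>Sh R V\<^esub>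
      (Sh_cons R V a (?W u' \<diamondop> Sh_cons R V c (?W v \<diamondop> ?W w')) \<oplus>\<^bsub>Sh R V\<^esub> Sh_cons R V c (?W u \<diamondop> (?W v \<diamondop> ?W w')))"
      by (simp only: vw shuffle_add_right Sh_cons_add_right cl ac(2))
    also have "\<dots> = ?W u \<diamondop> (?W v \<diamondop> ?W w)"
      by (simp only: vw shuffle_add_right cu cl)
    finally show ?thesis .
  qed
qed

lemma shuffle_assoc:
  assumes "s \<in> carrier (Sh R V)" "t \<in> carrier (Sh R V)" "q \<in> carrier (Sh R V)"
  shows "(s \<diamondop> t) \<diamondop> q = s \<diamondop> (t \<diamondop> q)"
proof -
  note l = bilinear_map_left[OF shuffle_bilinear] and r = bilinear_map_right[OF shuffle_bilinear]
  have w: "(x \<diamondop> y) \<diamondop> q = x \<diamondop> (y \<diamondop> q)"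
    if "x \<in> Sh_word R V ` lists (carrier V)" "y \<in> Sh_word R V ` lists (carrier V)" for x y
    by (rule spans_hom_eq[OF Sh_spans module_Sh module_Sh _ _ _ assms(3)])
      (use that in \<open>auto intro!: r mod_hom_comp[OF r r] shuffle_closed Sh_word_closed shuffle_assoc_words\<close>)
  show ?thesis
  proof (rule spans_bilinear_eq[OF Sh_spans Sh_spans module_Sh module_Sh module_Sh _ _ w assms(1,2)])
    show "bilinear_map R (Sh R V) (Sh R V) (Sh R V) (\<lambda>s t. (s \<diamondop> t) \<diamondop> q)"
      by (intro bilinear_mapI mod_hom_comp[OF l l] mod_hom_comp[OF l r] assms(3))
    show "bilinear_map R (Sh R V) (Sh R V) (Sh R V) (\<lambda>s t. s \<diamondop> (t \<diamondop> q))"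
      by (intro bilinear_mapI mod_hom_comp[OF r l] l shuffle_closed assms(3))
  qed
qed

end

section \<open>The matching Zinbiel algebra \<open>Sha\<close>\<close>

locale Sha_module =
  fixes R :: "('r, 'x) ring_scheme" and \<Omega> :: "'o set" and M :: "('r, 'm, 'y) module_scheme"
  assumes M: "module R M"
begin

interpretation M: module R M by (rule M)

abbreviation "V \<equiv> letters R \<Omega> M"
abbreviation "S \<equiv> Sha R \<Omega> M"
abbreviation "L \<equiv> {letter R \<Omega> M \<omega> b | \<omega> b. \<omega> \<in> \<Omega> \<and> b \<in> carrier M}"

lemma module_free_\<Omega>: "module R (free_module R \<Omega>)"
  by (rule module_free_module[OF M.is_cring])

lemma module_letters: "module R V"
  unfolding letters_def by (rule module_tensor[OF module_free_\<Omega> M])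

lemma letter_hom: "\<omega> \<in> \<Omega> \<Longrightarrow> letter R \<Omega> M \<omega> \<in> mod_hom R M V"
  unfolding letters_def letter_def
  by (rule bilinear_map_right[OF tensor_pure_bilinear[OF module_free_\<Omega> M] free_basis_closed[OF M.is_cring]])

lemma letter_closed: "\<lbrakk>\<omega> \<in> \<Omega>; b \<in> carrier M\<rbrakk> \<Longrightarrow> letter R \<Omega> M \<omega> b \<in> carrier V"
  by (rule mod_hom_closed[OF letter_hom])

lemma letters_spans: "spans R V L"
proof -
  have "L = {tensor_pure R (free_module R \<Omega>) M x y | x y. x \<in> free_basis R ` \<Omega> \<and> y \<in> carrier M}"
    by (auto simp: letter_def)
  then show ?thesis
    using tensor_spans[OF module_free_\<Omega> M free_module_spans[OF M.is_cring] spans_carrier]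
    by (simp add: letters_def)
qed

text \<open>The indices \<open>\<omega>\<close> are free generators, so that no compatibility between different \<open>\<omega>\<close> is required:
  the values extend to a bilinear map by \<open>bilinear_extension\<close>, with \<open>M\<close> spanned by all its elements.\<close>

lemma letters_universal:
  assumes P: "module R P" and \<phi>: "\<And>\<omega>. \<omega> \<in> \<Omega> \<Longrightarrow> \<phi> \<omega> \<in> mod_hom R M P"
  shows "\<exists>h \<in> mod_hom R V P. \<forall>\<omega>\<in>\<Omega>. \<forall>b\<in>carrier M. h (letter R \<Omega> M \<omega> b) = \<phi> \<omega> b"
proof -
  have l: "\<exists>h \<in> mod_hom R (free_module R \<Omega>) P. \<forall>\<omega>\<in>\<Omega>. h (free_basis R \<omega>) = \<phi> \<omega> b" if "b \<in> carrier M" for b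
    using mod_hom_closed[OF \<phi> that] by (rule free_module_universal[OF P])
  have r: "\<exists>h \<in> mod_hom R M P. \<forall>b\<in>carrier M. h b = \<phi> \<omega> b" if "\<omega> \<in> \<Omega>" for \<omega>
    using \<phi>[OF that] by auto
  have sp: "spans R M ((\<lambda>b. b) ` carrier M)" by (simp add: spans_carrier)
  have "\<exists>F. bilinear_map R (free_module R \<Omega>) M P F \<and>
      (\<forall>\<omega>\<in>\<Omega>. \<forall>b\<in>carrier M. F (free_basis R \<omega>) b = \<phi> \<omega> b)"
    by (rule bilinear_extension[OF free_module_spans[OF M.is_cring] module_free_\<Omega> sp M P l r])
  then obtain F where F: "bilinear_map R (free_module R \<Omega>) M P F"
    and F\<phi>: "\<And>\<omega> b. \<lbrakk>\<omega> \<in> \<Omega>; b \<in> carrier M\<rbrakk> \<Longrightarrow> F (free_basis R \<omega>) b = \<phi> \<omega> b"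
    by blast
  from tensor_universal[OF module_free_\<Omega> M P F]
  obtain h where "h \<in> mod_hom R V P"
    "\<And>x b. \<lbrakk>x \<in> carrier (free_module R \<Omega>); b \<in> carrier M\<rbrakk> \<Longrightarrow> h (tensor_pure R (free_module R \<Omega>) M x b) = F x b"
    by (auto simp: letters_def)
  then show ?thesis
    by (intro bexI[of _ h]) (simp_all add: letter_def F\<phi> free_basis_closed[OF M.is_cring])
qed

interpretation Sh: module R "Sh R V" by (rule module_Sh[OF module_letters])

lemma module_Sha: "module R S"
  unfolding Sha_def by (rule module_tensor[OF M Sh.module_axioms])

interpretation Sha: module R S by (rule module_Sha)

lemma Sha_pure_bilinear: "bilinear_map R M (Sh R V) S (Sha_pure R \<Omega> M)"
  unfolding Sha_def Sha_pure_def by (rule tensor_pure_bilinear[OF M Sh.module_axioms])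

lemmas Sha_pure_closed = bilinear_map_closed[OF Sha_pure_bilinear]

lemma Sha_spans_pure:
  assumes "spans R (Sh R V) T"
  shows "spans R S ((\<lambda>(a, s). Sha_pure R \<Omega> M a s) ` (carrier M \<times> T))"
proof -
  have "(\<lambda>(a, s). Sha_pure R \<Omega> M a s) ` (carrier M \<times> T) =
      {tensor_pure R M (Sh R V) a s | a s. a \<in> carrier M \<and> s \<in> T}"
    by (auto simp: Sha_pure_def)
  then show ?thesis
    using tensor_spans[OF M Sh.module_axioms spans_carrier assms] by (simp add: Sha_def)
qed

lemmas Sha_spans = Sha_spans_pure[OF spans_carrier]

lemma Sha_universal:
  assumes "module R P" "bilinear_map R M (Sh R V) P \<beta>"
  shows "\<exists>h \<in> mod_hom R S P. \<forall>a\<in>carrier M. \<forall>s\<in>carrier (Sh R V). h (Sha_pure R \<Omega> M a s) = \<beta> a s"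
  unfolding Sha_def Sha_pure_def by (rule tensor_universal[OF M Sh.module_axioms assms])

lemmas V = module_letters
lemmas mul = shuffle_bilinear[OF V]
lemmas cons = Sh_cons_hom[OF V]

text \<open>The right-hand side of the formula is bilinear in \<open>(a, s)\<close> and in \<open>(b, t)\<close>, hence linear on each
  tensor factor, and \<open>bilinear_extension\<close> applies with the pure tensors as generators.\<close>

lemma is_Sha_prec_Sha_prec:
  assumes \<omega>: "\<omega> \<in> \<Omega>"
  shows "is_Sha_prec R \<Omega> M \<omega> (Sha_prec R \<Omega> M \<omega>)"
proof -
  let ?sh = "shuffle_product R V" and ?c = "\<lambda>b t. Sh_cons R V (letter R \<Omega> M \<omega> b) t"
  have c: "bilinear_map R M (Sh R V) (Sh R V) ?c"
    by (intro bilinear_mapI cons letter_closed \<omega> mod_hom_comp[OF bilinear_map_left[OF Sh_cons_bilinear[OF V]] letter_hom])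
  let ?B = "carrier M \<times> carrier (Sh R V)"
  let ?\<phi> = "\<lambda>(a, s) (b, t). Sha_pure R \<Omega> M a (?sh s (?c b t))"
  have l: "\<exists>h \<in> mod_hom R S S. \<forall>p\<in>?B. h ((\<lambda>(a, s). Sha_pure R \<Omega> M a s) p) = ?\<phi> p q" if q: "q \<in> ?B" for q
  proof -
    obtain b t where bt: "q = (b, t)" "b \<in> carrier M" "t \<in> carrier (Sh R V)" using q by auto
    note ct = bilinear_map_closed[OF c bt(2,3)]
    have "bilinear_map R M (Sh R V) S (\<lambda>a s. Sha_pure R \<Omega> M a (?sh s (?c b t)))"
      by (intro bilinear_mapI bilinear_map_comp_right[OF Sha_pure_bilinear bilinear_map_left[OF mul ct]]
          bilinear_map_left[OF Sha_pure_bilinear] bilinear_map_closed[OF mul] ct)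
    from Sha_universal[OF module_Sha this] show ?thesis
      by (auto simp: bt(1))
  qed
  have r: "\<exists>h \<in> mod_hom R S S. \<forall>q\<in>?B. h ((\<lambda>(a, s). Sha_pure R \<Omega> M a s) q) = ?\<phi> p q" if p: "p \<in> ?B" for p
  proof -
    obtain a s where as: "p = (a, s)" "a \<in> carrier M" "s \<in> carrier (Sh R V)" using p by auto
    have h: "(\<lambda>x. Sha_pure R \<Omega> M a (?sh s x)) \<in> mod_hom R (Sh R V) S"
      by (rule mod_hom_comp[OF bilinear_map_right[OF Sha_pure_bilinear as(2)] bilinear_map_right[OF mul as(3)]])
    have "bilinear_map R M (Sh R V) S (\<lambda>b t. Sha_pure R \<Omega> M a (?sh s (?c b t)))"
      by (intro bilinear_mapI mod_hom_comp[OF h bilinear_map_right[OF c]] mod_hom_comp[OF h bilinear_map_left[OF c]])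
    from Sha_universal[OF module_Sha this] show ?thesis
      by (auto simp: as(1))
  qed
  have "\<exists>F. bilinear_map R S S S F \<and> (\<forall>p\<in>?B. \<forall>q\<in>?B.
      F ((\<lambda>(a, s). Sha_pure R \<Omega> M a s) p) ((\<lambda>(a, s). Sha_pure R \<Omega> M a s) q) = ?\<phi> p q)"
    by (rule bilinear_extension[OF Sha_spans module_Sha Sha_spans module_Sha module_Sha l r])
  then obtain F where F: "bilinear_map R S S S F"
    and F\<phi>: "\<And>p q. \<lbrakk>p \<in> ?B; q \<in> ?B\<rbrakk> \<Longrightarrow>
      F ((\<lambda>(a, s). Sha_pure R \<Omega> M a s) p) ((\<lambda>(a, s). Sha_pure R \<Omega> M a s) q) = ?\<phi> p q"
    by blast
  have "is_Sha_prec R \<Omega> M \<omega> F"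
    unfolding is_Sha_prec_def Let_def
  proof (intro conjI F ballI allI)
    fix a b m n s t
    assume *: "a \<in> carrier M" "b \<in> carrier M"
      "s \<in> carrier (tensor_power R V m)" "t \<in> carrier (tensor_power R V n)"
    show "F (Sha_pure R \<Omega> M a (Sh_inj R V m s)) (Sha_pure R \<Omega> M b (Sh_inj R V n t)) =
      Sha_pure R \<Omega> M a (?sh (Sh_inj R V m s) (Sh_inj R V (Suc n) (tensor_power_cons R V n (letter R \<Omega> M \<omega> b) t)))"
      using F\<phi>[of "(a, Sh_inj R V m s)" "(b, Sh_inj R V n t)"] * mod_hom_closed[OF Sh_inj_hom[OF V]]
      by (simp add: Sh_cons_inj[OF V letter_closed[OF \<omega> *(2)] *(4)])
  qed
  then show ?thesis
    unfolding Sha_prec_def by (rule someI[where P = "is_Sha_prec R \<Omega> M \<omega>"])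
qed

lemma Sha_prec_bilinear: "\<omega> \<in> \<Omega> \<Longrightarrow> bilinear_map R S S S (Sha_prec R \<Omega> M \<omega>)"
  using is_Sha_prec_Sha_prec by (simp add: is_Sha_prec_def Let_def)

text \<open>The formula for \<^const>\<open>Sha_prec\<close> speaks of homogeneous \<open>s\<close> and \<open>t\<close>; by bilinearity it holds without
  a restriction on the degree.\<close>

lemma Sha_prec_pure:
  assumes \<omega>: "\<omega> \<in> \<Omega>" and ab: "a \<in> carrier M" "b \<in> carrier M"
    and st: "s \<in> carrier (Sh R V)" "t \<in> carrier (Sh R V)"
  shows "Sha_prec R \<Omega> M \<omega> (Sha_pure R \<Omega> M a s) (Sha_pure R \<Omega> M b t) =
    Sha_pure R \<Omega> M a (shuffle_product R V s (Sh_cons R V (letter R \<Omega> M \<omega> b) t))"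
proof -
  note p = Sha_prec_bilinear[OF \<omega>] and pa = bilinear_map_right[OF Sha_pure_bilinear ab(1)]
    and pb = bilinear_map_right[OF Sha_pure_bilinear ab(2)] and x = letter_closed[OF \<omega> ab(2)]
  show ?thesis
  proof (rule spans_bilinear_eq[OF Sh_spans[OF V] Sh_spans[OF V] Sh.module_axioms Sh.module_axioms module_Sha _ _ _ st])
    show "bilinear_map R (Sh R V) (Sh R V) S (\<lambda>s t. Sha_prec R \<Omega> M \<omega> (Sha_pure R \<Omega> M a s) (Sha_pure R \<Omega> M b t))"
      by (rule bilinear_mapI)
        (auto intro: bilinear_map_comp_right[OF p pb] bilinear_map_comp_left[OF p pa] mod_hom_closed[OF pa] mod_hom_closed[OF pb])
    show "bilinear_map R (Sh R V) (Sh R V) S (\<lambda>s t. Sha_pure R \<Omega> M a (shuffle_product R V s (Sh_cons R V (letter R \<Omega> M \<omega> b) t)))"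
    proof (rule bilinear_mapI)
      fix s assume s: "s \<in> carrier (Sh R V)"
      show "(\<lambda>t. Sha_pure R \<Omega> M a (shuffle_product R V s (Sh_cons R V (letter R \<Omega> M \<omega> b) t))) \<in> mod_hom R (Sh R V) S"
        by (rule mod_hom_comp[OF pa bilinear_map_comp_right[OF mul cons[OF x] s]])
      show "(\<lambda>t. Sha_pure R \<Omega> M a (shuffle_product R V t (Sh_cons R V (letter R \<Omega> M \<omega> b) s))) \<in> mod_hom R (Sh R V) S"
        by (rule mod_hom_comp[OF pa bilinear_map_left[OF mul mod_hom_closed[OF cons[OF x] s]]])
    qed
    fix s t assume "s \<in> Sh_word R V ` lists (carrier V)" "t \<in> Sh_word R V ` lists (carrier V)"
    then obtain u v where u: "u \<in> lists (carrier V)" "s = Sh_inj R V (length u) (tensor_word R V (length u) u)"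
      and v: "v \<in> lists (carrier V)" "t = Sh_inj R V (length v) (tensor_word R V (length v) v)"
      by (auto simp: Sh_word_def)
    have w: "tensor_word R V (length w) w \<in> carrier (tensor_power R V (length w))" if "w \<in> lists (carrier V)" for w
      using that by (auto simp: words_of_length_eq intro: tensor_word_closed[OF V])
    show "Sha_prec R \<Omega> M \<omega> (Sha_pure R \<Omega> M a s) (Sha_pure R \<Omega> M b t) =
      Sha_pure R \<Omega> M a (shuffle_product R V s (Sh_cons R V (letter R \<Omega> M \<omega> b) t))"
      unfolding u(2) v(2) Sh_cons_inj[OF V x w[OF v(1)]]
      using is_Sha_prec_Sha_prec[OF \<omega>] ab w[OF u(1)] w[OF v(1)] by (simp add: is_Sha_prec_def Let_def)
  qed
qed

lemma Sha_emb_hom: "Sha_emb R \<Omega> M \<in> mod_hom R M S"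
  unfolding Sha_emb_def
  using bilinear_map_left[OF Sha_pure_bilinear] Sh_word_closed[OF V, of "[]"] by (simp add: Sh_one_eq)

text \<open>Put \<open>B = (\<alpha> \<otimes> b) \<otimes> t\<close> and \<open>C = (\<beta> \<otimes> c) \<otimes> q\<close>. By associativity the left-hand side is \<open>a\<close> tensored with
  the shuffle of \<open>s\<close> with the shuffle of \<open>B\<close> and \<open>C\<close>. The recursion for the latter has two summands,
  one beginning with \<open>\<alpha> \<otimes> b\<close> and one with \<open>\<beta> \<otimes> c\<close>, and these give the two terms on the right. The
  second needs commutativity, as \<open>y\<close> and \<open>z\<close> are exchanged there.\<close>

lemma Sha_zinbiel_pure:
  assumes \<alpha>\<beta>: "\<alpha> \<in> \<Omega>" "\<beta> \<in> \<Omega>" and abc: "a \<in> carrier M" "b \<in> carrier M" "c \<in> carrier M"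
    and stq: "s \<in> carrier (Sh R V)" "t \<in> carrier (Sh R V)" "q \<in> carrier (Sh R V)"
  defines "x \<equiv> Sha_pure R \<Omega> M a s" and "y \<equiv> Sha_pure R \<Omega> M b t" and "z \<equiv> Sha_pure R \<Omega> M c q"
  shows "Sha_prec R \<Omega> M \<beta> (Sha_prec R \<Omega> M \<alpha> x y) z =
    Sha_prec R \<Omega> M \<alpha> x (Sha_prec R \<Omega> M \<beta> y z) \<oplus>\<^bsub>S\<^esub> Sha_prec R \<Omega> M \<beta> x (Sha_prec R \<Omega> M \<alpha> z y)"
proof -
  let ?sh = "shuffle_product R V"
  define B where "B = Sh_cons R V (letter R \<Omega> M \<alpha> b) t"
  define C where "C = Sh_cons R V (letter R \<Omega> M \<beta> c) q"
  note l = letter_closed[OF \<alpha>\<beta>(1) abc(2)] letter_closed[OF \<alpha>\<beta>(2) abc(3)]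
  note cl = shuffle_closed[OF V] Sh_cons_closed[OF V]
  have BC: "B \<in> carrier (Sh R V)" "C \<in> carrier (Sh R V)"
    using l stq by (simp_all add: B_def C_def cl)
  have "Sha_prec R \<Omega> M \<beta> (Sha_prec R \<Omega> M \<alpha> x y) z = Sha_pure R \<Omega> M a (?sh (?sh s B) C)"
    using \<alpha>\<beta> abc stq l BC by (simp add: x_def y_def z_def Sha_prec_pure cl B_def C_def)
  also have "?sh (?sh s B) C = ?sh s (?sh B C)"
    by (rule shuffle_assoc[OF V stq(1) BC])
  also have "?sh B C = Sh_cons R V (letter R \<Omega> M \<alpha> b) (?sh t C) \<oplus>\<^bsub>Sh R V\<^esub> Sh_cons R V (letter R \<Omega> M \<beta> c) (?sh q B)"
    unfolding shuffle_commute[OF V stq(3) BC(1)]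
    unfolding B_def C_def by (rule shuffle_cons[OF V l stq(2,3)])
  also have "?sh s \<dots> = ?sh s (Sh_cons R V (letter R \<Omega> M \<alpha> b) (?sh t C)) \<oplus>\<^bsub>Sh R V\<^esub>
      ?sh s (Sh_cons R V (letter R \<Omega> M \<beta> c) (?sh q B))"
    using l stq BC by (simp add: shuffle_add_right[OF V] cl)
  also have "Sha_pure R \<Omega> M a \<dots> = Sha_pure R \<Omega> M a (?sh s (Sh_cons R V (letter R \<Omega> M \<alpha> b) (?sh t C))) \<oplus>\<^bsub>S\<^esub>
      Sha_pure R \<Omega> M a (?sh s (Sh_cons R V (letter R \<Omega> M \<beta> c) (?sh q B)))"
    using l stq BC abc by (simp add: mod_hom_add[OF bilinear_map_right[OF Sha_pure_bilinear]] cl)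
  also have "\<dots> = Sha_prec R \<Omega> M \<alpha> x (Sha_prec R \<Omega> M \<beta> y z) \<oplus>\<^bsub>S\<^esub> Sha_prec R \<Omega> M \<beta> x (Sha_prec R \<Omega> M \<alpha> z y)"
    using \<alpha>\<beta> abc stq l BC by (simp add: x_def y_def z_def Sha_prec_pure cl B_def C_def)
  finally show ?thesis .
qed

lemma matching_zinbiel_algebra_Sha: "matching_zinbiel_algebra R \<Omega> S (Sha_prec R \<Omega> M)"
proof
  fix \<alpha> \<beta> x y z assume \<alpha>\<beta>: "\<alpha> \<in> \<Omega>" "\<beta> \<in> \<Omega>" and xyz: "x \<in> carrier S" "y \<in> carrier S" "z \<in> carrier S"
  let ?A = "Sha_prec R \<Omega> M \<alpha>" and ?B = "Sha_prec R \<Omega> M \<beta>"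
  note A = Sha_prec_bilinear[OF \<alpha>\<beta>(1)] and B = Sha_prec_bilinear[OF \<alpha>\<beta>(2)]
  note Al = bilinear_map_left[OF A] and Ar = bilinear_map_right[OF A] and Ac = bilinear_map_closed[OF A]
  note Bl = bilinear_map_left[OF B] and Br = bilinear_map_right[OF B] and Bc = bilinear_map_closed[OF B]
  note eq = spans_hom_eq[OF Sha_spans module_Sha module_Sha]
  let ?P = "(\<lambda>(a, s). Sha_pure R \<Omega> M a s) ` (carrier M \<times> carrier (Sh R V))"
  have P: "p \<in> carrier S" if "p \<in> ?P" for p using that by (auto intro: Sha_pure_closed)
  \<comment> \<open>The identity is linear in each of \<open>x\<close>, \<open>y\<close>, \<open>z\<close>; pure tensors are replaced by arbitrary elements
    in the order \<open>z\<close>, \<open>y\<close>, \<open>x\<close>.\<close>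
  have 1: "?B (?A x y) z = ?A x (?B y z) \<oplus>\<^bsub>S\<^esub> ?B x (?A z y)"
    if "x \<in> ?P" "y \<in> ?P" "z \<in> ?P" for x y z
    using that Sha_zinbiel_pure[OF \<alpha>\<beta>] by auto
  have 2: "?B (?A x y) z = ?A x (?B y z) \<oplus>\<^bsub>S\<^esub> ?B x (?A z y)"
    if xy: "x \<in> ?P" "y \<in> ?P" and z: "z \<in> carrier S" for x y z
    by (rule eq[OF Br[OF Ac] mod_hom_sum[OF module_Sha mod_hom_comp[OF Ar Br] mod_hom_comp[OF Br Al]] 1 z])
      (use xy P in auto)
  have 3: "?B (?A x y) z = ?A x (?B y z) \<oplus>\<^bsub>S\<^esub> ?B x (?A z y)"
    if x: "x \<in> ?P" and yz: "y \<in> carrier S" "z \<in> carrier S" for x y z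
    by (rule eq[OF mod_hom_comp[OF Bl Ar] mod_hom_sum[OF module_Sha mod_hom_comp[OF Ar Bl] mod_hom_comp[OF Br Ar]] 2 yz(1)])
      (use x yz P in auto)
  show "?B (?A x y) z = ?A x (?B y z) \<oplus>\<^bsub>S\<^esub> ?B x (?A z y)"
    by (rule eq[OF mod_hom_comp[OF Bl Al] mod_hom_sum[OF module_Sha Al[OF Bc] Bl[OF Ac]] 3 xyz(1)])
      (use xyz P in auto)
qed (rule Sha_prec_bilinear)

end

section \<open>The universal property\<close>

text \<open>On a word \<open>(\<omega>\<^sub>1 \<otimes> b\<^sub>1) \<dots> (\<omega>\<^sub>n \<otimes> b\<^sub>n)\<close> this is the product of \<open>d\<close>, \<open>f b\<^sub>1\<close>, ..., \<open>f b\<^sub>n\<close> bracketed to the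
  right, with the operations \<open>\<omega>\<^sub>1\<close>, ..., \<open>\<omega>\<^sub>n\<close> in this order. A general letter is a sum of letters of the
  form \<open>\<omega> \<otimes> b\<close>; the choice operator picks the linear extension to it.\<close>

primrec nested_product ::
  "('r, 'x) ring_scheme \<Rightarrow> 'o set \<Rightarrow> ('r, 'm, 'y) module_scheme \<Rightarrow>
   ('r, 'd, 'z) module_scheme \<Rightarrow> ('o \<Rightarrow> 'd \<Rightarrow> 'd \<Rightarrow> 'd) \<Rightarrow> ('m \<Rightarrow> 'd) \<Rightarrow>
   ('r, 'o, 'm) letter list \<Rightarrow> 'd \<Rightarrow> 'd"
  where
    "nested_product R \<Omega> M D circ f [] d = d"
  | "nested_product R \<Omega> M D circ f (v # w) d =
      (SOME h. h \<in> mod_hom R (letters R \<Omega> M) D \<and>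
        (\<forall>\<omega>\<in>\<Omega>. \<forall>b\<in>carrier M. h (letter R \<Omega> M \<omega> b) = circ \<omega> d (nested_product R \<Omega> M D circ f w (f b)))) v"

declare nested_product.simps(2) [simp del]

locale Sha_target = Sha_module R \<Omega> M + D: matching_zinbiel_algebra R \<Omega> D circ
  for R :: "('r, 'x) ring_scheme" and \<Omega> :: "'o set" and M :: "('r, 'm, 'y) module_scheme"
    and D :: "('r, 'd, 'z) module_scheme" and circ :: "'o \<Rightarrow> 'd \<Rightarrow> 'd \<Rightarrow> 'd" +
  fixes f :: "'m \<Rightarrow> 'd"
  assumes f: "f \<in> mod_hom R M D"
begin

abbreviation "np \<equiv> nested_product R \<Omega> M D circ f"

lemmas D = D.module_axioms
lemmas f_closed = mod_hom_closed[OF f]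
lemmas circ_left = bilinear_map_left[OF D.bilinear]
lemmas circ_right = bilinear_map_right[OF D.bilinear]

text \<open>The linear extension chosen in \<^const>\<open>nested_product\<close> exists, provided that the product over the
  rest of the word is linear in its first factor, through which the letter acts.\<close>

lemma np_Cons:
  assumes w: "np w \<in> mod_hom R D D" and d: "d \<in> carrier D"
  shows "(\<lambda>v. np (v # w) d) \<in> mod_hom R V D"
    and "\<lbrakk>\<omega> \<in> \<Omega>; b \<in> carrier M\<rbrakk> \<Longrightarrow> np (letter R \<Omega> M \<omega> b # w) d = circ \<omega> d (np w (f b))"
proof -
  have "(\<lambda>b. circ \<omega> d (np w (f b))) \<in> mod_hom R M D" if "\<omega> \<in> \<Omega>" for \<omega>
    by (rule mod_hom_comp[OF circ_right[OF that d] mod_hom_comp[OF w f]])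
  then have "\<exists>h \<in> mod_hom R V D. \<forall>\<omega>\<in>\<Omega>. \<forall>b\<in>carrier M. h (letter R \<Omega> M \<omega> b) = circ \<omega> d (np w (f b))"
    by (rule letters_universal[OF D])
  note * = someI_ex[OF this[unfolded Bex_def]]
  show "(\<lambda>v. np (v # w) d) \<in> mod_hom R V D"
    using conjunct1[OF *] by (simp add: nested_product.simps(2))
  show "np (letter R \<Omega> M \<omega> b # w) d = circ \<omega> d (np w (f b))" if "\<omega> \<in> \<Omega>" "b \<in> carrier M"
    using conjunct2[OF *] that by (simp add: nested_product.simps(2))
qed

lemma np_Cons_bilinear:
  assumes w: "np w \<in> mod_hom R D D"
  shows "bilinear_map R V D D (\<lambda>v. np (v # w))"
proof (rule bilinear_map_if_linear_on_spanning_set[OF letters_spans V D D np_Cons(1)[OF w]])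
  fix v assume "v \<in> L"
  then obtain \<omega> b where v: "\<omega> \<in> \<Omega>" "b \<in> carrier M" "v = letter R \<Omega> M \<omega> b" by auto
  show "np (v # w) \<in> mod_hom R D D"
    by (rule mod_hom_cong[OF D circ_left[OF v(1) mod_hom_closed[OF w f_closed[OF v(2)]]]])
      (simp only: v(3) np_Cons(2)[OF w _ v(1,2)])
qed

lemma np_hom: "w \<in> lists (carrier V) \<Longrightarrow> np w \<in> mod_hom R D D"
proof (induction w)
  case Nil
  show ?case by (rule mod_hom_cong[OF D mod_hom_id]) simp
next
  case (Cons v w)
  then show ?case by (intro bilinear_map_right[OF np_Cons_bilinear]) auto
qed

lemma np_letter:
  assumes "\<omega> \<in> \<Omega>" "b \<in> carrier M" "w \<in> lists (carrier V)" "d \<in> carrier D"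
  shows "np (letter R \<Omega> M \<omega> b # w) d = circ \<omega> d (np w (f b))"
  by (rule np_Cons(2)[OF np_hom]) (use assms in auto)

text \<open>Induction on the letters \<open>us\<close> in front of \<open>x\<close>. The dependence on the foremost letter is linear as
  well, so that this letter may be taken of the form \<open>\<omega> \<otimes> b\<close>; then it becomes an operation
  applied to the shorter product.\<close>

lemma np_linear_in_letter:
  assumes vs: "vs \<in> lists (carrier V)"
  shows "\<lbrakk>us \<in> lists (carrier V); d \<in> carrier D\<rbrakk> \<Longrightarrow> (\<lambda>x. np (us @ x # vs) d) \<in> mod_hom R V D"
proof (induction us arbitrary: d)
  case Nil
  then show ?case using np_Cons(1)[OF np_hom[OF vs]] by simp
next
  case (Cons u us)
  have "bilinear_map R V V D (\<lambda>u x. np (u # us @ x # vs) d)"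
  proof (rule bilinear_map_if_linear_on_spanning_set[OF letters_spans V V D])
    fix x assume "x \<in> carrier V"
    then show "(\<lambda>u. np (u # us @ x # vs) d) \<in> mod_hom R V D"
      using Cons.prems vs by (intro np_Cons(1) np_hom) auto
  next
    fix v assume "v \<in> L"
    then obtain \<omega> b where v: "\<omega> \<in> \<Omega>" "b \<in> carrier M" "v = letter R \<Omega> M \<omega> b" by auto
    have "(\<lambda>x. circ \<omega> d (np (us @ x # vs) (f b))) \<in> mod_hom R V D"
      by (rule mod_hom_comp[OF circ_right[OF v(1) Cons.prems(2)] Cons.IH[OF _ f_closed[OF v(2)]]])
        (use Cons.prems in auto)
    then show "(\<lambda>x. np (v # us @ x # vs) d) \<in> mod_hom R V D"
      by (rule mod_hom_cong[OF V])
        (use Cons.prems vs v in \<open>auto simp: np_letter\<close>)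
  qed
  from bilinear_map_right[OF this] show ?case
    using Cons.prems(1) by auto
qed

lemma np_multilinear:
  assumes d: "d \<in> carrier D"
  shows "multilinear R V n D (\<lambda>w. np w d)"
proof (rule multilinearI)
  show "np w d \<in> carrier D" if "w \<in> words_of_length V n" for w
    using that by (intro mod_hom_closed[OF np_hom d]) (simp add: words_of_length_eq)
  fix us x vs assume "us @ x # vs \<in> words_of_length V n"
  then have w: "us \<in> lists (carrier V)" "x \<in> carrier V" "vs \<in> lists (carrier V)"
    by (auto simp: words_of_length_eq)
  note h = np_linear_in_letter[OF w(3,1) d]
  show "np (us @ (x \<oplus>\<^bsub>V\<^esub> y) # vs) d = np (us @ x # vs) d \<oplus>\<^bsub>D\<^esub> np (us @ y # vs) d" if "y \<in> carrier V" for y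
    by (rule mod_hom_add[OF h w(2) that])
  show "np (us @ (r \<odot>\<^bsub>V\<^esub> x) # vs) d = r \<odot>\<^bsub>D\<^esub> np (us @ x # vs) d" if "r \<in> carrier R" for r
    by (rule mod_hom_smult[OF h that w(2)])
qed

interpretation Sh: module R "Sh R V" by (rule module_Sh[OF module_letters])

lemma np_extends:
  "\<exists>F. bilinear_map R (Sh R V) D D F \<and>
    (\<forall>w\<in>lists (carrier V). \<forall>d\<in>carrier D. F (Sh_word R V w) d = np w d)"
proof -
  have sp: "spans R D ((\<lambda>d. d) ` carrier D)" by (simp add: spans_carrier)
  have l: "\<exists>h\<in>mod_hom R (Sh R V) D. \<forall>w\<in>lists (carrier V). h (Sh_word R V w) = np w d"
    if "d \<in> carrier D" for d
    by (rule Sh_universal[OF V D np_multilinear[OF that]])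
  have r: "\<exists>h\<in>mod_hom R D D. \<forall>d\<in>carrier D. h d = np w d" if "w \<in> lists (carrier V)" for w
    using np_hom[OF that] by auto
  show ?thesis
    by (rule bilinear_extension[OF Sh_spans[OF V] Sh.module_axioms sp D D l r])
qed

lemma lists_letters: "w \<in> lists L \<Longrightarrow> w \<in> lists (carrier V)"
  using lists_mono[OF spans_subset[OF letters_spans]] by auto

text \<open>This is the compatibility of the extension of \<open>f\<close> with the products, with the first tensor factor
  replaced by an arbitrary \<open>d\<close> so that the induction goes through. For nonempty \<open>u\<close> with first letter
  \<open>\<alpha> \<otimes> x\<close> the recursion of the shuffle product yields two summands. The induction hypothesis
  for the first one is used with \<open>f x\<close> in place of \<open>d\<close>, and for the second one, after commuting,
  with the two words exchanged and \<open>f b\<close> in place of \<open>d\<close>. The resulting sum is the right-hand side of the matching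
  Zinbiel identity in \<open>D\<close>.\<close>

lemma np_shuffle:
  assumes F: "bilinear_map R (Sh R V) D D F"
    and Fw: "\<And>w d. \<lbrakk>w \<in> lists (carrier V); d \<in> carrier D\<rbrakk> \<Longrightarrow> F (Sh_word R V w) d = np w d"
  shows "\<lbrakk>u \<in> lists L; v \<in> lists L; \<omega> \<in> \<Omega>; b \<in> carrier M; d \<in> carrier D\<rbrakk> \<Longrightarrow>
    F (shuffle_product R V (Sh_word R V u) (Sh_cons R V (letter R \<Omega> M \<omega> b) (Sh_word R V v))) d =
    circ \<omega> (np u d) (np v (f b))"
proof (induction "length u + length v" arbitrary: u v \<omega> b d rule: less_induct)
  case less
  let ?W = "Sh_word R V" and ?sh = "shuffle_product R V"
  let ?B = "Sh_cons R V (letter R \<Omega> M \<omega> b)"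
  note u = lists_letters[OF less.prems(1)] and v = lists_letters[OF less.prems(2)]
  note \<omega> = less.prems(3) and b = less.prems(4) and d = less.prems(5)
  note cl = Sh_word_closed[OF V] Sh_cons_closed[OF V] shuffle_closed[OF V] letter_closed
  show ?case
  proof (cases u)
    case Nil
    then show ?thesis
      using v \<omega> b d by (simp add: shuffle_one[OF V] cl Sh_cons_word[OF V] Fw np_letter)
  next
    case (Cons a u')
    then obtain \<alpha> x where ax: "\<alpha> \<in> \<Omega>" "x \<in> carrier M" "a = letter R \<Omega> M \<alpha> x"
      and u': "u' \<in> lists L" using less.prems(1) by auto
    let ?A = "Sh_cons R V (letter R \<Omega> M \<alpha> x)"
    note u'V = lists_letters[OF u']
    have Wu: "?W u = ?A (?W u')"
      using u'V ax by (simp add: Cons Sh_cons_word[OF V] letter_closed)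
    have nu: "np u' (f x) \<in> carrier D" and nv: "np v (f b) \<in> carrier D"
      using mod_hom_closed[OF np_hom] u'V v f_closed ax(2) b by auto
    have IH1: "F (?sh (?W u') (?B (?W v))) (f x) = circ \<omega> (np u' (f x)) (np v (f b))"
      by (rule less.hyps) (use less.prems u' ax f_closed Cons in auto)
    have IH2: "F (?sh (?W v) (?A (?W u'))) (f b) = circ \<alpha> (np v (f b)) (np u' (f x))"
      by (rule less.hyps) (use less.prems u' ax f_closed Cons in auto)
    \<comment> \<open>Prepending a letter is one more outer operation, also for sums of words.\<close>
    have Fcons: "F (Sh_cons R V (letter R \<Omega> M \<gamma> c) s) d = circ \<gamma> d (F s (f c))"
      if "\<gamma> \<in> \<Omega>" "c \<in> carrier M" "s \<in> carrier (Sh R V)" for \<gamma> c s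
    proof (rule spans_hom_eq[OF Sh_spans[OF V] Sh.module_axioms D _ _ _ that(3)])
      show "(\<lambda>s. F (Sh_cons R V (letter R \<Omega> M \<gamma> c) s) d) \<in> mod_hom R (Sh R V) D"
        by (rule bilinear_map_comp_left[OF F Sh_cons_hom[OF V letter_closed[OF that(1,2)]] d])
      show "(\<lambda>s. circ \<gamma> d (F s (f c))) \<in> mod_hom R (Sh R V) D"
        by (rule mod_hom_comp[OF circ_right[OF that(1) d] bilinear_map_left[OF F f_closed[OF that(2)]]])
      fix s assume "s \<in> ?W ` lists (carrier V)"
      then obtain w where "w \<in> lists (carrier V)" "s = ?W w" by blast
      then show "F (Sh_cons R V (letter R \<Omega> M \<gamma> c) s) d = circ \<gamma> d (F s (f c))"
        using that(1,2) d f_closed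
        by (simp add: Sh_cons_word[OF V] letter_closed Fw np_letter)
    qed
    have "F (?sh (?W u) (?B (?W v))) d =
      F (?A (?sh (?W u') (?B (?W v))) \<oplus>\<^bsub>Sh R V\<^esub> ?B (?sh (?A (?W u')) (?W v))) d"
      using u'V v \<omega> b ax by (simp add: Wu shuffle_cons[OF V] cl)
    also have "?sh (?A (?W u')) (?W v) = ?sh (?W v) (?A (?W u'))"
      using u'V v ax by (intro shuffle_commute[OF V] cl) auto
    also have "F (?A (?sh (?W u') (?B (?W v))) \<oplus>\<^bsub>Sh R V\<^esub> ?B (?sh (?W v) (?A (?W u')))) d =
      F (?A (?sh (?W u') (?B (?W v)))) d \<oplus>\<^bsub>D\<^esub> F (?B (?sh (?W v) (?A (?W u')))) d"
      using u'V v \<omega> b ax by (intro mod_hom_add[OF bilinear_map_left[OF F d]]) (simp_all add: cl)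
    also have "\<dots> = circ \<alpha> d (circ \<omega> (np u' (f x)) (np v (f b))) \<oplus>\<^bsub>D\<^esub> circ \<omega> d (circ \<alpha> (np v (f b)) (np u' (f x)))"
      using u'V v \<omega> b ax by (simp add: Fcons cl IH1 IH2)
    also have "\<dots> = circ \<omega> (circ \<alpha> d (np u' (f x))) (np v (f b))"
      by (rule D.matching_zinbiel[OF ax(1) \<omega> d nu nv, symmetric])
    also have "circ \<alpha> d (np u' (f x)) = np u d"
      using ax u'V d by (simp add: Cons np_letter)
    finally show ?thesis .
  qed
qed

lemma Sha_hom_exists:
  "\<exists>g \<in> matching_zinbiel_hom R \<Omega> S (Sha_prec R \<Omega> M) D circ. \<forall>a\<in>carrier M. f a = g (Sha_emb R \<Omega> M a)"
proof -
  obtain F where F: "bilinear_map R (Sh R V) D D F"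
    and Fw: "\<And>w d. \<lbrakk>w \<in> lists (carrier V); d \<in> carrier D\<rbrakk> \<Longrightarrow> F (Sh_word R V w) d = np w d"
    using np_extends by blast
  have "bilinear_map R M (Sh R V) D (\<lambda>a s. F s (f a))"
    by (rule bilinear_mapI) (auto intro: bilinear_map_left[OF F] f_closed bilinear_map_comp_right[OF F f])
  from Sha_universal[OF D this] obtain g where g: "g \<in> mod_hom R S D"
    and g_pure: "\<And>a s. \<lbrakk>a \<in> carrier M; s \<in> carrier (Sh R V)\<rbrakk> \<Longrightarrow> g (Sha_pure R \<Omega> M a s) = F s (f a)"
    by blast
  have "f a = g (Sha_emb R \<Omega> M a)" if "a \<in> carrier M" for a
    using that by (simp add: Sha_emb_def Sh_one_eq g_pure Sh_word_closed[OF V] Fw f_closed)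
  moreover have "g (Sha_prec R \<Omega> M \<omega> x y) = circ \<omega> (g x) (g y)"
    if \<omega>: "\<omega> \<in> \<Omega>" and xy: "x \<in> carrier S" "y \<in> carrier S" for \<omega> x y
  proof (rule spans_bilinear_eq[OF _ _ module_Sha module_Sha D _ _ _ xy])
    note sp = Sha_spans_pure[OF Sh_spans_words[OF V letters_spans]]
    show "spans R S ((\<lambda>(a, s). Sha_pure R \<Omega> M a s) ` (carrier M \<times> Sh_word R V ` lists L))"
      "spans R S ((\<lambda>(a, s). Sha_pure R \<Omega> M a s) ` (carrier M \<times> Sh_word R V ` lists L))"
      by (fact sp)+
    note p = Sha_prec_bilinear[OF \<omega>] and c = D.bilinear[OF \<omega>]
    show "bilinear_map R S S D (\<lambda>x y. g (Sha_prec R \<Omega> M \<omega> x y))"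
      by (rule bilinear_mapI) (auto intro: mod_hom_comp[OF g bilinear_map_right[OF p]] mod_hom_comp[OF g bilinear_map_left[OF p]])
    show "bilinear_map R S S D (\<lambda>x y. circ \<omega> (g x) (g y))"
      by (rule bilinear_mapI) (auto intro: bilinear_map_comp_right[OF c g] bilinear_map_comp_left[OF c g] mod_hom_closed[OF g])
    fix x y assume "x \<in> (\<lambda>(a, s). Sha_pure R \<Omega> M a s) ` (carrier M \<times> Sh_word R V ` lists L)"
      "y \<in> (\<lambda>(a, s). Sha_pure R \<Omega> M a s) ` (carrier M \<times> Sh_word R V ` lists L)"
    then obtain a u b v where x: "x = Sha_pure R \<Omega> M a (Sh_word R V u)" "a \<in> carrier M" "u \<in> lists L"
      and y: "y = Sha_pure R \<Omega> M b (Sh_word R V v)" "b \<in> carrier M" "v \<in> lists L"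
      by (auto del: listsE)
    note cl = Sh_word_closed[OF V lists_letters[OF x(3)]] Sh_word_closed[OF V lists_letters[OF y(3)]]
      Sh_cons_closed[OF V] shuffle_closed[OF V] letter_closed
    have "g (Sha_prec R \<Omega> M \<omega> x y) =
        F (shuffle_product R V (Sh_word R V u) (Sh_cons R V (letter R \<Omega> M \<omega> b) (Sh_word R V v))) (f a)"
      using x(2) y(2) \<omega> by (simp add: x(1) y(1) Sha_prec_pure g_pure cl)
    also have "\<dots> = circ \<omega> (np u (f a)) (np v (f b))"
      by (rule np_shuffle[OF F Fw x(3) y(3) \<omega> y(2) f_closed[OF x(2)]])
    also have "\<dots> = circ \<omega> (g x) (g y)"
      using x(2) y(2) by (simp add: x(1) y(1) g_pure cl Fw lists_letters[OF x(3)] lists_letters[OF y(3)] f_closed)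
    finally show "g (Sha_prec R \<Omega> M \<omega> x y) = circ \<omega> (g x) (g y)" .
  qed
  ultimately show ?thesis
    using g unfolding matching_zinbiel_hom_def by blast
qed

text \<open>Every \<open>a \<otimes> (\<omega> \<otimes> b) \<otimes> w\<close> is the product of the image of \<open>a\<close> with \<open>b \<otimes> w\<close>, so that by induction
  on the word the image of \<open>M\<close> generates.\<close>

lemma Sha_hom_unique:
  assumes g: "g \<in> matching_zinbiel_hom R \<Omega> S (Sha_prec R \<Omega> M) D circ" "\<forall>a\<in>carrier M. f a = g (Sha_emb R \<Omega> M a)"
    and h: "h \<in> matching_zinbiel_hom R \<Omega> S (Sha_prec R \<Omega> M) D circ" "\<forall>a\<in>carrier M. f a = h (Sha_emb R \<Omega> M a)"
    and x: "x \<in> carrier S"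
  shows "g x = h x"
proof (rule spans_hom_eq[OF Sha_spans_pure[OF Sh_spans_words[OF V letters_spans]] module_Sha D _ _ _ x])
  show "g \<in> mod_hom R S D" "h \<in> mod_hom R S D"
    using g(1) h(1) by (simp_all add: matching_zinbiel_hom_def)
  let ?W = "Sh_word R V"
  have "g (Sha_pure R \<Omega> M a (?W w)) = h (Sha_pure R \<Omega> M a (?W w))"
    if "w \<in> lists L" "a \<in> carrier M" for a w
    using that
  proof (induction w arbitrary: a rule: list.induct)
    case Nil
    then have "g (Sha_emb R \<Omega> M a) = h (Sha_emb R \<Omega> M a)" using g(2) h(2) by metis
    then show ?case by (simp add: Sha_emb_def Sh_one_eq)
  next
    case (Cons v w)
    then obtain \<omega> b where v: "\<omega> \<in> \<Omega>" "b \<in> carrier M" "v = letter R \<Omega> M \<omega> b" and w: "w \<in> lists L" by auto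
    note wV = lists_letters[OF w]
    have "Sha_pure R \<Omega> M a (?W (v # w)) =
        Sha_prec R \<Omega> M \<omega> (Sha_pure R \<Omega> M a (?W [])) (Sha_pure R \<Omega> M b (?W w))"
      using v Cons.prems(2) wV
      by (simp add: Sha_prec_pure Sh_word_closed[OF V] shuffle_one[OF V] Sh_cons_closed[OF V]
          letter_closed Sh_cons_word[OF V])
    moreover have "Sha_pure R \<Omega> M a (?W []) \<in> carrier S" "Sha_pure R \<Omega> M b (?W w) \<in> carrier S"
      using v Cons.prems(2) wV by (auto intro!: Sha_pure_closed Sh_word_closed[OF V])
    moreover have "g (Sha_pure R \<Omega> M a (?W [])) = h (Sha_pure R \<Omega> M a (?W []))"
      using g(2) h(2) Cons.prems(2) by (metis Sha_emb_def Sh_one_eq)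
    ultimately show ?case
      using g(1) h(1) v(1) Cons.IH[OF w v(2)] by (simp add: matching_zinbiel_hom_def)
  qed
  then show "g y = h y" if "y \<in> (\<lambda>(a, s). Sha_pure R \<Omega> M a s) ` (carrier M \<times> ?W ` lists L)" for y
    using that by (auto del: listsE)
qed

end

theorem theorem4p10:
  fixes R :: "('r, 'x) ring_scheme" and \<Omega> :: "'o set" and M :: "('r, 'm, 'y) module_scheme"
  assumes "cring R" and "\<Omega> \<noteq> {}" and "module R M"
  shows "matching_zinbiel_algebra R \<Omega> (Sha R \<Omega> M) (Sha_prec R \<Omega> M) \<and>
    Sha_emb R \<Omega> M \<in> mod_hom R M (Sha R \<Omega> M) \<and>
    (\<forall>(D :: ('r, 'd, 'z) module_scheme) circ. matching_zinbiel_algebra R \<Omega> D circ \<longrightarrow>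
      (\<forall>f \<in> mod_hom R M D.
        \<exists>!g. g \<in> extensional (carrier (Sha R \<Omega> M)) \<and>
          g \<in> matching_zinbiel_hom R \<Omega> (Sha R \<Omega> M) (Sha_prec R \<Omega> M) D circ \<and>
          (\<forall>a\<in>carrier M. f a = g (Sha_emb R \<Omega> M a))))"
proof (intro conjI allI impI ballI)
  interpret Sha_module R \<Omega> M by (rule Sha_module.intro[OF assms(3)])
  show "matching_zinbiel_algebra R \<Omega> (Sha R \<Omega> M) (Sha_prec R \<Omega> M)"
    by (rule matching_zinbiel_algebra_Sha)
  show "Sha_emb R \<Omega> M \<in> mod_hom R M (Sha R \<Omega> M)"
    by (rule Sha_emb_hom)
  fix D :: "('r, 'd, 'z) module_scheme" and circ f
  assume D: "matching_zinbiel_algebra R \<Omega> D circ" and f: "f \<in> mod_hom R M D"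
  interpret Sha_target R \<Omega> M D circ f
    by (intro Sha_target.intro Sha_target_axioms.intro Sha_module_axioms D f)
  let ?S = "Sha R \<Omega> M" and ?p = "Sha_prec R \<Omega> M"
  obtain g where g: "g \<in> matching_zinbiel_hom R \<Omega> ?S ?p D circ" "\<forall>a\<in>carrier M. f a = g (Sha_emb R \<Omega> M a)"
    using Sha_hom_exists by auto
  \<comment> \<open>Uniqueness holds among functions that are determined by their values on the carrier.\<close>
  let ?g = "restrict g (carrier ?S)"
  have "?g \<in> mod_hom R ?S D"
    by (rule mod_hom_cong[OF module_Sha, of g]) (use g(1) in \<open>auto simp: matching_zinbiel_hom_def\<close>)
  then have "?g \<in> matching_zinbiel_hom R \<Omega> ?S ?p D circ"
    using g(1) bilinear_map_closed[OF Sha_prec_bilinear] by (simp add: matching_zinbiel_hom_def)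
  moreover have "\<forall>a\<in>carrier M. f a = ?g (Sha_emb R \<Omega> M a)"
    using g(2) mod_hom_closed[OF Sha_emb_hom] by simp
  ultimately show "\<exists>!g. g \<in> extensional (carrier ?S) \<and> g \<in> matching_zinbiel_hom R \<Omega> ?S ?p D circ \<and>
      (\<forall>a\<in>carrier M. f a = g (Sha_emb R \<Omega> M a))"
  proof (intro ex1I[of _ ?g] conjI)
    fix h assume "h \<in> extensional (carrier ?S) \<and> h \<in> matching_zinbiel_hom R \<Omega> ?S ?p D circ \<and>
      (\<forall>a\<in>carrier M. f a = h (Sha_emb R \<Omega> M a))"
    then show "h = ?g"
      by (intro extensionalityI[of _ "carrier ?S"]) (auto intro: Sha_hom_unique[OF _ _ g])
  qed auto
qed

end
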